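(* For $0<\alpha\le\pi/2$, $$L(\alpha)\le C(\alpha)\le\min\Bigl\{K_{25}(\alpha),\ K_{\mathrm{BC}}(\alpha),\ \frac{\pi-\alpha}{\alpha}\Bigr\}.$$ In particular, $C(\alpha)<2$ whenever $\frac\pi6<\alpha\le\frac\pi2$.
   Context: Let $\mathcal L_\alpha=\{z\in\mathbb C:|z-i\cot\alpha|\le\csc\alpha\}\cap\{z\in\mathbb C:|z+i\cot\alpha|\le\csc\alpha\}$ and $$C(\alpha)=\sup_{\mathcal H,A}\ \sup_{p\in\mathbb C[z],\,p\ne0}\frac{\|p(A)\|}{\max_{z\in\mathcal L_\alpha}|p(z)|},$$ where the first supremum is over all complex Hilbert spaces $\mathcal H$ and all bounded operators $A$ on $\mathcal H$ with $\|A-i\cot\alpha\, I\|\le\csc\alpha$ and $\|A+i\cot\alpha\, I\|\le\csc\alpha$. Further, $$L(\alpha)=\frac{\pi\sin\alpha}{2\alpha},\qquad K_{25}(\alpha)=1-\frac\alpha\pi+\sqrt{2-\frac{4\alpha}{\pi}+\frac{\alpha^2}{\pi^2}},$$ $$\mu(\alpha)=\frac{\sin(2\alpha)}{\pi}\int_0^\infty\frac{dy}{y^2\cos\alpha-2y\cos(2\alpha)+\cos\alpha},\qquad K_{\mathrm{BC}}(\alpha)=2\,\frac{\pi-\alpha}{\pi}+\mu(\alpha).$$ The integral is positive and finite for $0<\alpha<\pi/2$; the value of $\mu$ at $\alpha=\pi/2$ is understood as a limit. *)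

theory Defs
  imports
    "HOL-Analysis.Analysis"
    "HOL-Computational_Algebra.Polynomial"
    "HOL-Algebra.Module"
    "HOL-Algebra.Algebraic_Closure_Type"
begin

section \<open>Complex Hilbert spaces with an explicit carrier\<close>

text \<open>
  The supremum defining the lens constant below ranges over all complex Hilbert spaces, so a Hilbert
  space has to be a value rather than a type: it is a complex vector space in the sense of
  \<open>HOL-Algebra\<close> (a module over the field of complex numbers, with an explicit carrier set) with
  an inner product.  The ring-multiplication fields that the record of modules inherits play no role.
\<close>

record 'u complex_inner_space = "(complex, 'u) module" +
  ip :: "'u \<Rightarrow> 'u \<Rightarrow> complex"

definition hnorm :: "'u complex_inner_space \<Rightarrow> 'u \<Rightarrow> real" where
  "hnorm H x = sqrt (Re (ip H x x))"

text \<open>The inner product is linear in its first argument; \<open>ip_cnj\<close> makes \<open>ip H x x\<close> real.\<close>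

locale complex_hilbert_space =
  Module.module "ring_of_type_algebra :: complex ring" H
  for H :: "'u complex_inner_space" (structure) +
  assumes ip_add: "\<lbrakk>x \<in> carrier H; y \<in> carrier H; z \<in> carrier H\<rbrakk>
      \<Longrightarrow> ip H (x \<oplus> y) z = ip H x z + ip H y z"
    and ip_smult: "\<lbrakk>x \<in> carrier H; y \<in> carrier H\<rbrakk> \<Longrightarrow> ip H (c \<odot> x) y = c * ip H x y"
    and ip_cnj: "\<lbrakk>x \<in> carrier H; y \<in> carrier H\<rbrakk> \<Longrightarrow> ip H y x = cnj (ip H x y)"
    and ip_nonneg: "x \<in> carrier H \<Longrightarrow> 0 \<le> Re (ip H x x)"
    and ip_definite: "\<lbrakk>x \<in> carrier H; ip H x x = 0\<rbrakk> \<Longrightarrow> x = \<zero>"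
    and complete: "\<And>s :: nat \<Rightarrow> 'u. \<lbrakk>range s \<subseteq> carrier H;
        \<forall>e>0. \<exists>N. \<forall>m\<ge>N. \<forall>n\<ge>N. hnorm H (s m \<ominus> s n) < e\<rbrakk>
      \<Longrightarrow> \<exists>l\<in>carrier H. (\<lambda>n. hnorm H (s n \<ominus> l)) \<longlonglongrightarrow> (0::real)"

text \<open>Only the values of an operator on the carrier matter in what follows.\<close>

definition bounded_operator :: "'u complex_inner_space \<Rightarrow> ('u \<Rightarrow> 'u) \<Rightarrow> bool" where
  "bounded_operator H A \<longleftrightarrow>
     A \<in> carrier H \<rightarrow> carrier H \<and>
     (\<forall>x\<in>carrier H. \<forall>y\<in>carrier H. A (x \<oplus>\<^bsub>H\<^esub> y) = A x \<oplus>\<^bsub>H\<^esub> A y) \<and>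
     (\<forall>c. \<forall>x\<in>carrier H. A (c \<odot>\<^bsub>H\<^esub> x) = c \<odot>\<^bsub>H\<^esub> A x) \<and>
     (\<exists>K. \<forall>x\<in>carrier H. hnorm H (A x) \<le> K * hnorm H x)"

definition op_norm :: "'u complex_inner_space \<Rightarrow> ('u \<Rightarrow> 'u) \<Rightarrow> real" where
  "op_norm H A = Sup {hnorm H (A x) | x. x \<in> carrier H \<and> hnorm H x \<le> 1}"

definition op_shift :: "'u complex_inner_space \<Rightarrow> ('u \<Rightarrow> 'u) \<Rightarrow> complex \<Rightarrow> 'u \<Rightarrow> 'u" where
  "op_shift H A c = (\<lambda>x. A x \<ominus>\<^bsub>H\<^esub> c \<odot>\<^bsub>H\<^esub> x)"

definition op_poly :: "'u complex_inner_space \<Rightarrow> complex poly \<Rightarrow> ('u \<Rightarrow> 'u) \<Rightarrow> 'u \<Rightarrow> 'u" where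
  "op_poly H p A =
     (\<lambda>x. \<Oplus>\<^bsub>H\<^esub>i\<in>{..Polynomial.degree p}. Polynomial.coeff p i \<odot>\<^bsub>H\<^esub> (A ^^ i) x)"


section \<open>The lens and its constant\<close>

definition lens :: "real \<Rightarrow> complex set" where
  "lens \<alpha> = {z. cmod (z - \<i> * complex_of_real (cot \<alpha>)) \<le> 1 / sin \<alpha>}
          \<inter> {z. cmod (z + \<i> * complex_of_real (cot \<alpha>)) \<le> 1 / sin \<alpha>}"

definition lens_operators :: "real \<Rightarrow> ('u complex_inner_space \<times> ('u \<Rightarrow> 'u)) set" where
  "lens_operators \<alpha> = {(H, A). complex_hilbert_space H \<and> bounded_operator H A \<and>
     op_norm H (op_shift H A (\<i> * complex_of_real (cot \<alpha>))) \<le> 1 / sin \<alpha> \<and>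
     op_norm H (op_shift H A (- (\<i> * complex_of_real (cot \<alpha>)))) \<le> 1 / sin \<alpha>}"

text \<open>
  HOL cannot quantify over types inside a term, so the type \<open>'u\<close> acts as a universe: the Hilbert
  spaces considered are those whose carrier is a set of elements of \<open>'u\<close>.  A claim about
  \<open>lens_const\<close> is to be made for every \<open>'u\<close> that is not too small to carry
  any nonzero complex vector space.  The value is an extended real because its finiteness is not
  known a priori.
\<close>

definition lens_const :: "'u itself \<Rightarrow> real \<Rightarrow> ereal" where
  "lens_const _ \<alpha> =
     (SUP (H, A) \<in> (lens_operators \<alpha> :: ('u complex_inner_space \<times> ('u \<Rightarrow> 'u)) set).
        SUP p \<in> {p :: complex poly. p \<noteq> 0}.
          ereal (op_norm H (op_poly H p A) / (SUP z\<in>lens \<alpha>. cmod (poly p z))))"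

definition L_bound :: "real \<Rightarrow> real" where
  "L_bound \<alpha> = pi * sin \<alpha> / (2 * \<alpha>)"

definition K25 :: "real \<Rightarrow> real" where
  "K25 \<alpha> = 1 - \<alpha> / pi + sqrt (2 - 4 * \<alpha> / pi + \<alpha>\<^sup>2 / pi\<^sup>2)"

definition mu_int :: "real \<Rightarrow> real" where
  "mu_int \<alpha> = sin (2 * \<alpha>) / pi *
     integral {0..} (\<lambda>y. 1 / (y\<^sup>2 * cos \<alpha> - 2 * y * cos (2 * \<alpha>) + cos \<alpha>))"

text \<open>At \<open>\<pi>/2\<close> the integral diverges, and the value is the limit from the left.\<close>

definition mu :: "real \<Rightarrow> real" where
  "mu \<alpha> = (if \<alpha> = pi / 2 then Lim (at_left (pi / 2)) mu_int else mu_int \<alpha>)"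

definition K_BC :: "real \<Rightarrow> real" where
  "K_BC \<alpha> = 2 * ((pi - \<alpha>) / pi) + mu \<alpha>"

end

theory Submission
  imports Defs "HOL-Complex_Analysis.Complex_Analysis" "HOL-Library.Function_Algebras" "HOL-Real_Asymp.Real_Asymp"
begin

text \<open>
  The map \<open>z \<mapsto> (1 + z) / (1 - z) = exp \<zeta>\<close> takes the lens to the strip \<open>\<bar>Im \<zeta>\<bar> < \<alpha>\<close>, and it turns the
  two disc conditions on an operator into two half-plane conditions on its Cayley transform \<open>W\<close>.
  Throughout, \<open>k = 1 - \<alpha>/\<pi>\<close> and \<open>a = 1 - 2\<alpha>/\<pi>\<close>, so that \<open>K25 \<alpha> = k + sqrt (k\<^sup>2 + a)\<close>.  Elementary
  estimates show that \<open>K25\<close> is the smallest of the three upper bounds and is below 2 for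
  \<open>\<alpha> > \<pi>/6\<close>; the remaining tasks are the upper bound \<open>K25\<close> and the lower bound.

  Upper bound.  Let \<open>\<phi>\<close> be holomorphic on the strip with \<open>\<bar>\<phi>\<bar> \<le> 1\<close>.  Integrate \<open>\<phi>\<close> over the two edges
  against the real part of the Cauchy kernel of \<open>W\<close>.  By the half-plane conditions this kernel is positive,
  and its total mass is \<open>2k\<close>, so the integral has norm at most \<open>2k\<close> (\<open>dual_sum_bound\<close>).  By Cauchy's theorem
  the integral equals \<open>\<phi>(W) + g(W)\<^sup>*\<close>, where \<open>g\<close> is the convolution of the reflected function \<open>\<phi>\<close> with
  an explicit positive kernel of mass \<open>a\<close> (\<open>strip_identity\<close>); hence \<open>\<bar>g\<bar> \<le> a\<close>.  Let \<open>K\<close> be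
  the best constant in \<open>\<parallel>\<phi>(W)\<parallel> \<le> K sup \<bar>\<phi>\<bar>\<close>.  If \<open>\<parallel>\<phi>(W)\<parallel> = K\<close> is attained at a unit vector \<open>u\<close>, then
  \<open>\<phi>(W)\<^sup>*\<phi>(W) u = K\<^sup>2 u\<close>, and so \<open>K\<^sup>2 \<phi>(W) u = \<phi>(W) (\<phi>(W)\<^sup>* + g(W)) \<phi>(W) u - (\<phi> g \<phi>)(W) u\<close> yields
  \<open>K\<^sup>3 \<le> 2 k K\<^sup>2 + a K\<close>, that is, \<open>K \<le> K25 \<alpha>\<close>.  The lemma \<open>nearly_maximal_vector\<close> is the version for
  vectors at which the norm is almost attained.

  This argument needs \<open>K < \<infinity>\<close> beforehand, and it needs all bounded holomorphic functions to act, because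
  \<open>g\<close> is no polynomial.  Both hold for diagonal operators with finitely many eigenvalues inside the strip,
  written in a basis that need not be orthogonal (\<open>sector_gram\<close>).  A general \<open>A\<close> is reduced to this
  case as follows.  A vector \<open>x\<close> gives a form \<open>(p, q) \<mapsto> \<langle>p(A) x, q(A) x\<rangle>\<close> on polynomials, made definite
  by a small multiple of a sum of point evaluations in the lens.  The compression of multiplication by \<open>z\<close> to
  polynomials of degree less than \<open>m\<close> is multiplication modulo the monic orthogonal polynomial of
  degree \<open>m\<close>.  Once the roots of that polynomial have been made distinct by a small perturbation, which
  is absorbed by a contraction by a factor \<open>\<rho> < 1\<close>, the compression is diagonal in the Lagrange basis at
  the roots (\<open>dilated_polynomial_bound\<close>).  Letting the added form and \<open>1 - \<rho>\<close> tend to 0 gives the bound for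
  \<open>p(A) x\<close> (\<open>polynomial_operator_bound\<close>).

  Lower bound.  The nilpotent matrix on \<open>\<complex>\<^sup>2\<close> with off-diagonal entry \<open>sin \<alpha>\<close> satisfies both disc
  conditions, and \<open>p\<close> of it has off-diagonal entry \<open>p'(0) sin \<alpha>\<close>.  The conformal map of the lens onto the unit
  disc, \<open>(w\<^sup>\<beta> - 1) / (w\<^sup>\<beta> + 1)\<close> with \<open>w = (1 + z) / (1 - z)\<close> and \<open>\<beta> = \<pi> / (2\<alpha>)\<close>, has derivative \<open>\<beta>\<close>
  at 0 and is approximated by polynomials (\<open>lens_extremal_polynomial\<close>).  The product \<open>\<beta> sin \<alpha>\<close> is
  \<open>L_bound \<alpha>\<close>.
\<close>


section \<open>Comparing the three upper bounds\<close>

lemma K25_eq: "K25 \<alpha> = (1 - \<alpha> / pi) + sqrt ((1 - \<alpha> / pi)\<^sup>2 + (1 - 2 * \<alpha> / pi))"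
  by (simp add: K25_def power2_diff power_divide algebra_simps)

lemma K25_nonneg:
  assumes "0 < \<alpha>" "\<alpha> \<le> pi / 2"
  shows "0 \<le> K25 \<alpha>"
proof -
  have "0 \<le> 1 - \<alpha> / pi" "0 \<le> 1 - 2 * \<alpha> / pi" using assms by (simp_all add: field_simps)
  then show ?thesis by (simp add: K25_eq)
qed

lemma cos_double_less_cos:
  fixes \<alpha> :: real
  assumes "0 < \<alpha>" "\<alpha> < pi / 2"
  shows "cos (2 * \<alpha>) < cos \<alpha>"
  using assms by (intro cos_monotone_0_pi) auto

lemma integral_halfline_kernel:
  assumes "0 < \<theta>" "\<theta> < pi"
  shows "set_integrable lborel {0<..} (\<lambda>y. sin \<theta> / (y\<^sup>2 - 2 * y * cos \<theta> + 1))"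
    and "(LINT y:{0<..}|lborel. sin \<theta> / (y\<^sup>2 - 2 * y * cos \<theta> + 1)) = pi - \<theta>"
proof -
  have s: "sin \<theta> > 0" using assms by (rule sin_gt_zero)
  have eq: "y\<^sup>2 - 2 * y * cos \<theta> + 1 = (y - cos \<theta>)\<^sup>2 + (sin \<theta>)\<^sup>2" for y
    using sin_cos_squared_add[of \<theta>] by (simp add: power2_diff algebra_simps)
  have pos: "y\<^sup>2 - 2 * y * cos \<theta> + 1 > 0" for y
    unfolding eq using s by (intro add_nonneg_pos) auto
  define F where "F = (\<lambda>y. arctan ((y - cos \<theta>) / sin \<theta>))"
  have der: "DERIV F y :> sin \<theta> / (y\<^sup>2 - 2 * y * cos \<theta> + 1)" for y
  proof -
    have "DERIV F y :> (1 / sin \<theta>) * inverse (1 + ((y - cos \<theta>) / sin \<theta>)\<^sup>2)"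
      unfolding F_def using s by (auto intro!: derivative_eq_intros)
    also have "1 + ((y - cos \<theta>) / sin \<theta>)\<^sup>2 = (y\<^sup>2 - 2 * y * cos \<theta> + 1) / (sin \<theta>)\<^sup>2"
      unfolding eq using s by (simp add: power_divide add_divide_distrib)
    also have "(1 / sin \<theta>) * inverse ((y\<^sup>2 - 2 * y * cos \<theta> + 1) / (sin \<theta>)\<^sup>2) = sin \<theta> / (y\<^sup>2 - 2 * y * cos \<theta> + 1)"
      using s by (simp add: power2_eq_square)
    finally show ?thesis .
  qed
  have lim1: "((F \<circ> real_of_ereal) \<longlongrightarrow> \<theta> - pi / 2) (at_right (ereal 0))"
  proof -
    have "(F \<longlongrightarrow> F 0) (at_right 0)"
      using DERIV_isCont[OF der[of 0]] by (simp add: isCont_def filterlim_at_split)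
    moreover have "F 0 = \<theta> - pi / 2"
    proof -
      have "(0 - cos \<theta>) / sin \<theta> = tan (\<theta> - pi / 2)"
        using s by (simp add: tan_def sin_diff cos_diff)
      moreover have "arctan (tan (\<theta> - pi / 2)) = \<theta> - pi / 2"
        using assms by (intro arctan_tan) auto
      ultimately show ?thesis by (simp add: F_def)
    qed
    ultimately show ?thesis by (simp add: ereal_tendsto_simps)
  qed
  have lim2: "((F \<circ> real_of_ereal) \<longlongrightarrow> pi / 2) (at_left \<infinity>)"
  proof -
    have "filterlim (\<lambda>y. (y - cos \<theta>) / sin \<theta>) at_top at_top" using s by real_asymp
    then have "(F \<longlongrightarrow> pi / 2) at_top"
      unfolding F_def by (rule filterlim_compose[OF tendsto_arctan_at_top])
    then show ?thesis by (simp add: ereal_tendsto_simps)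
  qed
  have cont: "isCont (\<lambda>y. sin \<theta> / (y\<^sup>2 - 2 * y * cos \<theta> + 1)) y" for y
    using pos[of y] by (intro continuous_intros) auto
  have ei: "einterval (ereal 0) \<infinity> = {0<..}" by (auto simp: einterval_def)
  note FTC = interval_integral_FTC_nonneg[of "ereal 0" \<infinity> F, OF _ der cont _ lim1 lim2]
  have nn: "AE y in lborel. ereal 0 < ereal y \<longrightarrow> ereal y < \<infinity> \<longrightarrow> 0 \<le> sin \<theta> / (y\<^sup>2 - 2 * y * cos \<theta> + 1)"
    using s pos by (auto intro!: AE_I2 divide_nonneg_pos)
  show "set_integrable lborel {0<..} (\<lambda>y. sin \<theta> / (y\<^sup>2 - 2 * y * cos \<theta> + 1))"
    using FTC(1)[OF _ nn] unfolding ei by simp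
  have "(LBINT y=ereal 0..\<infinity>. sin \<theta> / (y\<^sup>2 - 2 * y * cos \<theta> + 1)) = pi / 2 - (\<theta> - pi / 2)"
    by (rule FTC(2)[OF _ nn]) simp
  then show "(LINT y:{0<..}|lborel. sin \<theta> / (y\<^sup>2 - 2 * y * cos \<theta> + 1)) = pi - \<theta>"
    by (simp add: interval_lebesgue_integral_def ei[unfolded zero_ereal_def[symmetric]] zero_ereal_def[symmetric])
qed

context
  fixes \<alpha> :: real
  assumes \<alpha>: "0 < \<alpha>" "\<alpha> < pi / 2"
begin

definition mu_den :: "real \<Rightarrow> real \<Rightarrow> real" where
  "mu_den a y = y\<^sup>2 * cos a - 2 * y * cos (2 * a) + cos a"

lemma mu_den_lower:
  assumes "y > 0"
  shows "(cos \<alpha> - max (cos (2 * \<alpha>)) 0) * (y\<^sup>2 + 1) \<le> mu_den \<alpha> y" and "mu_den \<alpha> y > 0"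
proof -
  have cpos: "cos \<alpha> > 0" using \<alpha> by (intro cos_gt_zero_pi) auto
  have "2 * y \<le> y\<^sup>2 + 1" using zero_le_power2[of "y - 1"] by (simp add: power2_diff)
  have "2 * y * cos (2 * \<alpha>) \<le> 2 * y * max (cos (2 * \<alpha>)) 0" using assms by (intro mult_left_mono) auto
  also have "\<dots> \<le> (y\<^sup>2 + 1) * max (cos (2 * \<alpha>)) 0"
    using \<open>2 * y \<le> y\<^sup>2 + 1\<close> by (intro mult_right_mono) auto
  finally show *: "(cos \<alpha> - max (cos (2 * \<alpha>)) 0) * (y\<^sup>2 + 1) \<le> mu_den \<alpha> y"
    by (simp add: mu_den_def algebra_simps)
  have "0 < (cos \<alpha> - max (cos (2 * \<alpha>)) 0) * (y\<^sup>2 + 1)"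
    using cos_double_less_cos[OF \<alpha>] cpos by (intro mult_pos_pos add_nonneg_pos) (auto simp: max_def)
  with * show "mu_den \<alpha> y > 0" by linarith
qed

lemma integrable_inverse_mu_den: "set_integrable lborel {0<..} (\<lambda>y. 1 / mu_den \<alpha> y)"
proof (rule set_integrable_bound)
  define d where "d = cos \<alpha> - max (cos (2 * \<alpha>)) 0"
  have cpos: "cos \<alpha> > 0" using \<alpha> by (intro cos_gt_zero_pi) auto
  have d: "d > 0" using cos_double_less_cos[OF \<alpha>] cpos by (auto simp: d_def max_def)
  have "set_integrable lborel {0<..} (\<lambda>y. sin (pi / 2) / (y\<^sup>2 - 2 * y * cos (pi / 2) + 1))"
    by (rule integral_halfline_kernel) auto
  then have "set_integrable lborel {0<..} (\<lambda>y. 1 / d * (1 / (y\<^sup>2 + 1)))" by (intro set_integrable_mult_right) simp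
  then show "set_integrable lborel {0<..} (\<lambda>y. 1 / d * (1 / (y\<^sup>2 + 1)))" .
  show "set_borel_measurable lborel {0<..} (\<lambda>y. 1 / mu_den \<alpha> y)"
    unfolding set_borel_measurable_def mu_den_def by measurable
  show "AE y in lborel. y \<in> {0<..} \<longrightarrow> norm (1 / mu_den \<alpha> y) \<le> norm (1 / d * (1 / (y\<^sup>2 + 1)))"
  proof (intro AE_I2 impI)
    fix y :: real assume "y \<in> {0<..}"
    then have y: "y > 0" by simp
    have "0 < y\<^sup>2 + 1" by (intro add_nonneg_pos) auto
    then have "1 / mu_den \<alpha> y \<le> 1 / (d * (y\<^sup>2 + 1))"
      using mu_den_lower[OF y] d by (intro divide_left_mono mult_pos_pos) (auto simp: d_def)
    then show "norm (1 / mu_den \<alpha> y) \<le> norm (1 / d * (1 / (y\<^sup>2 + 1)))"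
      using mu_den_lower(2)[OF y] d \<open>0 < y\<^sup>2 + 1\<close> by simp
  qed
qed

lemma mu_int_eq: "mu_int \<alpha> = sin (2 * \<alpha>) / pi * (LINT y:{0<..}|lborel. 1 / mu_den \<alpha> y)"
proof -
  have "(LINT y:{0<..}|lborel. 1 / mu_den \<alpha> y) = integral {0<..} (\<lambda>y. 1 / mu_den \<alpha> y)"
    by (rule set_borel_integral_eq_integral(2)[OF integrable_inverse_mu_den])
  also have "\<dots> = integral {0..} (\<lambda>y. 1 / mu_den \<alpha> y)"
    by (rule integral_spike_set; rule negligible_subset[of "{0}"]) auto
  finally show ?thesis by (simp add: mu_int_def mu_den_def)
qed

lemma sin_double_pos: "sin (2 * \<alpha>) > 0"
  using \<alpha> by (intro sin_gt_zero) auto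

text \<open>Replacing the coefficient \<open>cos \<alpha>\<close> of \<open>y\<^sup>2 + 1\<close> by 1 increases the denominator and leaves an
  integral with the value \<open>\<pi> - 2\<alpha>\<close>.\<close>

lemma mu_int_lower: "1 - 2 * \<alpha> / pi \<le> mu_int \<alpha>"
proof -
  note s = sin_double_pos
  have \<theta>: "0 < 2 * \<alpha>" "2 * \<alpha> < pi" using \<alpha> by auto
  note hk = integral_halfline_kernel[OF \<theta>]
  have "pi - 2 * \<alpha> = (LINT y:{0<..}|lborel. sin (2 * \<alpha>) / (y\<^sup>2 - 2 * y * cos (2 * \<alpha>) + 1))" by (rule hk(2)[symmetric])
  also have "\<dots> \<le> (LINT y:{0<..}|lborel. sin (2 * \<alpha>) * (1 / mu_den \<alpha> y))"
  proof (rule set_integral_mono[OF hk(1) set_integrable_mult_right[OF integrable_inverse_mu_den]])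
    fix y :: real assume "y \<in> {0<..}"
    then have y: "y > 0" by simp
    have "(y\<^sup>2 + 1) * cos \<alpha> \<le> (y\<^sup>2 + 1) * 1" by (intro mult_left_mono) (auto simp: add_nonneg_nonneg)
    then have "mu_den \<alpha> y \<le> y\<^sup>2 - 2 * y * cos (2 * \<alpha>) + 1" by (simp add: mu_den_def algebra_simps)
    then show "sin (2 * \<alpha>) / (y\<^sup>2 - 2 * y * cos (2 * \<alpha>) + 1) \<le> sin (2 * \<alpha>) * (1 / mu_den \<alpha> y)"
      using mu_den_lower(2)[OF y] s by (simp add: frac_le)
  qed
  also have "\<dots> = sin (2 * \<alpha>) * (LINT y:{0<..}|lborel. 1 / mu_den \<alpha> y)"
    by (rule set_integral_mult_right)
  also have "\<dots> = mu_int \<alpha> * pi" unfolding mu_int_eq using pi_gt_zero by simp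
  finally have "(pi - 2 * \<alpha>) / pi \<le> mu_int \<alpha>" by (simp only: pos_divide_le_eq[OF pi_gt_zero])
  then show ?thesis by (simp add: diff_divide_distrib)
qed

text \<open>A bound of order \<open>c ln (1/c)\<close> with \<open>c = cos \<alpha>\<close>, which vanishes at \<open>\<pi>/2\<close>.  The
  condition \<open>\<alpha> > \<pi>/3\<close> means \<open>4c\<^sup>2 < 1\<close>; then \<open>-2 cos 2\<alpha> \<ge> 1\<close>, so the integrand is at most
  \<open>1 / (c y\<^sup>2 + y + c)\<close>, which has two real poles and a logarithm as antiderivative.\<close>

lemma mu_int_upper:
  assumes "pi / 3 < \<alpha>"
  defines "D \<equiv> sqrt (1 - 4 * (cos \<alpha>)\<^sup>2)"
  shows "mu_int \<alpha> \<le> cos \<alpha> * (2 / D * (ln (1 + D) - ln (2 * cos \<alpha>)))"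
proof -
  define c where "c = cos \<alpha>"
  have cpos: "c > 0" unfolding c_def using \<alpha> by (intro cos_gt_zero_pi) auto
  have "cos \<alpha> < cos (pi / 3)" by (rule cos_monotone_0_pi) (use assms(1) \<alpha> in auto)
  then have chalf: "c < 1 / 2" by (simp only: c_def cos_60)
  have "c\<^sup>2 < (1 / 2)\<^sup>2" using chalf cpos by (intro power_strict_mono) auto
  then have c4: "4 * c\<^sup>2 < 1" by (simp only: power_divide) simp
  have D: "0 < D" "D\<^sup>2 = 1 - 4 * c\<^sup>2" unfolding D_def c_def[symmetric] using c4 by simp_all
  have "D\<^sup>2 < 1\<^sup>2" unfolding D(2) using cpos by simp
  then have D1: "D < 1" by (rule power2_less_imp_less) simp
  have "cos (2 * \<alpha>) = 2 * c\<^sup>2 - 1" unfolding c_def by (rule cos_double_cos)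
  then have cos2: "- 2 * cos (2 * \<alpha>) \<ge> 1" using c4 by linarith
  define F where "F = (\<lambda>y. 1 / D * (ln (2 * c * y + 1 - D) - ln (2 * c * y + 1 + D)))"
  have posden: "c * y\<^sup>2 + y + c > 0" if "y > 0" for y
    using that cpos by (intro add_pos_pos mult_pos_pos) auto
  have der: "DERIV F y :> 1 / (c * y\<^sup>2 + y + c)" if y: "y > 0" for y
  proof -
    define a where "a = 2 * c * y"
    have a: "a > 0" using cpos y by (simp add: a_def)
    have nz: "a + 1 - D > 0" "a + 1 + D > 0" using a D1 D(1) by linarith+
    have "DERIV F y :> 1 / D * (2 * c / (a + 1 - D) - 2 * c / (a + 1 + D))"
      unfolding F_def a_def using nz[unfolded a_def] D(1) by (auto intro!: derivative_eq_intros)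
    also have "1 / D * (2 * c / (a + 1 - D) - 2 * c / (a + 1 + D)) = 4 * c / ((a + 1 - D) * (a + 1 + D))"
    proof -
      have "2 * c / (a + 1 - D) - 2 * c / (a + 1 + D) = 4 * c * D / ((a + 1 - D) * (a + 1 + D))"
        using nz by (simp add: divide_simps) (simp add: algebra_simps)
      then show ?thesis using D(1) by simp
    qed
    also have "(a + 1 - D) * (a + 1 + D) = 4 * c * (c * y\<^sup>2 + y + c)"
    proof -
      have "(a + 1 - D) * (a + 1 + D) = a\<^sup>2 + 2 * a + 1 - D\<^sup>2" by (simp add: power2_eq_square algebra_simps)
      also have "\<dots> = 4 * c * (c * y\<^sup>2 + y + c)"
        unfolding D(2) a_def by (simp add: power2_eq_square algebra_simps)
      finally show ?thesis .
    qed
    also have "4 * c / (4 * c * (c * y\<^sup>2 + y + c)) = 1 / (c * y\<^sup>2 + y + c)" using cpos by simp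
    finally show ?thesis .
  qed
  have lim1: "((F \<circ> real_of_ereal) \<longlongrightarrow> 1 / D * (ln (1 - D) - ln (1 + D))) (at_right (ereal 0))"
  proof -
    have "(F \<longlongrightarrow> 1 / D * (ln (2 * c * 0 + 1 - D) - ln (2 * c * 0 + 1 + D))) (at_right 0)"
      unfolding F_def using D(1) D1 by (intro tendsto_intros) auto
    then show ?thesis by (simp add: ereal_tendsto_simps)
  qed
  have lim2: "((F \<circ> real_of_ereal) \<longlongrightarrow> 0) (at_left \<infinity>)"
  proof -
    have "((\<lambda>y. ln (2 * c * y + (1 - D)) - ln (2 * c * y + (1 + D))) \<longlongrightarrow> 0) at_top"
      using cpos D(1) by real_asymp
    from tendsto_mult_left[OF this, of "1 / D"] have "(F \<longlongrightarrow> 0) at_top"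
      by (simp add: F_def algebra_simps)
    then show ?thesis by (simp add: ereal_tendsto_simps)
  qed
  have cont: "isCont (\<lambda>y. 1 / (c * y\<^sup>2 + y + c)) y" if "y > 0" for y
    using posden[OF that] by (intro continuous_intros) auto
  have ei: "einterval (ereal 0) \<infinity> = {0<..}" by (auto simp: einterval_def)
  have nn: "AE y in lborel. ereal 0 < ereal y \<longrightarrow> ereal y < \<infinity> \<longrightarrow> 0 \<le> 1 / (c * y\<^sup>2 + y + c)"
    using posden by (intro AE_I2) (auto intro: less_imp_le)
  note FTC = interval_integral_FTC_nonneg[of "ereal 0" \<infinity> F, OF _ _ _ nn lim1 lim2]
  have int: "set_integrable lborel {0<..} (\<lambda>y. 1 / (c * y\<^sup>2 + y + c))"
    using FTC(1) der cont unfolding ei by simp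
  have "(LBINT y=ereal 0..\<infinity>. 1 / (c * y\<^sup>2 + y + c)) = 0 - 1 / D * (ln (1 - D) - ln (1 + D))"
    by (rule FTC(2)) (use der cont in auto)
  then have val0: "(LINT y:{0<..}|lborel. 1 / (c * y\<^sup>2 + y + c)) = 1 / D * (ln (1 + D) - ln (1 - D))"
    by (simp add: interval_lebesgue_integral_def ei[unfolded zero_ereal_def[symmetric]] zero_ereal_def[symmetric]
        right_diff_distrib)
  have lnsum: "ln (1 - D) + ln (1 + D) = 2 * ln (2 * c)"
  proof -
    have "ln (1 - D) + ln (1 + D) = ln ((1 - D) * (1 + D))" using D(1) D1 by (simp add: ln_mult)
    also have "(1 - D) * (1 + D) = (2 * c)\<^sup>2" using D(2) by (simp add: power2_eq_square algebra_simps)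
    also have "ln ((2 * c)\<^sup>2) = 2 * ln (2 * c)" using cpos ln_realpow[of "2 * c" 2] by (simp del: power_mult_distrib)
    finally show ?thesis .
  qed
  have alg: "v - u = 2 * (v - w)" if "u + v = 2 * w" for u v w :: real using that by simp
  have val: "(LINT y:{0<..}|lborel. 1 / (c * y\<^sup>2 + y + c)) = 2 / D * (ln (1 + D) - ln (2 * c))"
    unfolding val0 alg[OF lnsum] by simp
  have le: "(LINT y:{0<..}|lborel. 1 / mu_den \<alpha> y) \<le> (LINT y:{0<..}|lborel. 1 / (c * y\<^sup>2 + y + c))"
  proof (rule set_integral_mono[OF integrable_inverse_mu_den int])
    fix y :: real assume "y \<in> {0<..}"
    then have y: "y > 0" by simp
    have "y * 1 \<le> y * (- 2 * cos (2 * \<alpha>))" using y cos2 by (intro mult_left_mono) auto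
    then have "c * y\<^sup>2 + y + c \<le> mu_den \<alpha> y" by (simp add: mu_den_def c_def algebra_simps)
    then show "1 / mu_den \<alpha> y \<le> 1 / (c * y\<^sup>2 + y + c)" using posden[OF y] by (simp add: frac_le)
  qed
  have "ln (2 * c) \<le> ln (1 + D)" using cpos chalf D(1) by simp
  then have nonneg: "0 \<le> 2 / D * (ln (1 + D) - ln (2 * c))" using D(1) by simp
  have "mu_int \<alpha> \<le> sin (2 * \<alpha>) / pi * (2 / D * (ln (1 + D) - ln (2 * c)))"
    unfolding mu_int_eq using le sin_double_pos by (intro mult_left_mono) (auto simp: val)
  also have "\<dots> \<le> c * (2 / D * (ln (1 + D) - ln (2 * c)))"
  proof (rule mult_right_mono[OF _ nonneg])
    have "2 * sin \<alpha> \<le> pi" using pi_gt3 sin_le_one[of \<alpha>] by linarith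
    then have "2 * sin \<alpha> * c \<le> pi * c" by (rule mult_right_mono) (use cpos in simp)
    moreover have "sin (2 * \<alpha>) = 2 * sin \<alpha> * c" by (simp only: sin_double c_def)
    ultimately have "sin (2 * \<alpha>) \<le> c * pi" by (simp only: mult.commute[of c pi])
    then show "sin (2 * \<alpha>) / pi \<le> c" by (simp only: pos_divide_le_eq[OF pi_gt_zero])
  qed
  finally show ?thesis by (simp add: c_def)
qed

end

text \<open>The factor \<open>sin 2\<alpha>\<close> wins over the divergence of the integral: the lower and the upper bound for
  \<open>mu_int\<close> both tend to 0.\<close>

lemma mu_half_pi: "mu (pi / 2) = 0"
proof -
  have "(mu_int \<longlongrightarrow> 0) (at_left (pi / 2))"
  proof (rule tendsto_sandwich)
    have ev: "\<forall>\<^sub>F a in at_left (pi / 2). a \<in> {pi / 3<..<pi / 2}" by (rule eventually_at_left_real) simp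
    show "\<forall>\<^sub>F a in at_left (pi / 2). 0 \<le> mu_int a"
      using ev
    proof eventually_elim
      case (elim a)
      then have a: "0 < a" "a < pi / 2" using pi_gt_zero by (auto intro: less_trans[of 0 "pi / 3"])
      have "0 \<le> 1 - 2 * a / pi" using a by (simp add: field_simps)
      then show ?case using mu_int_lower[OF a] by linarith
    qed
    define h where "h = (\<lambda>c::real. c * (2 / sqrt (1 - 4 * c\<^sup>2) * (ln (1 + sqrt (1 - 4 * c\<^sup>2)) - ln (2 * c))))"
    show "\<forall>\<^sub>F a in at_left (pi / 2). mu_int a \<le> h (cos a)"
      using ev
    proof eventually_elim
      case (elim a)
      then have a: "0 < a" "a < pi / 2" "pi / 3 < a" using pi_gt_zero by (auto intro: less_trans[of 0 "pi / 3"])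
      show ?case unfolding h_def by (rule mu_int_upper[OF a])
    qed
    have "(h \<longlongrightarrow> 0) (at_right 0)"
    proof -
      have "((\<lambda>c::real. c * ln (2 * c)) \<longlongrightarrow> 0) (at_right 0)" by real_asymp
      moreover have "((\<lambda>c::real. c) \<longlongrightarrow> 0) (at_right 0)" by (rule tendsto_ident_at)
      ultimately have "((\<lambda>c::real. 2 / sqrt (1 - 4 * c\<^sup>2) * (c * ln (1 + sqrt (1 - 4 * c\<^sup>2)) - c * ln (2 * c)))
         \<longlongrightarrow> 2 / sqrt (1 - 4 * 0\<^sup>2) * (0 * ln (1 + sqrt (1 - 4 * 0\<^sup>2)) - 0)) (at_right 0)"
        by (intro tendsto_intros) auto
      then show ?thesis by (simp add: h_def algebra_simps)
    qed
    moreover have "filterlim cos (at_right 0) (at_left (pi / 2))"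
      unfolding filterlim_at
    proof
      show "\<forall>\<^sub>F a in at_left (pi / 2). cos a \<in> {0<..} \<and> cos a \<noteq> 0"
        using ev
      proof eventually_elim
        case (elim a)
        then have "cos a > 0" using pi_gt_zero by (intro cos_gt_zero_pi) auto
        then show ?case by simp
      qed
      have "(cos \<longlongrightarrow> cos (pi / 2)) (at_left (pi / 2 :: real))" by (intro tendsto_intros)
      then show "(cos \<longlongrightarrow> 0) (at_left (pi / 2 :: real))" by simp
    qed
    ultimately show "((\<lambda>a. h (cos a)) \<longlongrightarrow> 0) (at_left (pi / 2))" by (rule filterlim_compose)
  qed auto
  from tendsto_Lim[OF trivial_limit_at_left_real this] show ?thesis by (simp add: mu_def)
qed

text \<open>Since \<open>2k = 1 + a\<close>, one has \<open>k\<^sup>2 + a \<le> (k + a)\<^sup>2\<close> and hence \<open>K25 \<le> 2k + a\<close>; the lower bound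
  \<open>a \<le> \<mu>\<close> does the rest.\<close>

lemma K25_le_K_BC:
  assumes \<alpha>: "0 < \<alpha>" "\<alpha> \<le> pi / 2"
  shows "K25 \<alpha> \<le> K_BC \<alpha>"
proof -
  define k a where "k = 1 - \<alpha> / pi" and "a = 1 - 2 * \<alpha> / pi"
  have ka: "k \<ge> 0" "a \<ge> 0" "2 * k = 1 + a" using \<alpha> by (simp_all add: k_def a_def field_simps)
  have mu: "a \<le> mu \<alpha>"
  proof (cases "\<alpha> = pi / 2")
    case True
    show ?thesis unfolding a_def True mu_half_pi by simp
  next
    case False
    then show ?thesis using mu_int_lower[of \<alpha>] \<alpha> by (simp add: mu_def a_def)
  qed
  have "sqrt (k\<^sup>2 + a) \<le> k + a"
  proof (rule real_le_lsqrt)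
    have "(k + a)\<^sup>2 = k\<^sup>2 + a * (2 * k) + a\<^sup>2" by (simp add: power2_sum algebra_simps)
    also have "a * (2 * k) = a + a\<^sup>2" unfolding ka(3) by (simp add: power2_eq_square algebra_simps)
    finally show "k\<^sup>2 + a \<le> (k + a)\<^sup>2" using zero_le_power2[of a] by linarith
  qed (use ka in auto)
  then have "K25 \<alpha> \<le> 2 * k + a" by (simp add: K25_eq k_def a_def)
  also have "\<dots> \<le> K_BC \<alpha>" using mu by (simp add: K_BC_def k_def diff_divide_distrib)
  finally show ?thesis .
qed

text \<open>With \<open>t = \<alpha>/\<pi>\<close>, the square root is compared with \<open>(1 - t)\<^sup>2 / t\<close>; the difference of the squares
  is itself a square.\<close>

lemma K25_le_ratio:
  assumes \<alpha>: "0 < \<alpha>" "\<alpha> \<le> pi / 2"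
  shows "K25 \<alpha> \<le> (pi - \<alpha>) / \<alpha>"
proof -
  define t where "t = \<alpha> / pi"
  have t: "t > 0" "t \<le> 1 / 2" using \<alpha> by (simp_all add: t_def field_simps)
  have "sqrt ((1 - t)\<^sup>2 + (1 - 2 * t)) \<le> (1 - t)\<^sup>2 / t"
  proof (rule real_le_lsqrt)
    have "((1 - t)\<^sup>2 / t)\<^sup>2 - ((1 - t)\<^sup>2 + (1 - 2 * t)) = ((1 - 2 * t) / t)\<^sup>2"
      using t(1) by (simp add: divide_simps power2_eq_square) (simp add: algebra_simps)
    then show "(1 - t)\<^sup>2 + (1 - 2 * t) \<le> ((1 - t)\<^sup>2 / t)\<^sup>2" using zero_le_power2[of "(1 - 2 * t) / t"] by linarith
  qed (use t in auto)
  then have "K25 \<alpha> \<le> (1 - t) + (1 - t)\<^sup>2 / t" by (simp add: K25_eq t_def)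
  also have "\<dots> = (1 - t) / t" using t(1) by (simp add: power2_eq_square field_simps)
  also have "\<dots> = (pi - \<alpha>) / \<alpha>" using \<alpha>(1) by (simp add: t_def field_simps)
  finally show ?thesis .
qed

text \<open>With \<open>t = \<alpha>/\<pi>\<close>, the radicand is less than \<open>(1 + t)\<^sup>2\<close> exactly when \<open>t > 1/6\<close>.\<close>

lemma K25_less_2:
  assumes "pi / 6 < \<alpha>" "\<alpha> \<le> pi / 2"
  shows "K25 \<alpha> < 2"
proof -
  define t where "t = \<alpha> / pi"
  have t: "t > 1 / 6" using assms by (simp add: t_def field_simps)
  have "sqrt ((1 - t)\<^sup>2 + (1 - 2 * t)) < sqrt ((1 + t)\<^sup>2)"
    using t by (intro real_sqrt_less_mono) (simp add: power2_eq_square algebra_simps)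
  also have "\<dots> = 1 + t" using t by simp
  finally show ?thesis by (simp add: K25_eq t_def)
qed


section \<open>Semi-inner products and a nearly maximal vector\<close>

text \<open>The optimal \<open>t = sqrt (b / a)\<close> makes sense only for positive \<open>a\<close> and \<open>b\<close>, so both are increased
  by \<open>e > 0\<close>, and then \<open>e\<close> tends to 0.\<close>

lemma le_geometric_mean:
  fixes x k a b :: real
  assumes "\<And>t. t > 0 \<Longrightarrow> x \<le> k * (t * a + b / t)" and "k \<ge> 0" "a \<ge> 0" "b \<ge> 0"
  shows "x \<le> 2 * k * (sqrt a * sqrt b)"
proof -
  have *: "x \<le> 2 * k * (sqrt (a + e) * sqrt (b + e))" if "e > 0" for e :: real
  proof -
    define p q where "p = sqrt (a + e)" and "q = sqrt (b + e)"
    have pq: "p > 0" "q > 0" "a \<le> p\<^sup>2" "b \<le> q\<^sup>2"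
      using that assms by (auto simp: p_def q_def)
    have "q / p * a \<le> p * q"
      using mult_left_mono[OF pq(3), of "q / p"] pq(1,2) by (simp add: power2_eq_square mult.commute)
    moreover have "b / (q / p) \<le> p * q"
      using mult_left_mono[OF pq(4), of "p / q"] pq(1,2) by (simp add: power2_eq_square mult.commute)
    ultimately have "q / p * a + b / (q / p) \<le> 2 * (p * q)" by linarith
    then have "k * (q / p * a + b / (q / p)) \<le> k * (2 * (p * q))"
      by (rule mult_left_mono) (rule assms(2))
    moreover have "x \<le> k * (q / p * a + b / (q / p))"
      by (rule assms(1)) (use pq in simp)
    ultimately show ?thesis by (simp add: p_def q_def mult_ac)
  qed
  have "((\<lambda>e. 2 * k * (sqrt (a + e) * sqrt (b + e))) \<longlongrightarrow> 2 * k * (sqrt (a + 0) * sqrt (b + 0))) (at_right 0)"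
    by (intro tendsto_intros)
  moreover have "\<forall>\<^sub>F e in at_right (0::real). x \<le> 2 * k * (sqrt (a + e) * sqrt (b + e))"
    using * by (auto simp: eventually_at_right_less intro: eventually_mono[OF eventually_at_right_less])
  ultimately show ?thesis
    by (intro tendsto_lowerbound[where F = "at_right (0::real)"]) auto
qed

text \<open>The form may be degenerate, as the form of an operator and a vector is whenever some
  polynomial in the operator annihilates the vector.  The scalar multiplication is a parameter, because
  the vectors will be coordinate functions in one place and polynomials in another.\<close>

locale semi_inner =
  fixes sc :: "complex \<Rightarrow> 'v::ab_group_add \<Rightarrow> 'v" and B :: "'v \<Rightarrow> 'v \<Rightarrow> complex"
  assumes B_add_left: "B (u + v) w = B u w + B v w"
    and B_sc_left: "B (sc c u) w = c * B u w"
    and B_herm: "B v u = cnj (B u v)"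
    and B_nonneg: "0 \<le> Re (B u u)"
begin

definition nm :: "'v \<Rightarrow> real" where "nm u = sqrt (Re (B u u))"

lemma B_add_right: "B w (u + v) = B w u + B w v"
  by (metis B_add_left B_herm complex_cnj_add)

lemma B_sc_right: "B w (sc c u) = cnj c * B w u"
  by (metis B_sc_left B_herm complex_cnj_mult)

lemma B_diff_left: "B (u - v) w = B u w - B v w"
  by (metis B_add_left add_diff_cancel_right' diff_add_cancel)

lemma B_diff_right: "B w (u - v) = B w u - B w v"
  by (metis B_diff_left B_herm complex_cnj_diff)

lemma B_zero_left [simp]: "B 0 w = 0"
  using B_diff_left[of 0 0 w] by simp

lemma B_zero_right [simp]: "B w 0 = 0"
  using B_diff_right[of w 0 0] by simp

lemma B_self: "B u u = of_real (Re (B u u))"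
  using B_herm[of u u] by (auto simp: complex_eq_iff)

lemma nm_nonneg [simp]: "nm u \<ge> 0"
  by (simp add: nm_def B_nonneg)

lemma nm_square: "(nm u)\<^sup>2 = Re (B u u)"
  by (simp add: nm_def B_nonneg)

lemma nm_sc: "nm (sc c u) = cmod c * nm u"
proof -
  have "B (sc c u) (sc c u) = of_real ((cmod c)\<^sup>2) * B u u"
    unfolding complex_norm_square by (simp add: B_sc_left B_sc_right mult_ac)
  then show ?thesis by (simp add: nm_def real_sqrt_mult)
qed

lemma nm_zero [simp]: "nm 0 = 0"
  by (simp add: nm_def)

lemma cmod_B_le_mean: "cmod (B u v) \<le> (Re (B u u) + Re (B v v)) / 2"
proof (cases "B u v = 0")
  case True
  then show ?thesis using B_nonneg[of u] B_nonneg[of v] by simp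
next
  case False
  define c where "c = sgn (B u v)"
  have c: "cnj c * c = 1" "cnj c * B u v = of_real (cmod (B u v))"
    using False complex_norm_square[of "B u v"] unfolding c_def
    by (auto simp: sgn_eq power2_eq_square divide_simps mult_ac)
  have c2: "c * B v u = of_real (cmod (B u v))"
    using arg_cong[OF c(2), of cnj] by (simp add: B_herm[of v u])
  have "B (u - sc c v) (u - sc c v) = B u u - cnj c * B u v - c * B v u + (cnj c * c) * B v v"
    by (simp add: B_diff_left B_diff_right B_sc_left B_sc_right algebra_simps)
  also have "\<dots> = B u u + B v v - 2 * of_real (cmod (B u v))"
    by (simp only: c c2) simp
  finally show ?thesis using B_nonneg[of "u - sc c v"] by simp
qed

text \<open>The left-hand side does not change when \<open>u\<close> and \<open>v\<close> are rescaled by reciprocal factors, so the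
  arithmetic mean on the right can be optimised into a geometric mean.\<close>

lemma form_bound:
  assumes "\<And>u v. cmod (S u v) \<le> k * (Re (B u u) + Re (B v v))" and "k \<ge> 0"
    and "\<And>c u v. S (sc c u) v = c * S u v" and "\<And>c u v. S u (sc c v) = cnj c * S u v"
  shows "cmod (S u v) \<le> 2 * k * (nm u * nm v)"
  unfolding nm_def
proof (rule le_geometric_mean)
  fix t :: real assume t: "t > 0"
  define s where "s = sqrt t"
  have s: "s > 0" "s * s = t" using t by (auto simp: s_def)
  have "cmod (S u v) = cmod (S (sc (of_real s) u) (sc (of_real (1 / s)) v))"
    using s by (simp add: assms(3,4))
  also have "\<dots> \<le> k * (Re (B (sc s u) (sc s u)) + Re (B (sc (1 / s) v) (sc (1 / s) v)))"
    using assms(1)[of "sc (of_real s) u" "sc (of_real (1 / s)) v"] by simp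
  also have "Re (B (sc s u) (sc s u)) = t * Re (B u u)"
    using s by (simp add: B_sc_left B_sc_right flip: s(2))
  also have "Re (B (sc (1 / s) v) (sc (1 / s) v)) = Re (B v v) / t"
    using s by (simp add: B_sc_left B_sc_right flip: s(2))
  finally show "cmod (S u v) \<le> k * (t * Re (B u u) + Re (B v v) / t)" .
qed (auto simp: assms B_nonneg)

lemma Cauchy_Schwarz: "cmod (B u v) \<le> nm u * nm v"
  using form_bound[of B "1/2" u v] cmod_B_le_mean
  by (simp add: B_sc_left B_sc_right)

lemma nm_triangle: "nm (u + v) \<le> nm u + nm v"
proof -
  have "(nm (u + v))\<^sup>2 = (nm u)\<^sup>2 + (nm v)\<^sup>2 + 2 * Re (B u v)"
    by (simp add: nm_square B_add_left B_add_right B_herm[of v u])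
  also have "\<dots> \<le> (nm u + nm v)\<^sup>2"
    using Cauchy_Schwarz[of u v] complex_Re_le_cmod[of "B u v"] by (simp add: power2_sum)
  finally show ?thesis by (rule power2_le_imp_le) simp
qed

lemma nm_triangle_diff: "nm (u - v) \<le> nm u + nm v"
proof -
  have "(nm (u - v))\<^sup>2 = (nm u)\<^sup>2 + (nm v)\<^sup>2 - 2 * Re (B u v)"
    by (simp add: nm_square B_diff_left B_diff_right B_herm[of v u])
  also have "\<dots> \<le> (nm u + nm v)\<^sup>2"
    using Cauchy_Schwarz[of u v] abs_Re_le_cmod[of "B u v"] by (simp add: power2_sum)
  finally show ?thesis by (rule power2_le_imp_le) simp
qed

lemma nm_le_of_dual:
  assumes "cmod (B u u) \<le> c * nm u" "c \<ge> 0"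
  shows "nm u \<le> c"
proof (cases "nm u = 0")
  case False
  then have "nm u > 0" using nm_nonneg[of u] by linarith
  moreover have "cmod (B u u) = nm u * nm u"
    using B_self[of u] nm_square[of u] B_nonneg[of u]
    by (metis abs_of_nonneg norm_of_real power2_eq_square)
  ultimately show ?thesis using assms by simp
qed (use assms in simp)

text \<open>Think of \<open>T\<close> and \<open>Tg\<close> as \<open>\<phi>(W)\<close> and \<open>g(W)\<close>.  If \<open>K\<close> were the norm of \<open>T\<close>, attained at the unit
  vector \<open>u\<close> (the case \<open>\<delta> = 0\<close>), then \<open>T\<^sup>*T u = K\<^sup>2 u\<close>, and the vector
  \<open>y = K\<^sup>2 u + Tg T u = (T\<^sup>* + Tg) T u\<close> would have norm at most \<open>2\<kappa>K\<close> because \<open>T\<^sup>* + Tg\<close> has norm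
  at most \<open>2\<kappa>\<close>; applying \<open>T\<close> gives \<open>K\<^sup>3 \<le> 2\<kappa>K\<^sup>2 + aK\<close>.  The proof avoids adjoints and maximizing vectors:
  the form \<open>Q v w = K\<^sup>2 \<langle>v, w\<rangle> - \<langle>T v, T w\<rangle>\<close> is positive and almost vanishes at \<open>u\<close>, so by the
  Cauchy-Schwarz inequality for \<open>Q\<close> it almost vanishes at \<open>u\<close> and any other vector.\<close>

lemma nearly_maximal_vector:
  assumes T_add: "\<And>u v. T (u + v) = T u + T v" and T_sc: "\<And>c u. T (sc c u) = sc c (T u)"
    and T_le: "\<And>v. nm (T v) \<le> K * nm v"
    and S_le: "\<And>v w. cmod (B (T v) w + B v (Tg w)) \<le> 2 * \<kappa> * (nm v * nm w)"
    and sandwich: "nm (T (Tg (T u))) \<le> a * K"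
    and u: "nm u \<le> 1" "K - \<delta> \<le> nm (T u)" "0 \<le> \<delta>" "\<delta> \<le> K" and "\<kappa> \<ge> 0"
  shows "K\<^sup>2 * (K - \<delta>) \<le> K * (2 * \<kappa> * K + K * sqrt (2 * K * \<delta>)) + a * K"
proof -
  have K: "K \<ge> 0" using u by linarith
  define Q where "Q = (\<lambda>v w. of_real (K\<^sup>2) * B v w - B (T v) (T w))"
  have le_sq: "(nm (T v))\<^sup>2 \<le> K\<^sup>2 * (nm v)\<^sup>2" for v
    using power_mono[OF T_le[of v] nm_nonneg, of 2] by (simp add: power_mult_distrib)
  interpret Q: semi_inner sc Q
  proof
    show "0 \<le> Re (Q v v)" for v
      using le_sq[of v] by (simp add: Q_def nm_square)
    show "Q v w = cnj (Q w v)" for v w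
      using B_herm[of v w] B_herm[of "T v" "T w"] by (simp add: Q_def)
  qed (simp_all add: Q_def T_add T_sc B_add_left B_sc_left algebra_simps)
  have Tu: "nm (T u) \<le> K"
    using T_le[of u] u(1) K mult_left_mono[of "nm u" 1 K] by linarith
  have "Q.nm v \<le> K * nm v" for v
  proof -
    have "(Q.nm v)\<^sup>2 = K\<^sup>2 * (nm v)\<^sup>2 - (nm (T v))\<^sup>2"
      unfolding Q.nm_square nm_square by (simp add: Q_def)
    also have "\<dots> \<le> (K * nm v)\<^sup>2" by (simp add: power_mult_distrib)
    finally show ?thesis by (rule power2_le_imp_le) (simp add: K)
  qed
  moreover have "Q.nm u \<le> sqrt (2 * K * \<delta>)"
  proof (rule real_le_rsqrt)
    have "(Q.nm u)\<^sup>2 = K\<^sup>2 * (nm u)\<^sup>2 - (nm (T u))\<^sup>2"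
      unfolding Q.nm_square nm_square by (simp add: Q_def)
    also have "\<dots> \<le> K\<^sup>2 - (K - \<delta>)\<^sup>2"
    proof -
      have "(nm u)\<^sup>2 \<le> 1" using u(1) by (simp add: power_le_one)
      then have "K\<^sup>2 * (nm u)\<^sup>2 \<le> K\<^sup>2" by (simp add: mult_left_le)
      moreover have "(K - \<delta>)\<^sup>2 \<le> (nm (T u))\<^sup>2" using u by (intro power_mono) auto
      ultimately show ?thesis by linarith
    qed
    also have "\<dots> \<le> 2 * K * \<delta>" by (simp add: power2_diff)
    finally show "(Q.nm u)\<^sup>2 \<le> 2 * K * \<delta>" .
  qed
  ultimately have Q_le: "cmod (Q v u) \<le> K * nm v * sqrt (2 * K * \<delta>)" for v
    by (rule order_trans[OF Q.Cauchy_Schwarz mult_mono]) (auto simp: K)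
  \<comment> \<open>A stand-in for \<open>(T\<^sup>* + Tg) T u\<close>.\<close>
  define y where "y = sc (of_real (K\<^sup>2)) u + Tg (T u)"
  define c where "c = 2 * \<kappa> * K + K * sqrt (2 * K * \<delta>)"
  have c: "c \<ge> 0" using K u \<open>\<kappa> \<ge> 0\<close> by (simp add: c_def)
  have "B y y = Q y u + (B (T y) (T u) + B y (Tg (T u)))"
    by (subst (2) y_def) (simp add: B_add_right B_sc_right Q_def)
  also have "cmod \<dots> \<le> K * nm y * sqrt (2 * K * \<delta>) + 2 * \<kappa> * (nm y * nm (T u))"
    by (rule norm_triangle_le) (rule add_mono[OF Q_le S_le])
  also have "2 * \<kappa> * (nm y * nm (T u)) \<le> 2 * \<kappa> * (nm y * K)"
    using Tu \<open>\<kappa> \<ge> 0\<close> by (intro mult_left_mono) auto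
  finally have "cmod (B y y) \<le> c * nm y" by (simp add: c_def algebra_simps)
  then have y: "nm y \<le> c" by (rule nm_le_of_dual) (rule c)
  have "sc (of_real (K\<^sup>2)) (T u) = T y - T (Tg (T u))"
    by (simp add: y_def T_add T_sc)
  then have "K\<^sup>2 * nm (T u) = nm (T y - T (Tg (T u)))"
    by (metis abs_of_nonneg nm_sc norm_of_real zero_le_power2)
  also have "\<dots> \<le> K * nm y + a * K"
    using nm_triangle_diff[of "T y" "T (Tg (T u))"] T_le[of y] sandwich by linarith
  also have "\<dots> \<le> K * c + a * K" using y K by (simp add: mult_left_mono)
  finally have "K\<^sup>2 * nm (T u) \<le> K * c + a * K" .
  moreover have "K\<^sup>2 * (K - \<delta>) \<le> K\<^sup>2 * nm (T u)" using u by (intro mult_left_mono) auto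
  ultimately show ?thesis by (simp add: c_def)
qed

end


section \<open>Contour integrals over a strip\<close>

definition closed_strip :: "real \<Rightarrow> real \<Rightarrow> complex set" where "closed_strip a b = {z. a \<le> Im z \<and> Im z \<le> b}"

lemma convex_closed_strip: "convex (closed_strip a b)"
  unfolding closed_strip_def Collect_conj_eq
  using convex_halfspace_Im_ge[of a] convex_halfspace_Im_le[of b] by (intro convex_Int) auto

lemma interior_closed_strip: "interior (closed_strip a b) = {z. a < Im z \<and> Im z < b}"
proof -
  have "interior (closed_strip a b) = interior {z. \<i> \<bullet> z \<ge> a} \<inter> interior {z. \<i> \<bullet> z \<le> b}"
    unfolding interior_Int[symmetric] by (rule arg_cong[of _ _ interior]) (auto simp: closed_strip_def inner_complex_def)
  also have "\<dots> = {z. \<i> \<bullet> z > a} \<inter> {z. \<i> \<bullet> z < b}"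
    by (simp only: interior_halfspace_ge interior_halfspace_le complex_i_not_zero not_False_eq_True)
  finally show ?thesis by (auto simp: inner_complex_def)
qed

lemma integral_sin_over_cosh:
  assumes "0 < \<theta>" "\<theta> < pi"
  shows "integrable lborel (\<lambda>t::real. sin \<theta> / (cosh t - cos \<theta>))"
    and "(\<integral>t. sin \<theta> / (cosh t - cos \<theta>) \<partial>lborel) = 2 * (pi - \<theta>)"
proof -
  have s: "sin \<theta> > 0" using assms by (rule sin_gt_zero)
  have c: "cos \<theta> < 1" using cos_monotone_0_pi[of 0 \<theta>] assms by simp
  have pos: "cosh t - cos \<theta> > 0" for t :: real using cosh_real_ge_1[of t] c by linarith
  define F where "F = (\<lambda>t. 2 * arctan ((exp t - cos \<theta>) / sin \<theta>))"
  have der: "DERIV F t :> sin \<theta> / (cosh t - cos \<theta>)" for t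
  proof -
    have "DERIV F t :> 2 * (exp t / sin \<theta> * inverse (1 + ((exp t - cos \<theta>) / sin \<theta>)\<^sup>2))"
      unfolding F_def using s by (auto intro!: derivative_eq_intros)
    also have "1 + ((exp t - cos \<theta>) / sin \<theta>)\<^sup>2 = 2 * exp t * (cosh t - cos \<theta>) / (sin \<theta>)\<^sup>2"
    proof -
      have "2 * exp t * cosh t = exp t * exp t + 1"
        by (simp add: cosh_def algebra_simps flip: exp_add)
      then have "(sin \<theta>)\<^sup>2 + (exp t - cos \<theta>)\<^sup>2 = 2 * exp t * (cosh t - cos \<theta>)"
        using sin_cos_squared_add[of \<theta>] by (simp add: power2_eq_square algebra_simps)
      moreover have "1 + ((exp t - cos \<theta>) / sin \<theta>)\<^sup>2 = ((sin \<theta>)\<^sup>2 + (exp t - cos \<theta>)\<^sup>2) / (sin \<theta>)\<^sup>2"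
        using s by (simp add: power_divide add_divide_distrib)
      ultimately show ?thesis by simp
    qed
    also have "2 * (exp t / sin \<theta> * inverse (2 * exp t * (cosh t - cos \<theta>) / (sin \<theta>)\<^sup>2)) = sin \<theta> / (cosh t - cos \<theta>)"
      using s pos[of t] by (simp add: divide_simps power2_eq_square)
    finally show ?thesis .
  qed
  have lim1: "((F \<circ> real_of_ereal) \<longlongrightarrow> 2 * (\<theta> - pi / 2)) (at_right (- \<infinity>))"
  proof -
    have "(F \<longlongrightarrow> 2 * arctan ((0 - cos \<theta>) / sin \<theta>)) at_bot"
      unfolding F_def by (intro tendsto_intros exp_at_bot) (use s in auto)
    also have "(0 - cos \<theta>) / sin \<theta> = tan (\<theta> - pi / 2)"
      using s by (simp add: tan_def sin_diff cos_diff)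
    also have "arctan (tan (\<theta> - pi / 2)) = \<theta> - pi / 2"
      using assms by (intro arctan_tan) auto
    finally show ?thesis by (simp add: ereal_tendsto_simps)
  qed
  have lim2: "((F \<circ> real_of_ereal) \<longlongrightarrow> pi) (at_left \<infinity>)"
  proof -
    have "filterlim (\<lambda>t. (exp t - cos \<theta>) / sin \<theta>) at_top at_top"
      using s by real_asymp
    then have "((\<lambda>t. 2 * arctan ((exp t - cos \<theta>) / sin \<theta>)) \<longlongrightarrow> 2 * (pi / 2)) at_top"
      by (intro tendsto_intros filterlim_compose[OF tendsto_arctan_at_top])
    then show ?thesis by (simp add: ereal_tendsto_simps F_def)
  qed
  have cont: "isCont (\<lambda>t. sin \<theta> / (cosh t - cos \<theta>)) t" for t
    using pos[of t] by (intro continuous_intros) auto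
  note FTC = interval_integral_FTC_nonneg[of "-\<infinity>" \<infinity> F "\<lambda>t. sin \<theta> / (cosh t - cos \<theta>)" "2 * (\<theta> - pi / 2)" pi, OF _ der cont _ lim1 lim2]
  have "set_integrable lborel (einterval (-\<infinity>) \<infinity>) (\<lambda>t. sin \<theta> / (cosh t - cos \<theta>))"
    by (rule FTC(1)) (use s pos in \<open>auto intro!: AE_I2 divide_nonneg_pos\<close>)
  then show "integrable lborel (\<lambda>t::real. sin \<theta> / (cosh t - cos \<theta>))"
    by (simp add: set_integrable_def)
  have "(LBINT t=-\<infinity>..\<infinity>. sin \<theta> / (cosh t - cos \<theta>)) = pi - 2 * (\<theta> - pi / 2)"
    by (rule FTC(2)) (use s pos in \<open>auto intro!: AE_I2 divide_nonneg_pos\<close>)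
  then show "(\<integral>t. sin \<theta> / (cosh t - cos \<theta>) \<partial>lborel) = 2 * (pi - \<theta>)"
    by (simp add: interval_lebesgue_integral_def set_lebesgue_integral_def algebra_simps)
qed

lemma integrable_exp_neg_abs: "integrable lborel (\<lambda>t::real. exp (-\<bar>t\<bar>))"
proof (rule Bochner_Integration.integrable_bound)
  show "integrable lborel (\<lambda>t::real. sin (pi / 2) / (cosh t - cos (pi / 2)))"
    by (rule integral_sin_over_cosh) auto
  have "exp (-\<bar>t\<bar>) \<le> 1 / cosh t" for t :: real
  proof -
    have "cosh t * 1 \<le> exp \<bar>t\<bar>" by (simp add: cosh_def abs_if)
    then show ?thesis by (simp add: exp_minus divide_simps mult.commute)
  qed
  then show "AE x in lborel. norm (exp (- \<bar>x\<bar>)) \<le> norm (sin (pi / 2) / (cosh x - cos (pi / 2)))"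
    by (auto intro!: AE_I2)
qed simp

lemma continuous_exp_decay_integrable:
  fixes f :: "real \<Rightarrow> complex"
  assumes "continuous_on UNIV f" and dec: "\<And>t. \<bar>t\<bar> \<ge> R \<Longrightarrow> cmod (f t) \<le> C * exp (-\<bar>t\<bar>)"
  shows "integrable lborel f"
proof -
  have "compact ((\<lambda>t. cmod (f t) * exp \<bar>t\<bar>) ` {-\<bar>R\<bar>..\<bar>R\<bar>})"
    by (intro compact_continuous_image continuous_intros continuous_on_subset[OF assms(1)]) auto
  then have "bounded ((\<lambda>t. cmod (f t) * exp \<bar>t\<bar>) ` {-\<bar>R\<bar>..\<bar>R\<bar>})"
    by (rule compact_imp_bounded)
  then obtain D where D0: "\<forall>x\<in>(\<lambda>t. cmod (f t) * exp \<bar>t\<bar>) ` {-\<bar>R\<bar>..\<bar>R\<bar>}. norm x \<le> D"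
    unfolding bounded_iff by blast
  have D: "cmod (f t) \<le> D * exp (-\<bar>t\<bar>)" if "t \<in> {-\<bar>R\<bar>..\<bar>R\<bar>}" for t
  proof -
    have "norm (cmod (f t) * exp \<bar>t\<bar>) \<le> D" by (rule bspec[OF D0 imageI[OF that]])
    then show ?thesis by (simp add: exp_minus field_simps)
  qed
  have le: "cmod (f t) \<le> max C D * exp (-\<bar>t\<bar>)" for t
  proof (cases "\<bar>t\<bar> \<ge> R")
    case True
    show ?thesis by (rule order_trans[OF dec[OF True]]) (rule mult_right_mono, auto)
  next
    case False
    then have "t \<in> {-\<bar>R\<bar>..\<bar>R\<bar>}" by auto
    then show ?thesis by (rule order_trans[OF D]) (rule mult_right_mono, auto)
  qed
  show ?thesis
  proof (rule Bochner_Integration.integrable_bound)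
    show "integrable lborel (\<lambda>t. max C D * exp (-\<bar>t\<bar>))"
      using integrable_exp_neg_abs by simp
    show "f \<in> borel_measurable lborel"
      using assms(1) by (simp add: borel_measurable_continuous_onI)
    show "AE x in lborel. cmod (f x) \<le> norm (max C D * exp (- \<bar>x\<bar>))"
      using le by (auto intro!: AE_I2 intro: order_trans[OF le] abs_ge_self)
  qed
qed

lemma tendsto_integral_symmetric:
  fixes f :: "real \<Rightarrow> complex"
  assumes "integrable lborel f"
  shows "(\<lambda>n. integral {-real n..real n} f) \<longlonglongrightarrow> (\<integral>t. f t \<partial>lborel)"
proof -
  have eq: "integral {-real n..real n} f = (\<integral>t. indicator {-real n..real n} t *\<^sub>R f t \<partial>lborel)" for n
  proof -
    have "set_integrable lborel {-real n..real n} f"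
      using assms unfolding set_integrable_def by (intro integrable_mult_indicator) auto
    from set_borel_integral_eq_integral(2)[OF this] show ?thesis
      by (simp add: set_lebesgue_integral_def)
  qed
  show ?thesis unfolding eq
  proof (rule integral_dominated_convergence[where w = "\<lambda>t. cmod (f t)"])
    show "AE x in lborel. (\<lambda>i. indicator {- real i..real i} x *\<^sub>R f x) \<longlonglongrightarrow> f x"
    proof (rule AE_I2, rule tendsto_eventually)
      fix x :: real
      have "\<forall>\<^sub>F i in sequentially. \<bar>x\<bar> \<le> real i"
        by (rule eventually_sequentiallyI[of "nat \<lceil>\<bar>x\<bar>\<rceil>"]) linarith
      then show "\<forall>\<^sub>F i in sequentially. indicator {- real i..real i} x *\<^sub>R f x = f x"
        by eventually_elim (auto simp: indicator_def)
    qed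
  qed (use assms in \<open>auto simp: indicator_def\<close>)
qed

lemma has_contour_integral_horizontal_iff:
  assumes "r < s"
  shows "(f has_contour_integral I) (linepath (Complex r a) (Complex s a)) \<longleftrightarrow>
    ((\<lambda>t. f (Complex t a)) has_integral I) {r..s}"
proof -
  have eq: "f (linepath (Complex r a) (Complex s a) x) * (Complex s a - Complex r a)
      = f (linepath (of_real r) (of_real s) x + Complex 0 a) * (of_real s - of_real r)" for x
  proof -
    have "linepath (Complex r a) (Complex s a) x = linepath (of_real r) (of_real s) x + Complex 0 a"
      by (auto simp: linepath_def complex_eq_iff algebra_simps)
    moreover have "Complex s a - Complex r a = of_real s - of_real r"
      by (auto simp: complex_eq_iff)
    ultimately show ?thesis by simp
  qed
  have "(f has_contour_integral I) (linepath (Complex r a) (Complex s a)) \<longleftrightarrow>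
    ((\<lambda>z. f (z + Complex 0 a)) has_contour_integral I) (linepath (of_real r) (of_real s))"
    unfolding has_contour_integral_linepath eq ..
  also have "\<dots> \<longleftrightarrow> ((\<lambda>t. f (of_real t + Complex 0 a)) has_integral I) {r..s}"
    using has_contour_integral_linepath_Reals_iff[of "of_real r" "of_real s"] assms by simp
  also have "(\<lambda>t. f (of_real t + Complex 0 a)) = (\<lambda>t. f (Complex t a))"
    by (intro ext arg_cong[of _ _ f]) (auto simp: complex_eq_iff)
  finally show ?thesis .
qed

text \<open>Cauchy's integral formula for long rectangles; the decay of \<open>h\<close> makes the vertical sides
  negligible.  The function \<open>q\<close> is \<open>h\<close> with its simple pole at \<open>z\<close> removed.\<close>

lemma strip_contour:
  assumes "a < b" and contq: "continuous_on (closed_strip a b) q"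
    and holq: "q holomorphic_on interior (closed_strip a b)" and z: "a < Im z" "Im z < b"
    and h: "\<And>\<sigma>. \<sigma> \<in> closed_strip a b \<Longrightarrow> \<sigma> \<noteq> z \<Longrightarrow> h \<sigma> = q \<sigma> / (\<sigma> - z)"
    and dec: "\<And>\<sigma>. \<sigma> \<in> closed_strip a b \<Longrightarrow> R \<le> \<bar>Re \<sigma>\<bar> \<Longrightarrow> cmod (h \<sigma>) \<le> C * exp (-\<bar>Re \<sigma>\<bar>)"
  shows "integrable lborel (\<lambda>t. h (Complex t a))" "integrable lborel (\<lambda>t. h (Complex t b))"
    and "(\<integral>t. h (Complex t a) \<partial>lborel) - (\<integral>t. h (Complex t b) \<partial>lborel) = 2 * pi * \<i> * q z"
proof -
  have conth: "continuous_on (closed_strip a b - {z}) h"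
  proof -
    have "continuous_on (closed_strip a b - {z}) (\<lambda>\<sigma>. q \<sigma> / (\<sigma> - z))"
      by (intro continuous_intros continuous_on_subset[OF contq]) auto
    then show ?thesis by (rule continuous_on_eq) (use h in auto)
  qed
  have int: "integrable lborel (\<lambda>t. h (Complex t c))" if "c = a \<or> c = b" for c
  proof (rule continuous_exp_decay_integrable)
    show "continuous_on UNIV (\<lambda>t. h (Complex t c))"
      by (rule continuous_on_compose2[OF conth])
        (use that z assms(1) in \<open>auto simp: closed_strip_def Complex_eq intro!: continuous_intros\<close>)
    show "cmod (h (Complex t c)) \<le> C * exp (- \<bar>t\<bar>)" if "R \<le> \<bar>t\<bar>" for t
      using dec[of "Complex t c"] that \<open>c = a \<or> c = b\<close> assms(1) by (auto simp: closed_strip_def)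
  qed
  show ia: "integrable lborel (\<lambda>t. h (Complex t a))" and ib: "integrable lborel (\<lambda>t. h (Complex t b))"
    using int by auto
  define V where "V = (\<lambda>r. contour_integral (linepath (Complex r a) (Complex r b)) h)"
  have V_le: "cmod (V r) \<le> C * exp (-\<bar>r\<bar>) * (b - a)" if r: "R \<le> \<bar>r\<bar>" "\<bar>r\<bar> > \<bar>Re z\<bar>" for r
  proof -
    have seg: "\<sigma> \<in> closed_strip a b - {z} \<and> Re \<sigma> = r" if "\<sigma> \<in> closed_segment (Complex r a) (Complex r b)" for \<sigma>
      using that r assms(1) by (auto simp: closed_segment_same_Re closed_segment_eq_real_ivl closed_strip_def)
    have "norm (V r) \<le> C * exp (-\<bar>r\<bar>) * norm (Complex r b - Complex r a)"
      unfolding V_def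
    proof (rule contour_integral_bound_linepath)
      show "h contour_integrable_on linepath (Complex r a) (Complex r b)"
        by (intro contour_integrable_continuous_linepath continuous_on_subset[OF conth]) (use seg in auto)
      show "cmod (h x) \<le> C * exp (- \<bar>r\<bar>)" if "x \<in> closed_segment (Complex r a) (Complex r b)" for x
        using dec[of x] seg[OF that] r by auto
      have "0 \<le> cmod (h (Complex r a))" by simp
      also have "\<dots> \<le> C * exp (- \<bar>r\<bar>)" using dec[of "Complex r a"] r assms(1) by (auto simp: closed_strip_def)
      finally show "0 \<le> C * exp (- \<bar>r\<bar>)" .
    qed
    also have "norm (Complex r b - Complex r a) = b - a"
      using assms(1) by (simp add: cmod_def)
    finally show ?thesis .
  qed
  have V_lim: "((\<lambda>n. V (real n)) \<longlongrightarrow> 0) sequentially" "((\<lambda>n. V (- real n)) \<longlongrightarrow> 0) sequentially"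
  proof -
    have lim0: "(\<lambda>n. C * exp (-real n) * (b - a)) \<longlonglongrightarrow> 0" by real_asymp
    have ev: "\<forall>\<^sub>F n in sequentially. R \<le> real n \<and> real n > \<bar>Re z\<bar>"
      by (rule eventually_sequentiallyI[of "nat \<lceil>\<bar>R\<bar>\<rceil> + nat \<lceil>\<bar>Re z\<bar>\<rceil> + 1"]) linarith
    show "((\<lambda>n. V (real n)) \<longlongrightarrow> 0) sequentially"
      by (rule Lim_null_comparison[OF eventually_mono[OF ev] lim0]) (use V_le[of "real _"] in simp)
    show "((\<lambda>n. V (- real n)) \<longlongrightarrow> 0) sequentially"
      by (rule Lim_null_comparison[OF eventually_mono[OF ev] lim0]) (use V_le[of "- real _"] in simp)
  qed
  have rect: "integral {-real n..real n} (\<lambda>t. h (Complex t a)) + V (real n)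
      - integral {-real n..real n} (\<lambda>t. h (Complex t b)) - V (- real n) = 2 * pi * \<i> * q z"
    if n: "real n > \<bar>Re z\<bar>" for n
  proof -
    define a1 a2 a3 a4 where "a1 = Complex (-real n) a" and "a2 = Complex (real n) a"
      and "a3 = Complex (real n) b" and "a4 = Complex (-real n) b"
    have n0: "- real n < real n" using n by linarith
    have rp: "rectpath a1 a3 = linepath a1 a2 +++ linepath a2 a3 +++ linepath a3 a4 +++ linepath a4 a1"
      by (simp add: rectpath_def a1_def a2_def a3_def a4_def Let_def)
    have im: "path_image (rectpath a1 a3) \<subseteq> closed_strip a b - {z}"
      using n assms(1) z by (subst path_image_rectpath) (auto simp: a1_def a3_def closed_strip_def)
    have segs: "closed_segment a1 a2 \<subseteq> closed_strip a b - {z}" "closed_segment a2 a3 \<subseteq> closed_strip a b - {z}"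
      "closed_segment a3 a4 \<subseteq> closed_strip a b - {z}" "closed_segment a4 a1 \<subseteq> closed_strip a b - {z}"
      using im unfolding rp by (auto simp: path_image_join)
    have hint: "h contour_integrable_on linepath a1 a2" "h contour_integrable_on linepath a2 a3"
      "h contour_integrable_on linepath a3 a4" "h contour_integrable_on linepath a4 a1"
      using segs by (auto intro!: contour_integrable_continuous_linepath continuous_on_subset[OF conth])
    have "((\<lambda>w. q w / (w - z)) has_contour_integral (2 * pi * \<i> * winding_number (rectpath a1 a3) z * q z)) (rectpath a1 a3)"
    proof (rule Cauchy_integral_formula_weak[OF convex_closed_strip finite.emptyI contq])
      show "q field_differentiable at x" if "x \<in> interior (closed_strip a b) - {}" for x
        using holq that by (auto simp: holomorphic_on_open field_differentiable_def)
    qed (use z im in \<open>auto simp: interior_closed_strip\<close>)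
    moreover have "winding_number (rectpath a1 a3) z = 1"
      by (rule winding_number_rectpath) (use n z in \<open>auto simp: in_box_complex_iff a1_def a3_def\<close>)
    ultimately have "((\<lambda>w. q w / (w - z)) has_contour_integral (2 * pi * \<i> * q z)) (rectpath a1 a3)" by simp
    then have "(h has_contour_integral (2 * pi * \<i> * q z)) (rectpath a1 a3)"
      by (rule has_contour_integral_eq) (rule h[symmetric], use im in auto)
    then have "2 * pi * \<i> * q z = contour_integral (rectpath a1 a3) h"
      by (simp add: contour_integral_unique)
    also have "\<dots> = contour_integral (linepath a1 a2) h + (contour_integral (linepath a2 a3) h
        + (contour_integral (linepath a3 a4) h + contour_integral (linepath a4 a1) h))"
      unfolding rp using hint by (simp add: contour_integrable_join)
    also have "contour_integral (linepath a3 a4) h = - contour_integral (linepath a4 a3) h"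
      using segs(3) by (intro contour_integral_reverse_linepath continuous_on_subset[OF conth])
    also have "contour_integral (linepath a4 a1) h = - contour_integral (linepath a1 a4) h"
      using segs(4) by (intro contour_integral_reverse_linepath continuous_on_subset[OF conth])
    also have "contour_integral (linepath a1 a2) h = integral {-real n..real n} (\<lambda>t. h (Complex t a))"
      using has_contour_integral_integral[OF hint(1)]
      unfolding a1_def a2_def has_contour_integral_horizontal_iff[OF n0] by (simp add: integral_unique)
    also have "contour_integral (linepath a4 a3) h = integral {-real n..real n} (\<lambda>t. h (Complex t b))"
    proof -
      have "h contour_integrable_on linepath a4 a3"
        by (intro contour_integrable_continuous_linepath continuous_on_subset[OF conth])
          (use segs(3) in \<open>simp add: closed_segment_commute\<close>)
      from has_contour_integral_integral[OF this] show ?thesis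
        unfolding a3_def a4_def has_contour_integral_horizontal_iff[OF n0] by (simp add: integral_unique)
    qed
    finally show ?thesis by (simp add: V_def a1_def a2_def a3_def a4_def algebra_simps)
  qed
  define J where "J = (\<lambda>n. integral {-real n..real n} (\<lambda>t. h (Complex t a)) + V (real n)
      - integral {-real n..real n} (\<lambda>t. h (Complex t b)) - V (- real n))"
  have "J \<longlonglongrightarrow> (\<integral>t. h (Complex t a) \<partial>lborel) + 0 - (\<integral>t. h (Complex t b) \<partial>lborel) - 0"
    unfolding J_def by (intro tendsto_intros tendsto_integral_symmetric ia ib V_lim)
  moreover have "\<forall>\<^sub>F n in sequentially. J n = 2 * pi * \<i> * q z"
    unfolding J_def
    by (rule eventually_sequentiallyI[of "nat \<lceil>\<bar>Re z\<bar>\<rceil> + 1"], rule rect) linarith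
  then have "J \<longlonglongrightarrow> 2 * pi * \<i> * q z" by (rule tendsto_eventually)
  ultimately show "(\<integral>t. h (Complex t a) \<partial>lborel) - (\<integral>t. h (Complex t b) \<partial>lborel) = 2 * pi * \<i> * q z"
    using LIMSEQ_unique by fastforce
qed


section \<open>The Cauchy kernel in a logarithmic coordinate\<close>

text \<open>The Cauchy kernel of a sector in the logarithmic coordinate: for \<open>w = exp \<sigma>\<close>,
  \<open>dw / (w - exp c) = ekern c \<sigma> d\<sigma>\<close>.\<close>

definition ekern :: "complex \<Rightarrow> complex \<Rightarrow> complex" where
  "ekern c \<sigma> = 1 / (1 - exp (c - \<sigma>))"

definition strip_kernel :: "real \<Rightarrow> real \<Rightarrow> real" where
  "strip_kernel \<alpha> t = sin (2 * \<alpha>) / (2 * pi * (cosh t - cos (2 * \<alpha>)))"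

lemma exp_ne_1:
  assumes "Im x \<noteq> 0" "\<bar>Im x\<bar> < 2 * pi"
  shows "exp x \<noteq> 1"
proof
  assume "exp x = 1"
  then obtain n :: int where n: "Im x = of_int (2 * n) * pi" by (auto simp: exp_eq_1)
  then have "\<bar>real_of_int n\<bar> * (2 * pi) < 1 * (2 * pi)" using assms(2) by (simp add: abs_mult)
  then have "\<bar>real_of_int n\<bar> < 1" by (rule mult_right_less_imp_less) auto
  then have "n = 0" by linarith
  with n assms(1) show False by simp
qed

lemma holomorphic_ekern:
  assumes "\<And>\<sigma>. \<sigma> \<in> S \<Longrightarrow> Im (\<sigma> - c) \<noteq> 0 \<and> \<bar>Im (\<sigma> - c)\<bar> < 2 * pi"
  shows "ekern c holomorphic_on S"
proof -
  have "exp (c - \<sigma>) \<noteq> 1" if "\<sigma> \<in> S" for \<sigma>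
    using assms[OF that] by (intro exp_ne_1) auto
  then show ?thesis
    unfolding ekern_def[abs_def] by (intro holomorphic_intros) fastforce+
qed

lemma cmod_div_one_minus_le:
  fixes w :: complex
  assumes "cmod w \<le> 1 / 2"
  shows "cmod (w / (1 - w)) \<le> 2 * cmod w"
proof -
  have "1 / 2 \<le> cmod (1 - w)" using norm_triangle_ineq2[of 1 w] assms by simp
  then have "cmod w * 1 \<le> cmod w * (2 * cmod (1 - w))" by (intro mult_left_mono) auto
  moreover have "cmod (1 - w) > 0" using \<open>1 / 2 \<le> cmod (1 - w)\<close> by linarith
  ultimately show ?thesis by (simp add: norm_divide pos_divide_le_eq mult_ac)
qed

lemma exp_minus_one_le_half: "exp (-1::real) \<le> 1 / 2"
  using exp_ge_add_one_self[of "1::real"] by (simp add: exp_minus divide_simps)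

lemma ekern_decay_right:
  assumes "Re \<sigma> \<ge> Re c + 1"
  shows "cmod (ekern c \<sigma> - 1) \<le> 2 * exp (Re c) * exp (- Re \<sigma>)"
proof -
  define w where "w = exp (c - \<sigma>)"
  have w: "cmod w = exp (Re c) * exp (- Re \<sigma>)" by (simp add: w_def flip: exp_add)
  have "cmod w \<le> exp (-1)" using assms by (simp add: w_def)
  then have "cmod w \<le> 1 / 2" using exp_minus_one_le_half by linarith
  moreover from this have "w \<noteq> 1" by auto
  then have "ekern c \<sigma> - 1 = w / (1 - w)" by (simp add: ekern_def w_def[symmetric] field_simps)
  ultimately show ?thesis using cmod_div_one_minus_le[of w] w by simp
qed

lemma ekern_decay_left:
  assumes "Re \<sigma> \<le> Re c - 1"
  shows "cmod (ekern c \<sigma>) \<le> 2 * exp (- Re c) * exp (Re \<sigma>)"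
proof -
  define w where "w = exp (\<sigma> - c)"
  have w: "cmod w = exp (- Re c) * exp (Re \<sigma>)" by (simp add: w_def flip: exp_add)
  have "cmod w \<le> exp (-1)" using assms by (simp add: w_def)
  then have le: "cmod w \<le> 1 / 2" using exp_minus_one_le_half by linarith
  then have "w \<noteq> 1" by auto
  have "exp (c - \<sigma>) = inverse w" using exp_minus[of "\<sigma> - c"] by (simp add: w_def)
  moreover have "w \<noteq> 0" by (simp add: w_def)
  ultimately have "ekern c \<sigma> = - (w / (1 - w))"
    using \<open>w \<noteq> 1\<close> by (simp add: ekern_def) (simp add: field_simps)
  then show ?thesis using cmod_div_one_minus_le[of w] w le by simp
qed

text \<open>A single kernel tends to 1 at the right end of the strip; the difference decays at both ends.\<close>

lemma ekern_diff_decay: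
  obtains R C where "C \<ge> 0"
    "\<And>\<sigma>. R \<le> \<bar>Re \<sigma>\<bar> \<Longrightarrow> cmod (ekern c \<sigma> - ekern d \<sigma>) \<le> C * exp (- \<bar>Re \<sigma>\<bar>)"
proof
  define C where "C = 2 * (exp (Re c) + exp (Re d) + exp (- Re c) + exp (- Re d))"
  show "C \<ge> 0" by (simp add: C_def add_nonneg_nonneg)
  fix \<sigma> :: complex assume R: "\<bar>Re c\<bar> + \<bar>Re d\<bar> + 1 \<le> \<bar>Re \<sigma>\<bar>"
  have *: "2 * exp (Re c) + 2 * exp (Re d) \<le> C" "2 * exp (- Re c) + 2 * exp (- Re d) \<le> C"
    unfolding C_def using exp_gt_zero[of "Re c"] exp_gt_zero[of "Re d"]
      exp_gt_zero[of "- Re c"] exp_gt_zero[of "- Re d"] by argo+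
  show "cmod (ekern c \<sigma> - ekern d \<sigma>) \<le> C * exp (- \<bar>Re \<sigma>\<bar>)"
  proof (cases "Re \<sigma> \<ge> 0")
    case True
    have "cmod (ekern c \<sigma> - ekern d \<sigma>) \<le> cmod (ekern c \<sigma> - 1) + cmod (ekern d \<sigma> - 1)"
      using norm_triangle_ineq4[of "ekern c \<sigma> - 1" "ekern d \<sigma> - 1"] by simp
    also have "\<dots> \<le> 2 * exp (Re c) * exp (- Re \<sigma>) + 2 * exp (Re d) * exp (- Re \<sigma>)"
      using True R by (intro add_mono ekern_decay_right) auto
    also have "\<dots> = (2 * exp (Re c) + 2 * exp (Re d)) * exp (- Re \<sigma>)" by (simp add: algebra_simps)
    also have "\<dots> \<le> C * exp (- Re \<sigma>)" using * by (intro mult_right_mono) auto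
    finally show ?thesis using True by simp
  next
    case False
    have "cmod (ekern c \<sigma> - ekern d \<sigma>) \<le> cmod (ekern c \<sigma>) + cmod (ekern d \<sigma>)"
      by (rule norm_triangle_ineq4)
    also have "\<dots> \<le> 2 * exp (- Re c) * exp (Re \<sigma>) + 2 * exp (- Re d) * exp (Re \<sigma>)"
      using False R by (intro add_mono ekern_decay_left) auto
    also have "\<dots> = (2 * exp (- Re c) + 2 * exp (- Re d)) * exp (Re \<sigma>)" by (simp add: algebra_simps)
    also have "\<dots> \<le> C * exp (Re \<sigma>)" using * by (intro mult_right_mono) auto
    finally show ?thesis using False by simp
  qed
qed

text \<open>The function \<open>x / (1 - exp (- x))\<close> has a removable singularity at 0, and its other singularities have
  imaginary part at least \<open>2\<pi>\<close> in absolute value.\<close>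

lemma removable_kernel:
  obtains P where "P holomorphic_on {x. \<bar>Im x\<bar> < 2 * pi}" "P 0 = (1::complex)"
    "\<And>x. x \<noteq> 0 \<Longrightarrow> P x = x / (1 - exp (- x))"
proof -
  define f :: "complex \<Rightarrow> complex" where "f = (\<lambda>x. 1 - exp (- x))"
  define Q where "Q = (\<lambda>x. if x = 0 then deriv f 0 else (f x - f 0) / (x - 0))"
  have "f holomorphic_on UNIV" unfolding f_def by (intro holomorphic_intros)
  then have holQ: "Q holomorphic_on UNIV" unfolding Q_def by (rule pole_lemma_open) simp
  have "deriv f 0 = 1"
    unfolding f_def by (rule DERIV_imp_deriv) (auto intro!: derivative_eq_intros)
  then have Q0: "Q 0 = 1" by (simp add: Q_def)
  have nz: "Q x \<noteq> 0" if "\<bar>Im x\<bar> < 2 * pi" for x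
  proof (cases "x = 0")
    case False
    have "exp (- x) \<noteq> 1"
    proof (cases "Im x = 0")
      case True
      then show ?thesis using False by (auto simp: exp_eq_1 complex_eq_iff[of x 0])
    qed (use that in \<open>intro exp_ne_1, auto\<close>)
    then show ?thesis using False by (simp add: Q_def f_def)
  qed (simp add: Q0)
  show thesis
  proof (rule that[of "\<lambda>x. 1 / Q x"])
    show "(\<lambda>x. 1 / Q x) holomorphic_on {x. \<bar>Im x\<bar> < 2 * pi}"
      by (intro holomorphic_intros holomorphic_on_subset[OF holQ]) (use nz in auto)
  qed (use Q0 in \<open>simp_all add: Q_def f_def\<close>)
qed

lemma strip_kernel_eq:
  assumes "0 < \<alpha>" "\<alpha> \<le> pi / 2"
  shows "ekern (2 * \<i> * \<alpha>) (of_real t) - ekern (- (2 * \<i> * \<alpha>)) (of_real t) = 2 * pi * \<i> * of_real (strip_kernel \<alpha> t)"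
proof -
  define x u where "x = exp (- t)" and "u = cis (2 * \<alpha>)"
  have x: "x > 0" "2 * x * cosh t = 1 + x * x"
    by (auto simp: x_def cosh_def algebra_simps simp flip: exp_add)
  have c: "cos (2 * \<alpha>) < 1" using cos_monotone_0_pi[of 0 "2 * \<alpha>"] assms by simp
  define D where "D = 2 * x * (cosh t - cos (2 * \<alpha>))"
  have D: "D > 0" using x(1) c cosh_real_ge_1[of t] unfolding D_def by (intro mult_pos_pos) auto
  have u: "u * cnj u = 1" "u + cnj u = 2 * cos (2 * \<alpha>)" "u - cnj u = 2 * \<i> * sin (2 * \<alpha>)"
    by (auto simp: u_def complex_eq_iff power2_eq_square[symmetric])
  have prod: "(1 - x * u) * (1 - x * cnj u) = of_real D"
  proof -
    have "(1 - x * u) * (1 - x * cnj u) = 1 - x * (u + cnj u) + x * x * (u * cnj u)"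
      by (simp add: algebra_simps)
    also have "\<dots> = of_real (1 + x * x - 2 * x * cos (2 * \<alpha>))" by (simp only: u) simp
    also have "1 + x * x - 2 * x * cos (2 * \<alpha>) = D" by (simp add: D_def right_diff_distrib x)
    finally show ?thesis .
  qed
  then have nz: "1 - x * u \<noteq> 0" "1 - x * cnj u \<noteq> 0" using D by auto
  have e: "exp (2 * \<i> * \<alpha> - of_real t) = x * u"
    by (auto simp: x_def u_def cis_conv_exp exp_of_real[symmetric] mult_ac simp flip: exp_add)
  have e': "exp (- (2 * \<i> * \<alpha>) - of_real t) = x * cnj u"
    using arg_cong[OF e, of cnj] by (simp add: exp_cnj)
  have "ekern (2 * \<i> * \<alpha>) (of_real t) - ekern (- (2 * \<i> * \<alpha>)) (of_real t) = 1 / (1 - x * u) - 1 / (1 - x * cnj u)"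
    by (simp only: ekern_def e e')
  also have "\<dots> = x * (u - cnj u) / ((1 - x * u) * (1 - x * cnj u))"
    using nz by (simp add: field_simps)
  also have "\<dots> = of_real (2 * x * sin (2 * \<alpha>) / D) * \<i>" by (simp only: u prod) simp
  also have "2 * x * sin (2 * \<alpha>) / D = 2 * pi * strip_kernel \<alpha> t"
    using x(1) by (simp add: D_def strip_kernel_def)
  finally show ?thesis by simp
qed

text \<open>Cauchy's theorem is used twice.  On the whole strip, \<open>ekern c - ekern (d - 2\<i>\<alpha>)\<close> has the single pole
  \<open>c\<close>, which produces \<open>\<phi> c\<close>.  The difference \<open>ekern (d + 2\<i>\<alpha>) - ekern (d - 2\<i>\<alpha>)\<close> has no pole in the strip,
  so its integral over the upper edge can be moved down to the horizontal line through \<open>d\<close>, where it is a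
  positive kernel.  The poles outside the strip are chosen so that the second kernel on each edge is the
  complex conjugate of the kernel with pole \<open>cnj d\<close>.\<close>

lemma strip_identity:
  fixes c d :: complex and \<phi> :: "complex \<Rightarrow> complex"
  assumes \<alpha>: "0 < \<alpha>" "\<alpha> \<le> pi / 2" and c: "\<bar>Im c\<bar> < \<alpha>" and d: "\<bar>Im d\<bar> < \<alpha>"
    and cont: "continuous_on (closed_strip (-\<alpha>) \<alpha>) \<phi>" and hol: "\<phi> holomorphic_on {z. \<bar>Im z\<bar> < \<alpha>}"
    and le1: "\<And>\<sigma>. \<sigma> \<in> closed_strip (-\<alpha>) \<alpha> \<Longrightarrow> cmod (\<phi> \<sigma>) \<le> 1"
  defines "lower \<equiv> \<lambda>t. \<phi> (Complex t (-\<alpha>)) * (ekern c (Complex t (-\<alpha>)) - ekern (d - 2 * \<i> * \<alpha>) (Complex t (-\<alpha>)))"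
    and "upper \<equiv> \<lambda>t. \<phi> (Complex t \<alpha>) * (ekern c (Complex t \<alpha>) - ekern (d + 2 * \<i> * \<alpha>) (Complex t \<alpha>))"
  shows "integrable lborel lower" "integrable lborel upper"
    and "integrable lborel (\<lambda>t. \<phi> (d + of_real t) * of_real (strip_kernel \<alpha> t))"
    and "(\<integral>t. lower t \<partial>lborel) - (\<integral>t. upper t \<partial>lborel) =
      2 * pi * \<i> * (\<phi> c + (\<integral>t. \<phi> (d + of_real t) * of_real (strip_kernel \<alpha> t) \<partial>lborel))"
proof -
  have int_eq: "interior (closed_strip (-\<alpha>) \<alpha>) = {z. \<bar>Im z\<bar> < \<alpha>}" by (auto simp: interior_closed_strip)
  define dl du where "dl = d - 2 * \<i> * \<alpha>" and "du = d + 2 * \<i> * \<alpha>"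
  have holl: "ekern dl holomorphic_on closed_strip (-\<alpha>) \<alpha>"
    by (rule holomorphic_ekern) (use \<alpha> d in \<open>auto simp: dl_def closed_strip_def\<close>)
  have holu: "ekern du holomorphic_on closed_strip (-\<alpha>) \<alpha>"
    by (rule holomorphic_ekern) (use \<alpha> d in \<open>auto simp: du_def closed_strip_def\<close>)
  obtain P where P: "P holomorphic_on {x. \<bar>Im x\<bar> < 2 * pi}" "P 0 = 1"
    "\<And>x. x \<noteq> 0 \<Longrightarrow> P x = x / (1 - exp (- x))" by (rule removable_kernel) auto
  have holP: "(\<lambda>\<sigma>. P (\<sigma> - c)) holomorphic_on closed_strip (-\<alpha>) \<alpha>"
  proof -
    have "(\<lambda>\<sigma>. \<sigma> - c) ` closed_strip (-\<alpha>) \<alpha> \<subseteq> {x. \<bar>Im x\<bar> < 2 * pi}"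
      using \<alpha> c by (auto simp: closed_strip_def)
    then have "P \<circ> (\<lambda>\<sigma>. \<sigma> - c) holomorphic_on closed_strip (-\<alpha>) \<alpha>"
      by (intro holomorphic_on_compose_gen[OF _ P(1)] holomorphic_intros)
    then show ?thesis by (simp add: o_def)
  qed
  define q where "q = (\<lambda>\<sigma>. \<phi> \<sigma> * (P (\<sigma> - c) - (\<sigma> - c) * ekern dl \<sigma>))"
  define h where "h = (\<lambda>\<sigma>. \<phi> \<sigma> * (ekern c \<sigma> - ekern dl \<sigma>))"
  obtain R C where RC: "C \<ge> 0"
    "\<And>\<sigma>. R \<le> \<bar>Re \<sigma>\<bar> \<Longrightarrow> cmod (ekern c \<sigma> - ekern dl \<sigma>) \<le> C * exp (- \<bar>Re \<sigma>\<bar>)"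
    by (rule ekern_diff_decay[of c dl]) (rule that, assumption, assumption)
  have 1: "integrable lborel (\<lambda>t. h (Complex t (-\<alpha>)))" "integrable lborel (\<lambda>t. h (Complex t \<alpha>))"
    "(\<integral>t. h (Complex t (-\<alpha>)) \<partial>lborel) - (\<integral>t. h (Complex t \<alpha>) \<partial>lborel) = 2 * pi * \<i> * q c"
  proof -
    have A1: "continuous_on (closed_strip (-\<alpha>) \<alpha>) q"
      unfolding q_def by (intro continuous_intros cont holomorphic_on_imp_continuous_on holP holl)
    have A2: "q holomorphic_on interior (closed_strip (-\<alpha>) \<alpha>)"
      unfolding q_def int_eq
      by (intro holomorphic_intros hol holomorphic_on_subset[OF holP] holomorphic_on_subset[OF holl])
        (auto simp: closed_strip_def)
    have A3: "h \<sigma> = q \<sigma> / (\<sigma> - c)" if "\<sigma> \<in> closed_strip (-\<alpha>) \<alpha>" "\<sigma> \<noteq> c" for \<sigma>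
    proof -
      have "P (\<sigma> - c) = (\<sigma> - c) * ekern c \<sigma>" using that(2) by (simp add: P(3) ekern_def)
      then have "q \<sigma> = (\<sigma> - c) * h \<sigma>" by (simp only: q_def h_def) (simp add: algebra_simps)
      then show ?thesis using that(2) by simp
    qed
    have A4: "cmod (h \<sigma>) \<le> C * exp (-\<bar>Re \<sigma>\<bar>)" if "\<sigma> \<in> closed_strip (-\<alpha>) \<alpha>" "R \<le> \<bar>Re \<sigma>\<bar>" for \<sigma>
      using mult_mono[OF le1[OF that(1)] RC(2)[OF that(2)]] by (simp add: h_def norm_mult)
    note * = strip_contour[OF _ A1 A2 _ _ A3 A4]
    show "integrable lborel (\<lambda>t. h (Complex t (-\<alpha>)))" by (rule *(1)) (use \<alpha> c in auto)
    show "integrable lborel (\<lambda>t. h (Complex t \<alpha>))" by (rule *(2)) (use \<alpha> c in auto)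
    show "(\<integral>t. h (Complex t (-\<alpha>)) \<partial>lborel) - (\<integral>t. h (Complex t \<alpha>) \<partial>lborel) = 2 * pi * \<i> * q c"
      by (rule *(3)) (use \<alpha> c in auto)
  qed
  have qc: "q c = \<phi> c" by (simp add: q_def P(2))
  define b where "b = Im d"
  have b: "- \<alpha> < b" "b < \<alpha>" using d by (auto simp: b_def)
  \<comment> \<open>Here no pole is wanted: for any point \<open>z\<close> between the two lines, the factor \<open>\<sigma> - z\<close> makes the
    residue vanish.\<close>
  define z where "z = Complex 0 ((b + \<alpha>) / 2)"
  define h' where "h' = (\<lambda>\<sigma>. \<phi> \<sigma> * (ekern du \<sigma> - ekern dl \<sigma>))"
  define q' where "q' = (\<lambda>\<sigma>. (\<sigma> - z) * h' \<sigma>)"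
  obtain R' C' where RC': "C' \<ge> 0"
    "\<And>\<sigma>. R' \<le> \<bar>Re \<sigma>\<bar> \<Longrightarrow> cmod (ekern du \<sigma> - ekern dl \<sigma>) \<le> C' * exp (- \<bar>Re \<sigma>\<bar>)"
    by (rule ekern_diff_decay[of du dl]) (rule that, assumption, assumption)
  have sub: "closed_strip b \<alpha> \<subseteq> closed_strip (-\<alpha>) \<alpha>" using b by (auto simp: closed_strip_def)
  have 2: "integrable lborel (\<lambda>t. h' (Complex t b))" "integrable lborel (\<lambda>t. h' (Complex t \<alpha>))"
    "(\<integral>t. h' (Complex t b) \<partial>lborel) - (\<integral>t. h' (Complex t \<alpha>) \<partial>lborel) = 2 * pi * \<i> * q' z"
  proof -
    have A1: "continuous_on (closed_strip b \<alpha>) q'"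
      unfolding q'_def h'_def
      by (intro continuous_intros continuous_on_subset[OF cont sub] holomorphic_on_imp_continuous_on
          holomorphic_on_subset[OF holl sub] holomorphic_on_subset[OF holu sub])
    have sub2: "interior (closed_strip b \<alpha>) \<subseteq> {z. \<bar>Im z\<bar> < \<alpha>}" "interior (closed_strip b \<alpha>) \<subseteq> closed_strip (-\<alpha>) \<alpha>"
      using b unfolding interior_closed_strip by (auto simp: closed_strip_def)
    have A2: "q' holomorphic_on interior (closed_strip b \<alpha>)"
      unfolding q'_def h'_def
      by (intro holomorphic_intros holomorphic_on_subset[OF hol sub2(1)] holomorphic_on_subset[OF holl sub2(2)]
          holomorphic_on_subset[OF holu sub2(2)])
    have A3: "h' \<sigma> = q' \<sigma> / (\<sigma> - z)" if "\<sigma> \<in> closed_strip b \<alpha>" "\<sigma> \<noteq> z" for \<sigma>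
      using that(2) by (simp add: q'_def)
    have A4: "cmod (h' \<sigma>) \<le> C' * exp (-\<bar>Re \<sigma>\<bar>)" if "\<sigma> \<in> closed_strip b \<alpha>" "R' \<le> \<bar>Re \<sigma>\<bar>" for \<sigma>
      using mult_mono[OF le1 RC'(2)[OF that(2)], of \<sigma>] sub that(1) by (auto simp: h'_def norm_mult)
    note * = strip_contour[OF _ A1 A2 _ _ A3 A4]
    show "integrable lborel (\<lambda>t. h' (Complex t b))" by (rule *(1)) (use b in \<open>auto simp: z_def\<close>)
    show "integrable lborel (\<lambda>t. h' (Complex t \<alpha>))" by (rule *(2)) (use b in \<open>auto simp: z_def\<close>)
    show "(\<integral>t. h' (Complex t b) \<partial>lborel) - (\<integral>t. h' (Complex t \<alpha>) \<partial>lborel) = 2 * pi * \<i> * q' z"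
      by (rule *(3)) (use b in \<open>auto simp: z_def\<close>)
  qed
  have q'z: "q' z = 0" by (simp add: q'_def)
  have lower: "lower = (\<lambda>t. h (Complex t (-\<alpha>)))" by (simp add: lower_def h_def dl_def)
  have upper: "upper = (\<lambda>t. h (Complex t \<alpha>) - h' (Complex t \<alpha>))"
    by (simp add: upper_def h_def h'_def du_def algebra_simps)
  show "integrable lborel lower" unfolding lower by (rule 1)
  show "integrable lborel upper" unfolding upper
    by (rule Bochner_Integration.integrable_diff[OF 1(2) 2(2)])
  have shift: "h' (Complex (Re d + 1 * t) b) = 2 * pi * \<i> * (\<phi> (d + of_real t) * of_real (strip_kernel \<alpha> t))" for t
  proof -
    have eq: "Complex (Re d + 1 * t) b = d + of_real t" by (simp add: complex_eq_iff b_def)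
    have "ekern du (d + of_real t) - ekern dl (d + of_real t)
        = ekern (2 * \<i> * \<alpha>) (of_real t) - ekern (- (2 * \<i> * \<alpha>)) (of_real t)"
    proof -
      have "du - (d + of_real t) = 2 * \<i> * \<alpha> - of_real t" "dl - (d + of_real t) = - (2 * \<i> * \<alpha>) - of_real t"
        by (simp_all add: du_def dl_def)
      then show ?thesis by (simp only: ekern_def)
    qed
    then show ?thesis unfolding eq h'_def using strip_kernel_eq[OF \<alpha>, of t] by simp
  qed
  have int': "integrable lborel (\<lambda>t. 2 * pi * \<i> * (\<phi> (d + of_real t) * of_real (strip_kernel \<alpha> t)))"
    using 2(1) lborel_integrable_real_affine[of "\<lambda>t. h' (Complex t b)" 1 "Re d"] unfolding shift by simp
  show "integrable lborel (\<lambda>t. \<phi> (d + of_real t) * of_real (strip_kernel \<alpha> t))"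
    using integrable_mult_right[of "1 / (2 * pi * \<i>)", OF int'] by simp
  have "(\<integral>t. h' (Complex t b) \<partial>lborel) = (\<integral>t. 2 * pi * \<i> * (\<phi> (d + of_real t) * of_real (strip_kernel \<alpha> t)) \<partial>lborel)"
    using lborel_integral_real_affine[of 1 "\<lambda>t. h' (Complex t b)" "Re d"] unfolding shift by simp
  also have "\<dots> = 2 * pi * \<i> * (\<integral>t. \<phi> (d + of_real t) * of_real (strip_kernel \<alpha> t) \<partial>lborel)"
    by simp
  finally have hb: "(\<integral>t. h' (Complex t b) \<partial>lborel) = 2 * pi * \<i> * (\<integral>t. \<phi> (d + of_real t) * of_real (strip_kernel \<alpha> t) \<partial>lborel)" .
  have "(\<integral>t. upper t \<partial>lborel) = (\<integral>t. h (Complex t \<alpha>) \<partial>lborel) - (\<integral>t. h' (Complex t \<alpha>) \<partial>lborel)"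
    unfolding upper by (rule Bochner_Integration.integral_diff[OF 1(2) 2(2)])
  then show "(\<integral>t. lower t \<partial>lborel) - (\<integral>t. upper t \<partial>lborel) =
      2 * pi * \<i> * (\<phi> c + (\<integral>t. \<phi> (d + of_real t) * of_real (strip_kernel \<alpha> t) \<partial>lborel))"
    using 1(3) 2(3) hb unfolding qc q'z lower by (simp add: algebra_simps)
qed


section \<open>The dual Cauchy transform\<close>

lemma cos_double_less_1:
  fixes \<alpha> :: real
  assumes "0 < \<alpha>" "\<alpha> \<le> pi / 2"
  shows "cos (2 * \<alpha>) < 1"
  using cos_monotone_0_pi[of 0 "2 * \<alpha>"] assms by simp

lemma strip_kernel_nonneg:
  assumes "0 < \<alpha>" "\<alpha> \<le> pi / 2"
  shows "strip_kernel \<alpha> t \<ge> 0"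
proof -
  have "sin (2 * \<alpha>) \<ge> 0" using assms by (intro sin_ge_zero) auto
  moreover have "cosh t - cos (2 * \<alpha>) > 0"
    using cos_double_less_1[OF assms] cosh_real_ge_1[of t] by linarith
  ultimately show ?thesis by (auto simp: strip_kernel_def)
qed

lemma continuous_strip_kernel:
  assumes "0 < \<alpha>" "\<alpha> \<le> pi / 2"
  shows "continuous_on A (strip_kernel \<alpha>)"
proof -
  have "cosh t - cos (2 * \<alpha>) \<noteq> 0" for t :: real
    using cos_double_less_1[OF assms] cosh_real_ge_1[of t] by linarith
  then show ?thesis unfolding strip_kernel_def[abs_def] by (intro continuous_intros) auto
qed

lemma integral_strip_kernel:
  assumes "0 < \<alpha>" "\<alpha> \<le> pi / 2"
  shows "integrable lborel (strip_kernel \<alpha>)" "(\<integral>t. strip_kernel \<alpha> t \<partial>lborel) = 1 - 2 * \<alpha> / pi"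
proof -
  have eq: "strip_kernel \<alpha> = (\<lambda>t. (1 / (2 * pi)) * (sin (2 * \<alpha>) / (cosh t - cos (2 * \<alpha>))))"
    by (simp add: strip_kernel_def[abs_def])
  have "integrable lborel (strip_kernel \<alpha>) \<and> (\<integral>t. strip_kernel \<alpha> t \<partial>lborel) = 1 - 2 * \<alpha> / pi"
  proof (cases "\<alpha> = pi / 2")
    case True
    then have "2 * \<alpha> = pi" by simp
    then have "strip_kernel \<alpha> = (\<lambda>t. 0)" "2 * \<alpha> / pi = 1" by (simp_all add: strip_kernel_def fun_eq_iff)
    then show ?thesis by simp
  next
    case False
    then have *: "0 < 2 * \<alpha>" "2 * \<alpha> < pi" using assms by auto
    have "(\<integral>t. strip_kernel \<alpha> t \<partial>lborel) = 1 / (2 * pi) * (2 * (pi - 2 * \<alpha>))"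
      unfolding eq integral_mult_right_zero integral_sin_over_cosh(2)[OF *] ..
    moreover have "integrable lborel (strip_kernel \<alpha>)"
      unfolding eq by (intro integrable_mult_right integral_sin_over_cosh(1)[OF *])
    ultimately show ?thesis by (simp add: field_simps)
  qed
  then show "integrable lborel (strip_kernel \<alpha>)" "(\<integral>t. strip_kernel \<alpha> t \<partial>lborel) = 1 - 2 * \<alpha> / pi" by auto
qed

definition strip :: "real \<Rightarrow> complex set" where "strip \<alpha> = {z. \<bar>Im z\<bar> < \<alpha>}"

lemma open_strip: "open (strip \<alpha>)"
  unfolding strip_def by (intro open_Collect_less continuous_intros)

lemma convex_strip: "convex (strip \<alpha>)"
proof -
  have "strip \<alpha> = interior (closed_strip (-\<alpha>) \<alpha>)" by (auto simp: strip_def interior_closed_strip)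
  then show ?thesis by (simp add: convex_closed_strip)
qed

text \<open>The conjugate of the remainder in \<open>strip_identity\<close>, as a function of \<open>\<zeta> = cnj d\<close>: the reflection of \<open>\<phi>\<close> in the
  real axis, convolved with \<open>strip_kernel\<close>.\<close>

definition cauchy_dual :: "real \<Rightarrow> (complex \<Rightarrow> complex) \<Rightarrow> complex \<Rightarrow> complex" where
  "cauchy_dual \<alpha> \<phi> \<zeta> = (\<integral>t. cnj (\<phi> (cnj (\<zeta> + of_real t))) * of_real (strip_kernel \<alpha> t) \<partial>lborel)"

lemma cauchy_dual_integrand:
  assumes \<alpha>: "0 < \<alpha>" "\<alpha> \<le> pi / 2" and cont: "continuous_on (strip \<alpha>) \<phi>"
    and le1: "\<And>z. z \<in> strip \<alpha> \<Longrightarrow> cmod (\<phi> z) \<le> 1" and \<zeta>: "\<zeta> \<in> strip \<alpha>"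
  shows "integrable lborel (\<lambda>t. cnj (\<phi> (cnj (\<zeta> + of_real t))) * of_real (strip_kernel \<alpha> t))"
    and "cmod (cnj (\<phi> (cnj (\<zeta> + of_real t))) * of_real (strip_kernel \<alpha> t)) \<le> strip_kernel \<alpha> t"
proof -
  show le: "cmod (cnj (\<phi> (cnj (\<zeta> + of_real t))) * of_real (strip_kernel \<alpha> t)) \<le> strip_kernel \<alpha> t" for t
  proof -
    have "cnj (\<zeta> + of_real t) \<in> strip \<alpha>" using \<zeta> by (simp add: strip_def)
    then have "cmod (\<phi> (cnj (\<zeta> + of_real t))) \<le> 1" by (rule le1)
    then show ?thesis using strip_kernel_nonneg[OF \<alpha>, of t] by (simp add: norm_mult mult_left_le_one_le)
  qed
  show "integrable lborel (\<lambda>t. cnj (\<phi> (cnj (\<zeta> + of_real t))) * of_real (strip_kernel \<alpha> t))"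
  proof (rule Bochner_Integration.integrable_bound[OF integral_strip_kernel(1)[OF \<alpha>]])
    have "continuous_on UNIV (\<lambda>t. \<phi> (cnj (\<zeta> + of_real t)))"
      by (rule continuous_on_compose2[OF cont]) (use \<zeta> in \<open>auto simp: strip_def intro!: continuous_intros\<close>)
    then have "continuous_on UNIV (\<lambda>t. cnj (\<phi> (cnj (\<zeta> + of_real t))) * of_real (strip_kernel \<alpha> t))"
      by (intro continuous_intros continuous_strip_kernel \<alpha>)
    then show "(\<lambda>t. cnj (\<phi> (cnj (\<zeta> + of_real t))) * of_real (strip_kernel \<alpha> t)) \<in> borel_measurable lborel"
      by (simp add: borel_measurable_continuous_onI)
    show "AE t in lborel. norm (cnj (\<phi> (cnj (\<zeta> + of_real t))) * of_real (strip_kernel \<alpha> t)) \<le> norm (strip_kernel \<alpha> t)"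
      using le strip_kernel_nonneg[OF \<alpha>] by (intro AE_I2) simp
  qed
qed

lemma cauchy_dual_le:
  assumes \<alpha>: "0 < \<alpha>" "\<alpha> \<le> pi / 2" and "continuous_on (strip \<alpha>) \<phi>"
    and "\<And>z. z \<in> strip \<alpha> \<Longrightarrow> cmod (\<phi> z) \<le> 1" and "\<zeta> \<in> strip \<alpha>"
  shows "cmod (cauchy_dual \<alpha> \<phi> \<zeta>) \<le> 1 - 2 * \<alpha> / pi"
proof -
  have "cmod (cauchy_dual \<alpha> \<phi> \<zeta>) \<le> (\<integral>t. strip_kernel \<alpha> t \<partial>lborel)"
    unfolding cauchy_dual_def
    by (rule Bochner_Integration.integral_norm_bound_integral[OF cauchy_dual_integrand(1)[OF assms] integral_strip_kernel(1)[OF \<alpha>]])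
      (use cauchy_dual_integrand(2)[OF assms] in auto)
  then show ?thesis by (simp add: integral_strip_kernel(2)[OF \<alpha>])
qed

lemma kernel_tail_tendsto_0:
  assumes \<alpha>: "0 < \<alpha>" "\<alpha> \<le> pi / 2"
  shows "(\<lambda>n. \<integral>t. indicator (- {-real n..real n}) t * strip_kernel \<alpha> t \<partial>lborel) \<longlonglongrightarrow> 0"
proof -
  have "(\<lambda>n. \<integral>t. indicator (- {-real n..real n}) t * strip_kernel \<alpha> t \<partial>lborel) \<longlonglongrightarrow> (\<integral>t. 0 \<partial>(lborel::real measure))"
  proof (rule integral_dominated_convergence[where w = "strip_kernel \<alpha>"])
    show "AE x in lborel. (\<lambda>n. indicator (- {- real n..real n}) x * strip_kernel \<alpha> x) \<longlonglongrightarrow> 0"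
    proof (rule AE_I2, rule tendsto_eventually)
      fix x :: real
      have "\<forall>\<^sub>F i in sequentially. \<bar>x\<bar> \<le> real i"
        by (rule eventually_sequentiallyI[of "nat \<lceil>\<bar>x\<bar>\<rceil>"]) linarith
      then show "\<forall>\<^sub>F i in sequentially. indicator (- {- real i..real i}) x * strip_kernel \<alpha> x = 0"
        by eventually_elim (auto simp: indicator_def)
    qed
    show "AE x in lborel. norm (indicator (- {- real n..real n}) x * strip_kernel \<alpha> x) \<le> strip_kernel \<alpha> x" for n
      using strip_kernel_nonneg[OF \<alpha>] by (intro AE_I2) (auto simp: indicator_def)
    show "(\<lambda>x. indicator (- {- real n..real n}) x * strip_kernel \<alpha> x) \<in> borel_measurable lborel" for n
      using borel_measurable_integrable[OF integral_strip_kernel(1)[OF \<alpha>]] by measurable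
  qed (use integral_strip_kernel(1)[OF \<alpha>] in auto)
  then show ?thesis by simp
qed

text \<open>The integral over a bounded interval is holomorphic by differentiation under the integral sign.
  The tails tend to 0 uniformly in \<open>\<zeta>\<close>, because they are bounded by the tails of \<open>strip_kernel\<close>.\<close>

lemma holomorphic_cauchy_dual:
  assumes \<alpha>: "0 < \<alpha>" "\<alpha> \<le> pi / 2" and hol: "\<phi> holomorphic_on strip \<alpha>"
    and le1: "\<And>z. z \<in> strip \<alpha> \<Longrightarrow> cmod (\<phi> z) \<le> 1"
  shows "cauchy_dual \<alpha> \<phi> holomorphic_on strip \<alpha>"
proof -
  define \<psi> where "\<psi> = cnj \<circ> \<phi> \<circ> cnj"
  have cnj_strip: "cnj ` strip \<alpha> = strip \<alpha>"
    by (auto simp: strip_def image_iff intro!: exI[of _ "cnj _"])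
  have hol\<psi>: "\<psi> holomorphic_on strip \<alpha>"
    unfolding \<psi>_def by (rule holomorphic_on_compose_cnj_cnj) (simp_all add: cnj_strip hol open_strip)
  have shift: "\<zeta> + of_real t \<in> strip \<alpha>" if "\<zeta> \<in> strip \<alpha>" for \<zeta> t using that by (simp add: strip_def)
  note contphi = holomorphic_on_imp_continuous_on[OF hol]
  define f where "f = (\<lambda>n \<zeta>. integral (cbox (-real n) (real n)) (\<lambda>t. \<psi> (\<zeta> + of_real t) * of_real (strip_kernel \<alpha> t)))"
  have holf: "f n holomorphic_on strip \<alpha>" for n
    unfolding f_def
  proof (rule leibniz_rule_holomorphic[where fx = "\<lambda>\<zeta> t. deriv \<psi> (\<zeta> + of_real t) * of_real (strip_kernel \<alpha> t)"])
    fix \<zeta> t assume \<zeta>: "\<zeta> \<in> strip \<alpha>"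
    have "(\<psi> has_field_derivative deriv \<psi> (\<zeta> + of_real t)) (at (\<zeta> + of_real t))"
      using holomorphic_derivI[OF hol\<psi> open_strip shift[OF \<zeta>]] .
    then have "((\<lambda>\<zeta>. \<psi> (\<zeta> + of_real t)) has_field_derivative deriv \<psi> (\<zeta> + of_real t)) (at \<zeta>)"
      by (simp add: DERIV_shift)
    then show "((\<lambda>\<zeta>. \<psi> (\<zeta> + of_real t) * of_real (strip_kernel \<alpha> t)) has_field_derivative
        deriv \<psi> (\<zeta> + of_real t) * of_real (strip_kernel \<alpha> t)) (at \<zeta> within strip \<alpha>)"
      by (intro DERIV_cmult_right) (rule has_field_derivative_at_within)
  next
    fix \<zeta> assume \<zeta>: "\<zeta> \<in> strip \<alpha>"
    have "continuous_on (cbox (-real n) (real n)) (\<lambda>t. \<psi> (\<zeta> + of_real t))"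
      by (rule continuous_on_compose2[OF holomorphic_on_imp_continuous_on[OF hol\<psi>]])
        (use shift[OF \<zeta>] in \<open>auto intro!: continuous_intros\<close>)
    then show "(\<lambda>t. \<psi> (\<zeta> + of_real t) * of_real (strip_kernel \<alpha> t)) integrable_on cbox (-real n) (real n)"
      by (intro integrable_continuous continuous_intros continuous_strip_kernel \<alpha>)
  next
    have "continuous_on (strip \<alpha>) (deriv \<psi>)"
      by (intro holomorphic_on_imp_continuous_on holomorphic_deriv hol\<psi> open_strip)
    then have "continuous_on (strip \<alpha> \<times> cbox (-real n) (real n)) (\<lambda>x. deriv \<psi> (fst x + of_real (snd x)))"
      by (rule continuous_on_compose2) (use shift in \<open>auto intro!: continuous_intros\<close>)
    moreover have "continuous_on (strip \<alpha> \<times> cbox (-real n) (real n)) (\<lambda>x. strip_kernel \<alpha> (snd x))"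
      by (rule continuous_on_compose2[OF continuous_strip_kernel[OF \<alpha>, of UNIV]]) (auto intro!: continuous_intros)
    ultimately show "continuous_on (strip \<alpha> \<times> cbox (-real n) (real n))
        (\<lambda>(\<zeta>, t). deriv \<psi> (\<zeta> + of_real t) * of_real (strip_kernel \<alpha> t))"
      by (auto simp: case_prod_unfold intro!: continuous_intros)
  qed (rule convex_strip)
  have tail: "cmod (cauchy_dual \<alpha> \<phi> \<zeta> - f n \<zeta>) \<le> (\<integral>t. indicator (- {-real n..real n}) t * strip_kernel \<alpha> t \<partial>lborel)"
    if \<zeta>: "\<zeta> \<in> strip \<alpha>" for \<zeta> n
  proof -
    let ?h = "\<lambda>t. \<psi> (\<zeta> + of_real t) * of_real (strip_kernel \<alpha> t)"
    have int: "integrable lborel ?h" and le: "\<And>t. cmod (?h t) \<le> strip_kernel \<alpha> t"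
      using cauchy_dual_integrand[OF \<alpha> contphi le1 \<zeta>] by (simp_all add: \<psi>_def)
    have si: "set_integrable lborel {-real n..real n} ?h"
      using int unfolding set_integrable_def by (intro integrable_mult_indicator) auto
    then have "f n \<zeta> = (\<integral>t. indicator {-real n..real n} t *\<^sub>R ?h t \<partial>lborel)"
      using set_borel_integral_eq_integral(2)[OF si] by (simp add: f_def set_lebesgue_integral_def)
    moreover have "cauchy_dual \<alpha> \<phi> \<zeta> = (\<integral>t. ?h t \<partial>lborel)" by (simp add: cauchy_dual_def \<psi>_def)
    ultimately have "cauchy_dual \<alpha> \<phi> \<zeta> - f n \<zeta> = (\<integral>t. ?h t - indicator {-real n..real n} t *\<^sub>R ?h t \<partial>lborel)"
      using int si by (simp add: Bochner_Integration.integral_diff set_integrable_def)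
    also have "cmod \<dots> \<le> (\<integral>t. indicator (- {-real n..real n}) t * strip_kernel \<alpha> t \<partial>lborel)"
    proof (rule Bochner_Integration.integral_norm_bound_integral)
      show "integrable lborel (\<lambda>t. ?h t - indicator {-real n..real n} t *\<^sub>R ?h t)"
        using int si by (intro Bochner_Integration.integrable_diff) (simp_all add: set_integrable_def)
      show "integrable lborel (\<lambda>t. indicator (- {-real n..real n}) t * strip_kernel \<alpha> t)"
        using integrable_mult_indicator[OF _ integral_strip_kernel(1)[OF \<alpha>], of "- {-real n..real n}"] by simp
      show "cmod (?h t - indicator {-real n..real n} t *\<^sub>R ?h t) \<le> indicator (- {-real n..real n}) t * strip_kernel \<alpha> t" for t
        using le[of t] by (auto simp: indicator_def)
    qed
    finally show ?thesis .
  qed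
  have ulim: "uniform_limit (strip \<alpha>) f (cauchy_dual \<alpha> \<phi>) sequentially"
  proof (rule uniform_limitI)
    fix e :: real assume "e > 0"
    with kernel_tail_tendsto_0[OF \<alpha>]
    have "\<forall>\<^sub>F n in sequentially. (\<integral>t. indicator (- {-real n..real n}) t * strip_kernel \<alpha> t \<partial>lborel) < e"
      by (rule order_tendstoD(2))
    then show "\<forall>\<^sub>F n in sequentially. \<forall>\<zeta>\<in>strip \<alpha>. dist (f n \<zeta>) (cauchy_dual \<alpha> \<phi> \<zeta>) < e"
    proof eventually_elim
      case (elim n)
      show ?case
      proof
        fix \<zeta> assume "\<zeta> \<in> strip \<alpha>"
        from le_less_trans[OF tail[OF this] elim] show "dist (f n \<zeta>) (cauchy_dual \<alpha> \<phi> \<zeta>) < e"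
          by (simp add: dist_norm norm_minus_commute)
      qed
    qed
  qed
  show ?thesis
  proof (rule holomorphic_uniform_sequence[OF open_strip holf])
    fix \<zeta> assume "\<zeta> \<in> strip \<alpha>"
    then obtain d where "d > 0" "cball \<zeta> d \<subseteq> strip \<alpha>"
      using open_strip open_contains_cball by blast
    then show "\<exists>d. 0 < d \<and> cball \<zeta> d \<subseteq> strip \<alpha> \<and> uniform_limit (cball \<zeta> d) f (cauchy_dual \<alpha> \<phi>) sequentially"
      using uniform_limit_on_subset[OF ulim] by blast
  qed
qed


section \<open>Gram forms over the strip and the positive edge kernel\<close>

definition gram :: "'i set \<Rightarrow> ('i \<Rightarrow> 'i \<Rightarrow> complex) \<Rightarrow> ('i \<Rightarrow> complex) \<Rightarrow> ('i \<Rightarrow> complex) \<Rightarrow> complex" where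
  "gram N G u v = (\<Sum>j\<in>N. \<Sum>k\<in>N. u j * cnj (v k) * G j k)"

lemma gram_cong:
  assumes "\<And>j. j \<in> N \<Longrightarrow> u j = u' j" "\<And>j. j \<in> N \<Longrightarrow> v j = v' j"
    and "\<And>j k. j \<in> N \<Longrightarrow> k \<in> N \<Longrightarrow> G j k = G' j k"
  shows "gram N G u v = gram N G' u' v'"
  unfolding gram_def by (intro sum.cong) (auto simp: assms)

lemma gram_semi_inner:
  assumes "\<And>j k. j \<in> N \<Longrightarrow> k \<in> N \<Longrightarrow> G k j = cnj (G j k)" and "\<And>u. 0 \<le> Re (gram N G u u)"
  shows "semi_inner (\<lambda>c u j. c * u j) (gram N G)"
proof
  show "gram N G (u + v) w = gram N G u w + gram N G v w" for u v w
    unfolding gram_def plus_fun_def by (simp add: distrib_right sum.distrib)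
  show "gram N G (\<lambda>j. c * u j) w = c * gram N G u w" for c u w
    by (simp add: gram_def sum_distrib_left mult.assoc)
  show "gram N G v u = cnj (gram N G u v)" for u v
  proof -
    have "cnj (gram N G u v) = (\<Sum>j\<in>N. \<Sum>k\<in>N. v k * cnj (u j) * G k j)"
      unfolding gram_def cnj_sum
    proof (intro sum.cong refl)
      fix j k assume "j \<in> N" "k \<in> N"
      from assms(1)[OF this] show "cnj (u j * cnj (v k) * G j k) = v k * cnj (u j) * G k j" by simp
    qed
    also have "\<dots> = gram N G v u" unfolding gram_def by (rule sum.swap)
    finally show ?thesis ..
  qed
qed (rule assms(2))

lemma gram_congruence:
  "gram N (\<lambda>j k. G j k * (y j * cnj (y k))) u v = gram N G (\<lambda>j. u j * y j) (\<lambda>j. v j * y j)"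
  by (simp add: gram_def mult_ac)

lemma gram_scale: "gram N (\<lambda>j k. G j k * (c * H j k)) u v = c * gram N (\<lambda>j k. G j k * H j k) u v"
  by (simp add: gram_def sum_distrib_left mult_ac)

definition admissible :: "real \<Rightarrow> (complex \<Rightarrow> complex) set" where
  "admissible \<alpha> = {\<phi>. \<phi> holomorphic_on strip \<alpha> \<and> (\<forall>z\<in>strip \<alpha>. cmod (\<phi> z) \<le> 1)}"

text \<open>The operator with eigenvalues \<open>exp (\<zeta> j)\<close> in a basis with Gram matrix \<open>G\<close>.  The half-plane conditions
  say that its multiples by \<open>-\<i> exp (\<i>\<alpha>)\<close> and by \<open>\<i> exp (-\<i>\<alpha>)\<close> have nonnegative real part; the corresponding
  half-planes intersect in the sector of half-angle \<open>\<alpha>\<close>.  Bounded coordinate evaluations mean that the form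
  is definite; they make the best multiplier constant finite before it is estimated.\<close>

locale sector_gram =
  fixes N :: "'i set" and G :: "'i \<Rightarrow> 'i \<Rightarrow> complex" and \<zeta> :: "'i \<Rightarrow> complex" and \<alpha> :: real
  assumes finite_nodes: "finite N" and \<alpha>: "0 < \<alpha>" "\<alpha> \<le> pi / 2"
    and herm: "\<And>j k. j \<in> N \<Longrightarrow> k \<in> N \<Longrightarrow> G k j = cnj (G j k)"
    and nonneg: "\<And>u. 0 \<le> Re (gram N G u u)"
    and nodes: "\<And>j. j \<in> N \<Longrightarrow> \<zeta> j \<in> strip \<alpha>"
    and lower_half_plane: "\<And>u. 0 \<le> Re (gram N (\<lambda>j k. G j k *
        (- \<i> * exp (\<i> * \<alpha>) * exp (\<zeta> j) + cnj (- \<i> * exp (\<i> * \<alpha>) * exp (\<zeta> k)))) u u)"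
    and upper_half_plane: "\<And>u. 0 \<le> Re (gram N (\<lambda>j k. G j k *
        (\<i> * exp (- \<i> * \<alpha>) * exp (\<zeta> j) + cnj (\<i> * exp (- \<i> * \<alpha>) * exp (\<zeta> k)))) u u)"
    and evaluation_bounded: "\<And>j. j \<in> N \<Longrightarrow> \<exists>C. \<forall>u. (cmod (u j))\<^sup>2 \<le> C * Re (gram N G u u)"
begin

sublocale semi_inner "\<lambda>c u j. c * u j" "gram N G"
  by (rule gram_semi_inner) (auto intro: herm nonneg)

definition edge_kernel :: "complex \<Rightarrow> complex \<Rightarrow> 'i \<Rightarrow> 'i \<Rightarrow> complex" where
  "edge_kernel c \<sigma> j k = c / (2 * pi) * (ekern (\<zeta> j) \<sigma> - cnj (ekern (\<zeta> k) \<sigma>))"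

text \<open>The resolvent identity factors the edge kernel as the kernel of a half-plane condition times
  \<open>y j * cnj (y k)\<close> with \<open>y j = ekern (\<zeta> j) \<sigma>\<close>.  It is therefore congruent, through a diagonal matrix, to a form
  that is positive by assumption.\<close>

lemma edge_kernel_semi_inner:
  assumes c: "cnj c = - c" and e: "e = exp (- \<i> * s)" and ne: "\<And>j. j \<in> N \<Longrightarrow> exp (\<zeta> j - Complex t s) \<noteq> 1"
    and pos: "\<And>u. 0 \<le> Re (gram N (\<lambda>j k. G j k *
        (c * e * exp (\<zeta> j) + cnj (c * e * exp (\<zeta> k)))) u u)"
  shows "semi_inner (\<lambda>c u j. c * u j) (gram N (\<lambda>j k. G j k * edge_kernel c (Complex t s) j k))"
proof (rule gram_semi_inner)
  let ?\<sigma> = "Complex t s"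
  fix j k assume "j \<in> N" "k \<in> N"
  then show "G k j * edge_kernel c ?\<sigma> k j = cnj (G j k * edge_kernel c ?\<sigma> j k)"
    using herm[of j k] c by (simp add: edge_kernel_def algebra_simps)
next
  let ?\<sigma> = "Complex t s"
  fix u :: "'i \<Rightarrow> complex"
  define y where "y = (\<lambda>j. ekern (\<zeta> j) ?\<sigma>)"
  define H where "H = (\<lambda>j k. c * e * exp (\<zeta> j) + cnj (c * e * exp (\<zeta> k)))"
  have p: "exp (\<zeta> j - ?\<sigma>) = of_real (exp (- t)) * (e * exp (\<zeta> j))" for j
    by (simp add: e exp_of_real[symmetric] Complex_eq algebra_simps flip: exp_add)
  have eq: "edge_kernel c ?\<sigma> j k = of_real (exp (- t) / (2 * pi)) * (H j k * (y j * cnj (y k)))"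
    if "j \<in> N" "k \<in> N" for j k
  proof -
    define a b where "a = exp (\<zeta> j - ?\<sigma>)" and "b = exp (\<zeta> k - ?\<sigma>)"
    have ab: "a \<noteq> 1" "b \<noteq> 1" using that ne by (auto simp: a_def b_def)
    then have "cnj b \<noteq> 1" by (metis complex_cnj_cnj complex_cnj_one)
    then have sub: "1 / (1 - a) - 1 / (1 - cnj b) = (a - cnj b) * (1 / (1 - a) * (1 / (1 - cnj b)))"
      using ab by (simp add: divide_simps)
    have y: "y j = 1 / (1 - a)" "cnj (y k) = 1 / (1 - cnj b)"
      by (simp_all add: y_def ekern_def a_def b_def)
    have "edge_kernel c ?\<sigma> j k = c / (2 * pi) * (y j - cnj (y k))"
      by (simp add: edge_kernel_def y_def)
    also have "y j - cnj (y k) = (a - cnj b) * (y j * cnj (y k))" unfolding y by (rule sub)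
    also have "c / (2 * pi) * ((a - cnj b) * (y j * cnj (y k))) = 1 / (2 * pi) * (c * (a - cnj b)) * (y j * cnj (y k))"
      by simp
    also have "c * (a - cnj b) = c * a + cnj (c * b)" by (simp add: c right_diff_distrib)
    also have "\<dots> = of_real (exp (- t)) * H j k"
      unfolding a_def b_def p H_def by (simp add: algebra_simps)
    finally show ?thesis by simp
  qed
  have "gram N (\<lambda>j k. G j k * edge_kernel c ?\<sigma> j k) u u
      = gram N (\<lambda>j k. G j k * (of_real (exp (- t) / (2 * pi)) * (H j k * (y j * cnj (y k))))) u u"
    by (rule gram_cong) (simp_all add: eq)
  also have "\<dots> = of_real (exp (- t) / (2 * pi)) * gram N (\<lambda>j k. G j k * H j k * (y j * cnj (y k))) u u"
    by (simp only: gram_scale mult.assoc)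
  also have "\<dots> = of_real (exp (- t) / (2 * pi)) * gram N (\<lambda>j k. G j k * H j k) (\<lambda>j. u j * y j) (\<lambda>j. u j * y j)"
    by (simp add: gram_congruence)
  finally show "0 \<le> Re (gram N (\<lambda>j k. G j k * edge_kernel c ?\<sigma> j k) u u)"
    using pos[of "\<lambda>j. u j * y j"] by (simp add: H_def del: of_real_divide)
qed

lemma lower_edge: "semi_inner (\<lambda>c u j. c * u j) (gram N (\<lambda>j k. G j k * edge_kernel (- \<i>) (Complex t (- \<alpha>)) j k))"
proof (rule edge_kernel_semi_inner[OF _ _ _ lower_half_plane])
  show "exp (\<zeta> j - Complex t (- \<alpha>)) \<noteq> 1" if "j \<in> N" for j
    by (rule exp_ne_1) (use nodes[OF that] \<alpha> in \<open>auto simp: strip_def\<close>)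
qed auto

lemma upper_edge: "semi_inner (\<lambda>c u j. c * u j) (gram N (\<lambda>j k. G j k * edge_kernel \<i> (Complex t \<alpha>) j k))"
proof (rule edge_kernel_semi_inner[OF _ _ _ upper_half_plane])
  show "exp (\<zeta> j - Complex t \<alpha>) \<noteq> 1" if "j \<in> N" for j
    by (rule exp_ne_1) (use nodes[OF that] \<alpha> in \<open>auto simp: strip_def\<close>)
qed auto

definition edge_density :: "(complex \<Rightarrow> complex) \<Rightarrow> ('i \<Rightarrow> complex) \<Rightarrow> ('i \<Rightarrow> complex) \<Rightarrow> real \<Rightarrow> complex" where
  "edge_density \<phi> u v t =
     \<phi> (Complex t (- \<alpha>)) * gram N (\<lambda>j k. G j k * edge_kernel (- \<i>) (Complex t (- \<alpha>)) j k) u v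
     + \<phi> (Complex t \<alpha>) * gram N (\<lambda>j k. G j k * edge_kernel \<i> (Complex t \<alpha>) j k) u v"

text \<open>The form of the operator \<open>\<phi>(W) + g(W)\<^sup>*\<close>, with \<open>g\<close> the dual Cauchy transform of \<open>\<phi>\<close>.\<close>

definition dual_sum :: "(complex \<Rightarrow> complex) \<Rightarrow> ('i \<Rightarrow> complex) \<Rightarrow> ('i \<Rightarrow> complex) \<Rightarrow> complex" where
  "dual_sum \<phi> u v = gram N G (\<lambda>j. \<phi> (\<zeta> j) * u j) v + gram N G u (\<lambda>j. cauchy_dual \<alpha> \<phi> (\<zeta> j) * v j)"

text \<open>Entry by entry this is \<open>strip_identity\<close> with \<open>c = \<zeta> j\<close> and \<open>d = cnj (\<zeta> k)\<close>: on an edge, conjugation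
  moves the pole of a kernel from \<open>\<zeta> k\<close> to \<open>cnj (\<zeta> k) \<plusminus> 2\<i>\<alpha>\<close>.\<close>

lemma integral_edge_density:
  assumes cont: "continuous_on (closed_strip (-\<alpha>) \<alpha>) \<phi>" and hol: "\<phi> holomorphic_on strip \<alpha>"
    and le1: "\<And>\<sigma>. \<sigma> \<in> closed_strip (-\<alpha>) \<alpha> \<Longrightarrow> cmod (\<phi> \<sigma>) \<le> 1"
  shows "integrable lborel (edge_density \<phi> u v)" "(\<integral>t. edge_density \<phi> u v t \<partial>lborel) = dual_sum \<phi> u v"
proof -
  define lower where "lower = (\<lambda>j k t. \<phi> (Complex t (-\<alpha>)) *
    (ekern (\<zeta> j) (Complex t (-\<alpha>)) - ekern (cnj (\<zeta> k) - 2 * \<i> * \<alpha>) (Complex t (-\<alpha>))))"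
  define upper where "upper = (\<lambda>j k t. \<phi> (Complex t \<alpha>) *
    (ekern (\<zeta> j) (Complex t \<alpha>) - ekern (cnj (\<zeta> k) + 2 * \<i> * \<alpha>) (Complex t \<alpha>)))"
  define W where "W = (\<lambda>j k. u j * cnj (v k) * G j k * (- \<i> / (2 * pi)))"
  have lk: "\<phi> (Complex t (-\<alpha>)) * edge_kernel (- \<i>) (Complex t (- \<alpha>)) j k = - \<i> / (2 * pi) * lower j k t" for j k t
  proof -
    have "cnj (ekern (\<zeta> k) (Complex t (- \<alpha>))) = ekern (cnj (\<zeta> k) - 2 * \<i> * \<alpha>) (Complex t (-\<alpha>))"
      by (simp add: ekern_def exp_cnj Complex_eq algebra_simps)
    then show ?thesis by (simp add: edge_kernel_def lower_def)
  qed
  have uk: "\<phi> (Complex t \<alpha>) * edge_kernel \<i> (Complex t \<alpha>) j k = - (- \<i> / (2 * pi) * upper j k t)" for j k t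
  proof -
    have "cnj (ekern (\<zeta> k) (Complex t \<alpha>)) = ekern (cnj (\<zeta> k) + 2 * \<i> * \<alpha>) (Complex t \<alpha>)"
      by (simp add: ekern_def exp_cnj Complex_eq algebra_simps)
    then show ?thesis by (simp add: edge_kernel_def upper_def)
  qed
  have dens: "edge_density \<phi> u v = (\<lambda>t. \<Sum>j\<in>N. \<Sum>k\<in>N. W j k * (lower j k t - upper j k t))"
  proof
    fix t
    have "edge_density \<phi> u v t = (\<Sum>j\<in>N. \<Sum>k\<in>N. u j * cnj (v k) * G j k *
        (\<phi> (Complex t (-\<alpha>)) * edge_kernel (- \<i>) (Complex t (- \<alpha>)) j k
          + \<phi> (Complex t \<alpha>) * edge_kernel \<i> (Complex t \<alpha>) j k))"
      unfolding edge_density_def gram_def sum_distrib_left sum.distrib[symmetric]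
      by (intro sum.cong refl) (simp add: distrib_left mult_ac)
    also have "\<dots> = (\<Sum>j\<in>N. \<Sum>k\<in>N. W j k * (lower j k t - upper j k t))"
    proof (intro sum.cong refl)
      have alg: "w * (x * l + - (x * r)) = w * x * (l - r)" for w x l r :: complex
        by (simp add: algebra_simps)
      show "u j * cnj (v k) * G j k * (\<phi> (Complex t (-\<alpha>)) * edge_kernel (- \<i>) (Complex t (- \<alpha>)) j k
          + \<phi> (Complex t \<alpha>) * edge_kernel \<i> (Complex t \<alpha>) j k) = W j k * (lower j k t - upper j k t)" for j k
        unfolding lk uk alg W_def ..
    qed
    finally show "edge_density \<phi> u v t = (\<Sum>j\<in>N. \<Sum>k\<in>N. W j k * (lower j k t - upper j k t))" .
  qed
  have id: "integrable lborel (lower j k)" "integrable lborel (upper j k)"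
    "(\<integral>t. lower j k t \<partial>lborel) - (\<integral>t. upper j k t \<partial>lborel) = 2 * pi * \<i> * (\<phi> (\<zeta> j) + cnj (cauchy_dual \<alpha> \<phi> (\<zeta> k)))"
    if "j \<in> N" "k \<in> N" for j k
  proof -
    have c: "\<bar>Im (\<zeta> j)\<bar> < \<alpha>" "\<bar>Im (cnj (\<zeta> k))\<bar> < \<alpha>" using nodes that by (auto simp: strip_def)
    note * = strip_identity[OF \<alpha> c cont hol[unfolded strip_def] le1]
    show "integrable lborel (lower j k)" unfolding lower_def by (rule *(1))
    show "integrable lborel (upper j k)" unfolding upper_def by (rule *(2))
    have "cnj (cauchy_dual \<alpha> \<phi> (\<zeta> k)) = (\<integral>t. \<phi> (cnj (\<zeta> k) + of_real t) * of_real (strip_kernel \<alpha> t) \<partial>lborel)"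
      unfolding cauchy_dual_def
      using Bochner_Integration.integral_cnj[of lborel "\<lambda>t. cnj (\<phi> (cnj (\<zeta> k + of_real t))) * of_real (strip_kernel \<alpha> t)"]
      by simp
    then show "(\<integral>t. lower j k t \<partial>lborel) - (\<integral>t. upper j k t \<partial>lborel) = 2 * pi * \<i> * (\<phi> (\<zeta> j) + cnj (cauchy_dual \<alpha> \<phi> (\<zeta> k)))"
      using *(4) by (simp add: lower_def upper_def)
  qed
  have int: "integrable lborel (\<lambda>t. W j k * (lower j k t - upper j k t))" if "j \<in> N" "k \<in> N" for j k
    using id(1,2)[OF that] by (intro integrable_mult_right Bochner_Integration.integrable_diff)
  show "integrable lborel (edge_density \<phi> u v)"
    unfolding dens by (intro Bochner_Integration.integrable_sum int)
  have "(\<integral>t. edge_density \<phi> u v t \<partial>lborel) = (\<Sum>j\<in>N. \<Sum>k\<in>N. (\<integral>t. W j k * (lower j k t - upper j k t) \<partial>lborel))"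
  proof -
    have "(\<integral>t. edge_density \<phi> u v t \<partial>lborel) = (\<Sum>j\<in>N. (\<integral>t. (\<Sum>k\<in>N. W j k * (lower j k t - upper j k t)) \<partial>lborel))"
      unfolding dens by (rule Bochner_Integration.integral_sum) (rule Bochner_Integration.integrable_sum, rule int)
    also have "\<dots> = (\<Sum>j\<in>N. \<Sum>k\<in>N. (\<integral>t. W j k * (lower j k t - upper j k t) \<partial>lborel))"
      by (rule sum.cong[OF refl], rule Bochner_Integration.integral_sum) (rule int)
    finally show ?thesis .
  qed
  also have "\<dots> = (\<Sum>j\<in>N. \<Sum>k\<in>N. u j * cnj (v k) * G j k * (\<phi> (\<zeta> j) + cnj (cauchy_dual \<alpha> \<phi> (\<zeta> k))))"
  proof (intro sum.cong refl)
    fix j k assume jk: "j \<in> N" "k \<in> N"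
    have "(\<integral>t. W j k * (lower j k t - upper j k t) \<partial>lborel) = W j k * ((\<integral>t. lower j k t \<partial>lborel) - (\<integral>t. upper j k t \<partial>lborel))"
      using id(1,2)[OF jk] by (simp add: Bochner_Integration.integral_diff)
    also have "\<dots> = u j * cnj (v k) * G j k * (\<phi> (\<zeta> j) + cnj (cauchy_dual \<alpha> \<phi> (\<zeta> k)))"
    proof -
      have alg: "w * (- \<i> / (2 * pi)) * (2 * pi * \<i> * x) = w * x" for w x :: complex
        by (simp add: field_simps)
      show ?thesis unfolding id(3)[OF jk] W_def by (rule alg)
    qed
    finally show "(\<integral>t. W j k * (lower j k t - upper j k t) \<partial>lborel)
      = u j * cnj (v k) * G j k * (\<phi> (\<zeta> j) + cnj (cauchy_dual \<alpha> \<phi> (\<zeta> k)))" .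
  qed
  also have "\<dots> = dual_sum \<phi> u v"
    unfolding dual_sum_def gram_def sum.distrib[symmetric]
    by (intro sum.cong refl) (simp add: distrib_left mult_ac)
  finally show "(\<integral>t. edge_density \<phi> u v t \<partial>lborel) = dual_sum \<phi> u v" .
qed

text \<open>The total mass of the edge kernel: the dual of the constant 1 is the constant \<open>1 - 2\<alpha>/\<pi>\<close>.\<close>

lemma dual_sum_one: "dual_sum (\<lambda>_. 1) u u = of_real (2 * (1 - \<alpha> / pi)) * gram N G u u"
proof -
  have "cauchy_dual \<alpha> (\<lambda>_. 1) z = of_real (1 - 2 * \<alpha> / pi)" for z
    unfolding cauchy_dual_def using integral_strip_kernel[OF \<alpha>] by (simp del: of_real_diff of_real_divide)
  then have "dual_sum (\<lambda>_. 1) u u = gram N G u u + of_real (1 - 2 * \<alpha> / pi) * gram N G u u"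
    using B_sc_right[of u "of_real (1 - 2 * \<alpha> / pi)" u] by (simp add: dual_sum_def)
  then show ?thesis by (simp add: algebra_simps)
qed

text \<open>The edge forms are positive and \<open>\<bar>\<phi>\<bar> \<le> 1\<close>, so the density for \<open>\<phi>\<close> is dominated by that for the
  constant 1.\<close>

lemma dual_sum_mean:
  assumes cont: "continuous_on (closed_strip (-\<alpha>) \<alpha>) \<phi>" and hol: "\<phi> holomorphic_on strip \<alpha>"
    and le1: "\<And>\<sigma>. \<sigma> \<in> closed_strip (-\<alpha>) \<alpha> \<Longrightarrow> cmod (\<phi> \<sigma>) \<le> 1"
  shows "cmod (dual_sum \<phi> u v) \<le> (1 - \<alpha> / pi) * (Re (gram N G u u) + Re (gram N G v v))"
proof -
  define one :: "complex \<Rightarrow> complex" where "one = (\<lambda>_. 1)"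
  have one: "integrable lborel (edge_density one u u)" "(\<integral>t. edge_density one u u t \<partial>lborel) = dual_sum one u u" for u
    by (rule integral_edge_density; simp add: one_def)+
  have "cmod (edge_density \<phi> u v t) \<le> (Re (edge_density one u u t) + Re (edge_density one v v t)) / 2" for t
  proof -
    interpret L: semi_inner "\<lambda>c u j. c * u j" "gram N (\<lambda>j k. G j k * edge_kernel (- \<i>) (Complex t (- \<alpha>)) j k)"
      by (rule lower_edge)
    interpret U: semi_inner "\<lambda>c u j. c * u j" "gram N (\<lambda>j k. G j k * edge_kernel \<i> (Complex t \<alpha>) j k)"
      by (rule upper_edge)
    have "cmod (\<phi> (Complex t (- \<alpha>))) \<le> 1" "cmod (\<phi> (Complex t \<alpha>)) \<le> 1"
      using \<alpha> by (auto intro!: le1 simp: closed_strip_def)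
    then have "cmod (edge_density \<phi> u v t) \<le>
        cmod (gram N (\<lambda>j k. G j k * edge_kernel (- \<i>) (Complex t (- \<alpha>)) j k) u v)
        + cmod (gram N (\<lambda>j k. G j k * edge_kernel \<i> (Complex t \<alpha>) j k) u v)"
      unfolding edge_density_def
      by (intro order_trans[OF norm_triangle_ineq] add_mono) (simp_all add: norm_mult mult_left_le_one_le)
    also have "\<dots> \<le> (Re (edge_density one u u t) + Re (edge_density one v v t)) / 2"
      using L.cmod_B_le_mean[of u v] U.cmod_B_le_mean[of u v] by (simp add: edge_density_def one_def field_simps)
    finally show ?thesis .
  qed
  then have "cmod (\<integral>t. edge_density \<phi> u v t \<partial>lborel) \<le> (\<integral>t. (Re (edge_density one u u t) + Re (edge_density one v v t)) / 2 \<partial>lborel)"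
    using one by (intro Bochner_Integration.integral_norm_bound_integral integral_edge_density[OF assms]) auto
  also have "\<dots> = (Re (dual_sum one u u) + Re (dual_sum one v v)) / 2"
    using one by (simp add: integral_Re)
  also have "\<dots> = (1 - \<alpha> / pi) * (Re (gram N G u u) + Re (gram N G v v))"
    unfolding one_def dual_sum_one by (simp add: field_simps)
  finally show ?thesis using integral_edge_density(2)[OF assms] by simp
qed

lemma dual_sum_bound:
  assumes "continuous_on (closed_strip (-\<alpha>) \<alpha>) \<phi>" and "\<phi> holomorphic_on strip \<alpha>"
    and "\<And>\<sigma>. \<sigma> \<in> closed_strip (-\<alpha>) \<alpha> \<Longrightarrow> cmod (\<phi> \<sigma>) \<le> 1"
  shows "cmod (dual_sum \<phi> u v) \<le> 2 * (1 - \<alpha> / pi) * (nm u * nm v)"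
proof (rule form_bound)
  show "cmod (dual_sum \<phi> u v) \<le> (1 - \<alpha> / pi) * (Re (gram N G u u) + Re (gram N G v v))" for u v
    by (rule dual_sum_mean[OF assms])
  show "0 \<le> 1 - \<alpha> / pi" using \<alpha> by (simp add: divide_simps)
  show "dual_sum \<phi> (\<lambda>j. c * u j) v = c * dual_sum \<phi> u v" for c u v
    by (simp add: dual_sum_def B_sc_left mult.left_commute[of _ c] distrib_left)
  show "dual_sum \<phi> u (\<lambda>j. c * v j) = cnj c * dual_sum \<phi> u v" for c u v
    by (simp add: dual_sum_def B_sc_right mult.left_commute[of _ c] distrib_left)
qed

end


section \<open>The multiplier bound\<close>

lemma strip_dilate:
  assumes "z \<in> closed_strip (-\<alpha>) \<alpha>" "0 < s" "s < 1" "0 < \<alpha>"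
  shows "of_real s * z \<in> strip \<alpha>"
proof -
  have "\<bar>s * Im z\<bar> \<le> s * \<alpha>" using assms by (auto simp: closed_strip_def abs_mult intro!: mult_left_mono)
  also have "\<dots> < \<alpha>" using assms by simp
  finally show ?thesis by (simp add: strip_def)
qed

text \<open>Edge integrals require continuity up to the boundary, which a dilation provides.\<close>

lemma admissible_dilate:
  assumes \<phi>: "\<phi> \<in> admissible \<alpha>" and s: "0 < s" "s < 1" and "0 < \<alpha>"
  defines "\<psi> \<equiv> \<lambda>z. \<phi> (of_real s * z)"
  shows "continuous_on (closed_strip (-\<alpha>) \<alpha>) \<psi>" "\<psi> holomorphic_on strip \<alpha>"
    "\<And>z. z \<in> closed_strip (-\<alpha>) \<alpha> \<Longrightarrow> cmod (\<psi> z) \<le> 1" "\<psi> \<in> admissible \<alpha>"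
proof -
  have hol: "\<phi> holomorphic_on strip \<alpha>" and le: "\<And>z. z \<in> strip \<alpha> \<Longrightarrow> cmod (\<phi> z) \<le> 1"
    using \<phi> by (auto simp: admissible_def)
  have sub: "strip \<alpha> \<subseteq> closed_strip (-\<alpha>) \<alpha>" by (auto simp: strip_def closed_strip_def)
  show "continuous_on (closed_strip (-\<alpha>) \<alpha>) \<psi>"
    unfolding \<psi>_def
    by (rule continuous_on_compose2[OF holomorphic_on_imp_continuous_on[OF hol]])
      (use strip_dilate[OF _ s assms(4)] in \<open>auto intro!: continuous_intros\<close>)
  have "(\<phi> \<circ> (\<lambda>z. of_real s * z)) holomorphic_on strip \<alpha>"
    by (rule holomorphic_on_compose_gen[OF _ hol])
      (use strip_dilate[OF _ s assms(4)] sub in \<open>auto intro!: holomorphic_intros\<close>)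
  then show hol': "\<psi> holomorphic_on strip \<alpha>" by (simp add: \<psi>_def o_def)
  show le': "cmod (\<psi> z) \<le> 1" if "z \<in> closed_strip (-\<alpha>) \<alpha>" for z
    using le[OF strip_dilate[OF that s assms(4)]] by (simp add: \<psi>_def)
  show "\<psi> \<in> admissible \<alpha>"
    using hol' le' sub by (auto simp: admissible_def)
qed

lemma le_quadratic_root:
  fixes x k a :: real
  assumes "x\<^sup>2 \<le> 2 * k * x + a" and "0 \<le> k\<^sup>2 + a"
  shows "x \<le> k + sqrt (k\<^sup>2 + a)"
proof -
  have "(x - k)\<^sup>2 \<le> k\<^sup>2 + a" using assms(1) by (simp add: power2_diff algebra_simps)
  then have "\<bar>x - k\<bar> \<le> sqrt (k\<^sup>2 + a)" using real_le_rsqrt[of "\<bar>x - k\<bar>"] by simp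
  then show ?thesis by linarith
qed

context sector_gram
begin

lemma multiplication_bounded:
  "\<exists>C. \<forall>c u. (\<forall>j\<in>N. cmod (c j) \<le> 1) \<longrightarrow> nm (\<lambda>j. c j * u j) \<le> C * nm u"
proof -
  obtain C where C: "\<And>j u. j \<in> N \<Longrightarrow> (cmod (u j))\<^sup>2 \<le> C j * Re (gram N G u u)"
    using evaluation_bounded by metis
  define D where "D = (\<lambda>j. sqrt \<bar>C j\<bar>)"
  have D: "cmod (u j) \<le> D j * nm u" if "j \<in> N" for j u
  proof (rule power2_le_imp_le)
    have "(cmod (u j))\<^sup>2 \<le> \<bar>C j\<bar> * Re (gram N G u u)"
      using C[OF that, of u] mult_right_mono[OF abs_ge_self[of "C j"] nonneg[of u]] by linarith
    then show "(cmod (u j))\<^sup>2 \<le> (D j * nm u)\<^sup>2" by (simp add: power_mult_distrib nm_square D_def)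
  qed (simp add: D_def)
  define E where "E = (\<Sum>j\<in>N. \<Sum>k\<in>N. D j * D k * cmod (G j k))"
  show ?thesis
  proof (intro exI[of _ "sqrt E"] allI impI)
    fix c u :: "'i \<Rightarrow> complex" assume c: "\<forall>j\<in>N. cmod (c j) \<le> 1"
    have cu: "cmod (c j * u j) \<le> D j * nm u" if "j \<in> N" for j
      using mult_mono[OF bspec[OF c that] D[OF that, of u]] by (simp add: norm_mult)
    have "(nm (\<lambda>j. c j * u j))\<^sup>2 \<le> cmod (gram N G (\<lambda>j. c j * u j) (\<lambda>j. c j * u j))"
      unfolding nm_square by (rule complex_Re_le_cmod)
    also have "gram N G (\<lambda>j. c j * u j) (\<lambda>j. c j * u j) = (\<Sum>j\<in>N. \<Sum>k\<in>N. (c j * u j) * cnj (c k * u k) * G j k)"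
      by (rule gram_def)
    also have "cmod \<dots> \<le> (\<Sum>j\<in>N. \<Sum>k\<in>N. cmod ((c j * u j) * cnj (c k * u k) * G j k))"
      by (intro order_trans[OF norm_sum] sum_mono norm_sum)
    also have "\<dots> \<le> (\<Sum>j\<in>N. \<Sum>k\<in>N. (D j * nm u) * (D k * nm u) * cmod (G j k))"
    proof (intro sum_mono)
      fix j k assume jk: "j \<in> N" "k \<in> N"
      have "cmod (c j * u j) * cmod (c k * u k) * cmod (G j k) \<le> (D j * nm u) * (D k * nm u) * cmod (G j k)"
        using cu[OF jk(1)] cu[OF jk(2)] by (intro mult_mono) (auto simp: D_def)
      then show "cmod ((c j * u j) * cnj (c k * u k) * G j k) \<le> (D j * nm u) * (D k * nm u) * cmod (G j k)"
        by (simp add: norm_mult)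
    qed
    also have "\<dots> = E * (nm u)\<^sup>2"
      unfolding E_def sum_distrib_right by (intro sum.cong refl) (simp add: power2_eq_square mult_ac)
    finally have "sqrt ((nm (\<lambda>j. c j * u j))\<^sup>2) \<le> sqrt (E * (nm u)\<^sup>2)" by (rule real_sqrt_le_mono)
    then show "nm (\<lambda>j. c j * u j) \<le> sqrt E * nm u" by (simp add: real_sqrt_mult)
  qed
qed

definition norm_set :: "real set" where
  "norm_set = {nm (\<lambda>j. \<phi> (\<zeta> j) * u j) | \<phi> u. \<phi> \<in> admissible \<alpha> \<and> nm u \<le> 1}"

definition mult_const :: real where "mult_const = Sup norm_set"

lemma admissible_node: "\<phi> \<in> admissible \<alpha> \<Longrightarrow> j \<in> N \<Longrightarrow> cmod (\<phi> (\<zeta> j)) \<le> 1"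
  using nodes by (auto simp: admissible_def)

lemma bdd_above_norm_set: "bdd_above norm_set"
proof -
  obtain C where C: "\<And>c u. (\<forall>j\<in>N. cmod (c j) \<le> 1) \<Longrightarrow> nm (\<lambda>j. c j * u j) \<le> C * nm u"
    using multiplication_bounded by blast
  show ?thesis
  proof (rule bdd_aboveI[of _ "\<bar>C\<bar>"])
    fix x assume "x \<in> norm_set"
    then obtain \<phi> u where x: "x = nm (\<lambda>j. \<phi> (\<zeta> j) * u j)" "\<phi> \<in> admissible \<alpha>" "nm u \<le> 1"
      by (auto simp: norm_set_def)
    have "x \<le> C * nm u" unfolding x by (rule C) (use admissible_node[OF x(2)] in blast)
    also have "\<dots> \<le> \<bar>C\<bar> * nm u" by (rule mult_right_mono) auto
    also have "\<dots> \<le> \<bar>C\<bar>" using x(3) by (simp add: mult_left_le)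
    finally show "x \<le> \<bar>C\<bar>" .
  qed
qed

lemma zero_in_norm_set: "0 \<in> norm_set"
  unfolding norm_set_def
  by (rule CollectI, rule exI[of _ "\<lambda>_. 0"], rule exI[of _ 0])
    (auto simp: admissible_def zero_fun_def nm_def gram_def)

lemma mult_const_nonneg: "0 \<le> mult_const"
  unfolding mult_const_def by (rule cSup_upper[OF zero_in_norm_set bdd_above_norm_set])

lemma mult_const_bound:
  assumes "\<phi> \<in> admissible \<alpha>"
  shows "nm (\<lambda>j. \<phi> (\<zeta> j) * u j) \<le> mult_const * nm u"
proof (cases "nm u = 0")
  case True
  obtain C where C: "\<And>c u. (\<forall>j\<in>N. cmod (c j) \<le> 1) \<Longrightarrow> nm (\<lambda>j. c j * u j) \<le> C * nm u"
    using multiplication_bounded by blast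
  have "nm (\<lambda>j. \<phi> (\<zeta> j) * u j) \<le> C * nm u" by (rule C) (use admissible_node[OF assms] in blast)
  then show ?thesis by (simp add: True)
next
  case False
  then have pos: "nm u > 0" using nm_nonneg[of u] by linarith
  define v where "v = (\<lambda>j. of_real (1 / nm u) * u j)"
  have abs: "cmod (of_real (1 / nm u)) = 1 / nm u" using pos by (simp del: of_real_divide)
  have "nm v = 1" unfolding v_def using nm_sc[of "of_real (1 / nm u)" u] pos unfolding abs by simp
  then have "nm (\<lambda>j. \<phi> (\<zeta> j) * v j) \<in> norm_set" using assms unfolding norm_set_def by fastforce
  then have "nm (\<lambda>j. \<phi> (\<zeta> j) * v j) \<le> mult_const"
    unfolding mult_const_def by (rule cSup_upper[OF _ bdd_above_norm_set])
  moreover have "nm (\<lambda>j. \<phi> (\<zeta> j) * v j) = 1 / nm u * nm (\<lambda>j. \<phi> (\<zeta> j) * u j)"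
    using nm_sc[of "of_real (1 / nm u)" "\<lambda>j. \<phi> (\<zeta> j) * u j"] unfolding abs
    by (simp add: v_def mult.left_commute)
  ultimately have "1 / nm u * nm (\<lambda>j. \<phi> (\<zeta> j) * u j) \<le> mult_const" by simp
  then show ?thesis using pos by (simp add: pos_divide_le_eq)
qed

lemma tendsto_dilate:
  assumes "\<phi> \<in> admissible \<alpha>"
  shows "((\<lambda>s. nm (\<lambda>j. \<phi> (of_real s * \<zeta> j) * u j)) \<longlongrightarrow> nm (\<lambda>j. \<phi> (\<zeta> j) * u j)) (at_left 1)"
proof -
  have "((\<lambda>s. \<phi> (of_real s * \<zeta> j)) \<longlongrightarrow> \<phi> (\<zeta> j)) (at_left 1)" if "j \<in> N" for j
  proof (rule isCont_tendsto_compose[of "\<zeta> j" \<phi>])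
    show "isCont \<phi> (\<zeta> j)"
      using assms nodes[OF that] open_strip
      by (auto simp: admissible_def intro: holomorphic_on_imp_continuous_on continuous_on_interior
          simp: interior_open)
    have "((\<lambda>s. of_real s * \<zeta> j) \<longlongrightarrow> of_real 1 * \<zeta> j) (at_left 1)" by (intro tendsto_intros)
    then show "((\<lambda>s. of_real s * \<zeta> j) \<longlongrightarrow> \<zeta> j) (at_left 1)" by simp
  qed
  then show ?thesis unfolding nm_def gram_def by (intro tendsto_intros)
qed

text \<open>The function \<open>\<phi> g \<phi> / a\<close> is again admissible, so \<open>\<phi>(W) g(W) \<phi>(W)\<close> has norm at most \<open>a\<close> times the best
  constant.  This is why all holomorphic functions, and not just polynomials, have to act.\<close>

lemma mult_const_step:
  assumes "0 < \<delta>" "\<delta> < mult_const"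
  shows "mult_const\<^sup>2 * (mult_const - \<delta>) \<le> mult_const * (2 * (1 - \<alpha> / pi) * mult_const + mult_const * sqrt (2 * mult_const * \<delta>)) + (1 - 2 * \<alpha> / pi) * mult_const"
proof -
  define a where "a = 1 - 2 * \<alpha> / pi"
  have a: "a \<ge> 0" using \<alpha> by (simp add: a_def field_simps)
  have "mult_const - \<delta> < Sup norm_set" using assms by (simp add: mult_const_def)
  then obtain x where "x \<in> norm_set" "mult_const - \<delta> < x" using less_cSupD[of norm_set] zero_in_norm_set by blast
  then obtain \<phi>0 u where \<phi>0: "\<phi>0 \<in> admissible \<alpha>" and u: "nm u \<le> 1" "mult_const - \<delta> < nm (\<lambda>j. \<phi>0 (\<zeta> j) * u j)"
    by (auto simp: norm_set_def)
  have "\<forall>\<^sub>F s in at_left 1. mult_const - \<delta> < nm (\<lambda>j. \<phi>0 (of_real s * \<zeta> j) * u j)"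
    by (rule order_tendstoD(1)[OF tendsto_dilate[OF \<phi>0] u(2)])
  moreover have "\<forall>\<^sub>F s in at_left (1::real). s \<in> {0<..<1}"
    by (rule eventually_at_left_real) simp
  ultimately have "\<forall>\<^sub>F s in at_left (1::real). mult_const - \<delta> < nm (\<lambda>j. \<phi>0 (of_real s * \<zeta> j) * u j) \<and> s \<in> {0<..<1}"
    by (rule eventually_conj)
  from eventually_happens'[OF trivial_limit_at_left_real this]
  obtain s where s: "0 < s" "s < 1" "mult_const - \<delta> < nm (\<lambda>j. \<phi>0 (of_real s * \<zeta> j) * u j)" by auto
  define \<phi> where "\<phi> = (\<lambda>z. \<phi>0 (of_real s * z))"
  have \<phi>: "continuous_on (closed_strip (-\<alpha>) \<alpha>) \<phi>" "\<phi> holomorphic_on strip \<alpha>"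
    "\<And>z. z \<in> closed_strip (-\<alpha>) \<alpha> \<Longrightarrow> cmod (\<phi> z) \<le> 1" "\<phi> \<in> admissible \<alpha>"
    unfolding \<phi>_def using admissible_dilate[OF \<phi>0 s(1,2) \<alpha>(1)] by blast+
  have contphi: "continuous_on (strip \<alpha>) \<phi>" by (rule holomorphic_on_imp_continuous_on[OF \<phi>(2)])
  have le1: "\<And>z. z \<in> strip \<alpha> \<Longrightarrow> cmod (\<phi> z) \<le> 1" using \<phi>(4) by (simp add: admissible_def)
  define g where "g = cauchy_dual \<alpha> \<phi>"
  have g: "g holomorphic_on strip \<alpha>" "\<And>z. z \<in> strip \<alpha> \<Longrightarrow> cmod (g z) \<le> a"
    unfolding g_def a_def using holomorphic_cauchy_dual[OF \<alpha> \<phi>(2) le1] cauchy_dual_le[OF \<alpha> contphi le1] by auto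
  define T where "T = (\<lambda>v j. \<phi> (\<zeta> j) * v j)"
  define Tg where "Tg = (\<lambda>v j. g (\<zeta> j) * v j)"
  have "mult_const\<^sup>2 * (mult_const - \<delta>) \<le> mult_const * (2 * (1 - \<alpha> / pi) * mult_const + mult_const * sqrt (2 * mult_const * \<delta>)) + a * mult_const"
  proof (rule nearly_maximal_vector[where T = T and Tg = Tg])
    show "T (u + v) = T u + T v" for u v by (simp add: T_def plus_fun_def distrib_left)
    show "T (\<lambda>j. c * u j) = (\<lambda>j. c * T u j)" for c u by (simp add: T_def mult.left_commute)
    show "nm (T v) \<le> mult_const * nm v" for v unfolding T_def by (rule mult_const_bound[OF \<phi>(4)])
    show "cmod (gram N G (T v) w + gram N G v (Tg w)) \<le> 2 * (1 - \<alpha> / pi) * (nm v * nm w)" for v w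
      using dual_sum_bound[OF \<phi>(1,2) \<phi>(3), of v w] by (simp add: dual_sum_def T_def Tg_def g_def)
    show "nm (T (Tg (T u))) \<le> a * mult_const"
    \<comment> \<open>The case \<open>a = 0\<close> is \<open>\<alpha> = \<pi>/2\<close>, where \<open>g\<close> vanishes and cannot be normalised.\<close>
    proof (cases "a = 0")
      case True
      have "Tg (T u) j = 0" if "j \<in> N" for j
        using g(2)[OF nodes[OF that]] by (simp add: Tg_def True)
      then have "gram N G (T (Tg (T u))) (T (Tg (T u))) = gram N G 0 0"
        by (intro gram_cong) (auto simp: T_def)
      then show ?thesis by (simp add: nm_def True)
    next
      case False
      define h where "h = (\<lambda>z. \<phi> z * g z * \<phi> z / a)"
      have "h holomorphic_on strip \<alpha>"
        unfolding h_def using False by (intro holomorphic_intros \<phi>(2) g(1)) auto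
      moreover have "cmod (h z) \<le> 1" if "z \<in> strip \<alpha>" for z
      proof -
        have "cmod (\<phi> z) * cmod (g z) * cmod (\<phi> z) \<le> 1 * a * 1"
          using le1[OF that] g(2)[OF that] a by (intro mult_mono) auto
        then show ?thesis using False a by (simp add: h_def norm_mult norm_divide)
      qed
      ultimately have "h \<in> admissible \<alpha>" by (simp add: admissible_def)
      then have "nm (\<lambda>j. h (\<zeta> j) * u j) \<le> mult_const * nm u" by (rule mult_const_bound)
      also have "\<dots> \<le> mult_const" using u(1) mult_const_nonneg by (simp add: mult_left_le)
      finally have "a * nm (\<lambda>j. h (\<zeta> j) * u j) \<le> a * mult_const" using a by (rule mult_left_mono)
      moreover have "T (Tg (T u)) = (\<lambda>j. of_real a * (h (\<zeta> j) * u j))"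
        using False by (simp add: T_def Tg_def h_def mult_ac)
      ultimately show ?thesis using a nm_sc[of "of_real a" "\<lambda>j. h (\<zeta> j) * u j"] by simp
    qed
    show "mult_const - \<delta> \<le> nm (T u)" using s(3) by (simp add: T_def \<phi>_def)
    show "0 \<le> 1 - \<alpha> / pi" using \<alpha> by (simp add: divide_simps)
  qed (use u assms in auto)
  then show ?thesis by (simp add: a_def)
qed

lemma mult_const_le: "mult_const \<le> K25 \<alpha>"
proof (cases "mult_const = 0")
  case True
  then show ?thesis using K25_nonneg[OF \<alpha>] by simp
next
  case False
  then have pos: "mult_const > 0" using mult_const_nonneg by linarith
  define k a where "k = 1 - \<alpha> / pi" and "a = 1 - 2 * \<alpha> / pi"
  have ka: "k \<ge> 0" "a \<ge> 0" using \<alpha> by (simp_all add: k_def a_def field_simps)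
  have "mult_const\<^sup>2 * (mult_const - 0) \<le> mult_const * (2 * k * mult_const + mult_const * sqrt (2 * mult_const * 0)) + a * mult_const"
  proof (rule tendsto_le)
    show "((\<lambda>\<delta>. mult_const\<^sup>2 * (mult_const - \<delta>)) \<longlongrightarrow> mult_const\<^sup>2 * (mult_const - 0)) (at_right 0)" by (intro tendsto_intros)
    show "((\<lambda>\<delta>. mult_const * (2 * k * mult_const + mult_const * sqrt (2 * mult_const * \<delta>)) + a * mult_const)
      \<longlongrightarrow> mult_const * (2 * k * mult_const + mult_const * sqrt (2 * mult_const * 0)) + a * mult_const) (at_right 0)" by (intro tendsto_intros)
    show "\<forall>\<^sub>F \<delta> in at_right 0. mult_const\<^sup>2 * (mult_const - \<delta>) \<le> mult_const * (2 * k * mult_const + mult_const * sqrt (2 * mult_const * \<delta>)) + a * mult_const"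
      using eventually_at_right_real[OF pos] by eventually_elim (use mult_const_step in \<open>auto simp: k_def a_def\<close>)
  qed simp
  then have "mult_const * mult_const\<^sup>2 \<le> mult_const * (2 * k * mult_const + a)" by (simp add: algebra_simps power2_eq_square)
  then have "mult_const\<^sup>2 \<le> 2 * k * mult_const + a" using pos by simp
  then show ?thesis unfolding K25_eq k_def[symmetric] a_def[symmetric]
    by (rule le_quadratic_root) (use ka in simp)
qed

theorem admissible_multiplication_bound:
  assumes "\<phi> \<in> admissible \<alpha>"
  shows "nm (\<lambda>j. \<phi> (\<zeta> j) * u j) \<le> K25 \<alpha> * nm u"
  using mult_const_bound[OF assms, of u] mult_right_mono[OF mult_const_le nm_nonneg[of u]] by linarith

end


section \<open>Interpolation, orthogonal polynomials and perturbed roots\<close>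

definition lagrange :: "nat \<Rightarrow> (nat \<Rightarrow> complex) \<Rightarrow> nat \<Rightarrow> complex poly" where
  "lagrange m \<mu> j = (\<Prod>i\<in>{..<m} - {j}. Polynomial.smult (1 / (\<mu> j - \<mu> i)) [:- \<mu> i, 1:])"

definition interp :: "nat \<Rightarrow> (nat \<Rightarrow> complex) \<Rightarrow> (nat \<Rightarrow> complex) \<Rightarrow> complex poly" where
  "interp m \<mu> u = (\<Sum>j<m. Polynomial.smult (u j) (lagrange m \<mu> j))"

lemma degree_lagrange:
  assumes "j < m" shows "Polynomial.degree (lagrange m \<mu> j) < m"
proof -
  have "Polynomial.degree (lagrange m \<mu> j) \<le> (\<Sum>i\<in>{..<m} - {j}. Polynomial.degree (Polynomial.smult (1 / (\<mu> j - \<mu> i)) [:- \<mu> i, 1:]))"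
    unfolding lagrange_def by (rule degree_prod_sum_le[unfolded o_def]) simp
  also have "\<dots> \<le> (\<Sum>i\<in>{..<m} - {j}. 1)" by (intro sum_mono) (auto intro: order_trans[OF degree_smult_le])
  also have "\<dots> < m" using assms by simp
  finally show ?thesis .
qed

lemma degree_interp: "0 < m \<Longrightarrow> Polynomial.degree (interp m \<mu> u) < m"
  unfolding interp_def
  by (rule degree_sum_less) (auto intro!: le_less_trans[OF degree_smult_le] degree_lagrange)

lemma poly_lagrange:
  assumes "inj_on \<mu> {..<m}" "j < m" "k < m"
  shows "poly (lagrange m \<mu> j) (\<mu> k) = (if j = k then 1 else 0)"
proof (cases "j = k")
  case True
  have "\<mu> k - \<mu> i \<noteq> 0" if "i \<in> {..<m} - {k}" for i
    using that assms(3) inj_onD[OF assms(1), of k i] by auto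
  then show ?thesis by (auto simp: True lagrange_def poly_prod diff_divide_distrib[symmetric] intro!: prod.neutral)
next
  case False
  then have "k \<in> {..<m} - {j}" using assms by auto
  then show ?thesis using False by (auto simp: lagrange_def poly_prod intro!: prod_zero)
qed

lemma poly_interp:
  assumes "inj_on \<mu> {..<m}" "k < m"
  shows "poly (interp m \<mu> u) (\<mu> k) = u k"
proof -
  have "poly (interp m \<mu> u) (\<mu> k) = (\<Sum>j<m. u j * (if j = k then 1 else 0))"
    unfolding interp_def poly_sum using assms by (intro sum.cong) (simp_all add: poly_lagrange)
  then show ?thesis using assms(2) by (simp add: if_distrib cong: if_cong)
qed

lemma interp_poly:
  assumes inj: "inj_on \<mu> {..<m}" and deg: "Polynomial.degree q < m"
  shows "interp m \<mu> (\<lambda>j. poly q (\<mu> j)) = q"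
proof (rule poly_eqI_degree[of "\<mu> ` {..<m}"])
  have c: "card (\<mu> ` {..<m}) = m" by (simp add: card_image inj)
  show "Polynomial.degree q < card (\<mu> ` {..<m})" using deg c by simp
  show "Polynomial.degree (interp m \<mu> (\<lambda>j. poly q (\<mu> j))) < card (\<mu> ` {..<m})"
    using degree_interp[of m] deg c by simp
qed (use poly_interp[OF inj] in auto)

lemma (in semi_inner) nm_sum_le: "finite S \<Longrightarrow> nm (\<Sum>i\<in>S. f i) \<le> (\<Sum>i\<in>S. nm (f i))"
  by (induction S rule: finite_induct) (auto intro: order_trans[OF nm_triangle])

lemma (in semi_inner) B_sum_left: "B (\<Sum>i\<in>S. f i) w = (\<Sum>i\<in>S. B (f i) w)"
  by (induction S rule: infinite_finite_induct) (auto simp: B_add_left)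

lemma (in semi_inner) B_sum_right: "B w (\<Sum>i\<in>S. f i) = (\<Sum>i\<in>S. B w (f i))"
  by (induction S rule: infinite_finite_induct) (auto simp: B_add_right)

locale poly_form = semi_inner Polynomial.smult \<Phi>
  for \<Phi> :: "complex poly \<Rightarrow> complex poly \<Rightarrow> complex"
begin

definition low :: "nat \<Rightarrow> complex poly set" where
  "low k = {q. \<forall>i\<ge>k. Polynomial.coeff q i = 0}"

text \<open>Gram-Schmidt for a possibly degenerate form.  If the next orthogonalised monomial is a null vector,
  the Cauchy-Schwarz inequality makes it orthogonal to everything, and no correction is due.\<close>

lemma orthogonal_projection:
  "\<exists>s\<in>low k. \<forall>q\<in>low k. \<Phi> (v - s) q = 0"
proof (induction k arbitrary: v)
  case 0
  have "q = 0" if "q \<in> low 0" for q using that by (auto simp: low_def poly_eq_iff)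
  then have "\<Phi> (v - 0) q = 0" if "q \<in> low 0" for q using that B_zero_right by metis
  then show ?case by (intro bexI[of _ 0]) (auto simp: low_def)
next
  case (Suc k)
  define e :: "complex poly" where "e = Polynomial.monom 1 k"
  obtain se where se: "se \<in> low k" "\<And>q. q \<in> low k \<Longrightarrow> \<Phi> (e - se) q = 0" using Suc[of e] by blast
  obtain sv where sv: "sv \<in> low k" "\<And>q. q \<in> low k \<Longrightarrow> \<Phi> (v - sv) q = 0" using Suc[of v] by blast
  define o' where "o' = e - se"
  define t where "t = (if \<Phi> o' o' = 0 then 0 else \<Phi> (v - sv) o' / \<Phi> o' o')"
  have null: "\<Phi> (v - sv) o' = 0" if "\<Phi> o' o' = 0"
  proof -
    have "nm o' = 0" by (simp add: nm_def that)
    then show ?thesis using Cauchy_Schwarz[of "v - sv" o'] by simp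
  qed
  have ort: "\<Phi> (v - (sv + Polynomial.smult t o')) o' = 0"
    using null by (auto simp: t_def B_diff_left B_add_left B_sc_left)
  have ort2: "\<Phi> (v - (sv + Polynomial.smult t o')) q = 0" if "q \<in> low k" for q
    using se(2)[OF that] sv(2)[OF that] by (simp add: o'_def B_diff_left B_add_left B_sc_left)
  have o_low: "o' \<in> low (Suc k)" using se(1) by (auto simp: o'_def e_def low_def)
  show ?case
  proof (intro bexI[of _ "sv + Polynomial.smult t o'"] ballI)
    show "sv + Polynomial.smult t o' \<in> low (Suc k)" using sv(1) o_low by (auto simp: low_def)
    fix q assume q: "q \<in> low (Suc k)"
    define c where "c = Polynomial.coeff q k"
    have "q - Polynomial.smult c o' \<in> low k"
      unfolding low_def
    proof (intro CollectI allI impI)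
      fix i assume "k \<le> i"
      then show "Polynomial.coeff (q - Polynomial.smult c o') i = 0"
        using q se(1) by (cases "i = k") (auto simp: low_def c_def o'_def e_def)
    qed
    from ort2[OF this] show "\<Phi> (v - (sv + Polynomial.smult t o')) q = 0"
      using ort by (simp add: B_diff_right B_sc_right)
  qed
qed

lemma degree_less_iff_low: "0 < m \<Longrightarrow> Polynomial.degree q < m \<longleftrightarrow> q \<in> low m"
  unfolding low_def by (auto intro: coeff_eq_0 degree_lessI)

lemma monic_orthogonal_polynomial:
  assumes "0 < m"
  obtains \<omega> where "Polynomial.degree \<omega> = m" "Polynomial.lead_coeff \<omega> = 1"
    "\<And>q. Polynomial.degree q < m \<Longrightarrow> \<Phi> \<omega> q = 0"
proof -
  obtain s where s: "s \<in> low m" "\<And>q. q \<in> low m \<Longrightarrow> \<Phi> (Polynomial.monom 1 m - s) q = 0"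
    using orthogonal_projection[of m "Polynomial.monom 1 m"] by blast
  have deg: "Polynomial.degree (Polynomial.monom 1 m - s) = m"
  proof (rule antisym)
    show "Polynomial.degree (Polynomial.monom 1 m - s) \<le> m"
      using s(1) by (intro degree_le) (auto simp: low_def)
    show "m \<le> Polynomial.degree (Polynomial.monom 1 m - s)"
      using s(1) by (intro le_degree) (auto simp: low_def)
  qed
  show thesis
  proof (rule that[of "Polynomial.monom 1 m - s"])
    show "Polynomial.lead_coeff (Polynomial.monom 1 m - s) = 1" unfolding deg using s(1) by (auto simp: low_def)
  qed (use deg s degree_less_iff_low[OF assms] in auto)
qed

lemma nm_le_coeffs:
  assumes "Polynomial.degree d \<le> m"
  shows "nm d \<le> (\<Sum>i\<le>m. cmod (Polynomial.coeff d i) * nm (Polynomial.monom 1 i))"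
proof -
  have "d = (\<Sum>i\<le>m. Polynomial.smult (Polynomial.coeff d i) (Polynomial.monom 1 i))"
    using poly_as_sum_of_monoms'[OF assms] by (simp add: smult_monom)
  then have "nm d = nm (\<Sum>i\<le>m. Polynomial.smult (Polynomial.coeff d i) (Polynomial.monom 1 i))" by simp
  also have "\<dots> \<le> (\<Sum>i\<le>m. nm (Polynomial.smult (Polynomial.coeff d i) (Polynomial.monom 1 i)))" by (rule nm_sum_le) simp
  finally show ?thesis by (simp only: nm_sc)
qed

lemma tendsto_nm_zero:
  assumes "\<And>\<eta>. Polynomial.degree (d \<eta>) \<le> m"
    and "\<And>i. ((\<lambda>\<eta>. Polynomial.coeff (d \<eta>) i) \<longlongrightarrow> 0) F"
  shows "((\<lambda>\<eta>. nm (d \<eta>)) \<longlongrightarrow> 0) F"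
proof (rule Lim_null_comparison)
  show "\<forall>\<^sub>F \<eta> in F. norm (nm (d \<eta>)) \<le> (\<Sum>i\<le>m. cmod (Polynomial.coeff (d \<eta>) i) * nm (Polynomial.monom 1 i))"
    using nm_le_coeffs[OF assms(1)] by simp
  have "((\<lambda>\<eta>. \<Sum>i\<le>m. cmod (Polynomial.coeff (d \<eta>) i) * nm (Polynomial.monom 1 i)) \<longlongrightarrow> (\<Sum>i\<le>m. cmod 0 * nm (Polynomial.monom 1 i))) F"
    by (intro tendsto_intros assms(2))
  then show "((\<lambda>\<eta>. \<Sum>i\<le>m. cmod (Polynomial.coeff (d \<eta>) i) * nm (Polynomial.monom 1 i)) \<longlongrightarrow> 0) F" by simp
qed

end

lemma tendsto_coeff_prod:
  fixes p :: "'a \<Rightarrow> real \<Rightarrow> complex poly"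
  assumes "finite S" "\<And>i n. i \<in> S \<Longrightarrow> ((\<lambda>\<eta>. Polynomial.coeff (p i \<eta>) n) \<longlongrightarrow> Polynomial.coeff (p0 i) n) F"
  shows "((\<lambda>\<eta>. Polynomial.coeff (\<Prod>i\<in>S. p i \<eta>) n) \<longlongrightarrow> Polynomial.coeff (\<Prod>i\<in>S. p0 i) n) F"
  using assms
proof (induction S arbitrary: n rule: finite_induct)
  case (insert x S)
  then show ?case by (auto simp: coeff_mult intro!: tendsto_intros)
qed simp

definition shifted_root_poly :: "nat \<Rightarrow> (nat \<Rightarrow> complex) \<Rightarrow> real \<Rightarrow> complex poly" where
  "shifted_root_poly m rt \<eta> = (\<Prod>i<m. [:- (rt i + of_real \<eta> * of_nat i), 1:])"

text \<open>Each pair of indices excludes at most one value of \<open>\<eta>\<close>.\<close>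

lemma eventually_distinct_roots:
  "\<forall>\<^sub>F \<eta> in at_right 0. inj_on (\<lambda>i. rt i + of_real \<eta> * of_nat i :: complex) {..<m::nat}"
proof -
  have ne: "\<forall>\<^sub>F \<eta> in at_right (0::real). of_real \<eta> \<noteq> (b::complex)" for b
  proof (cases "b = 0")
    case True
    then show ?thesis using eventually_at_right_less[of "0::real"] by (auto elim: eventually_mono)
  next
    case False
    have "((\<lambda>\<eta>. complex_of_real \<eta>) \<longlongrightarrow> of_real 0) (at_right 0)" by (intro tendsto_intros)
    then show ?thesis using False by (intro tendsto_imp_eventually_ne) auto
  qed
  have "\<forall>\<^sub>F \<eta> in at_right 0. \<forall>i\<in>{..<m}. \<forall>j\<in>{..<m}. i \<noteq> j \<longrightarrow>
      rt i + of_real \<eta> * of_nat i \<noteq> rt j + of_real \<eta> * of_nat j"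
  proof (intro eventually_ball_finite ballI)
    fix i j :: nat
    show "\<forall>\<^sub>F \<eta> in at_right 0. i \<noteq> j \<longrightarrow> rt i + of_real \<eta> * of_nat i \<noteq> rt j + of_real \<eta> * of_nat j"
      using ne[of "(rt j - rt i) / (of_nat i - of_nat j)"]
    proof eventually_elim
      case (elim \<eta>)
      show ?case
      proof
        assume "i \<noteq> j"
        then have "(of_nat i - of_nat j :: complex) \<noteq> 0" by simp
        with elim show "rt i + of_real \<eta> * of_nat i \<noteq> rt j + of_real \<eta> * of_nat j"
          by (auto simp: field_simps)
      qed
    qed
  qed auto
  then show ?thesis by eventually_elim (auto simp: inj_on_def)
qed

lemma shifted_root_poly_props:
  shows "Polynomial.degree (shifted_root_poly m rt \<eta>) = m" "Polynomial.lead_coeff (shifted_root_poly m rt \<eta>) = 1"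
    and "j < m \<Longrightarrow> poly (shifted_root_poly m rt \<eta>) (rt j + of_real \<eta> * of_nat j) = 0"
proof -
  show "Polynomial.degree (shifted_root_poly m rt \<eta>) = m"
    unfolding shifted_root_poly_def by (subst degree_prod_eq_sum_degree) auto
  show "Polynomial.lead_coeff (shifted_root_poly m rt \<eta>) = 1"
    unfolding shifted_root_poly_def lead_coeff_prod by simp
  show "j < m \<Longrightarrow> poly (shifted_root_poly m rt \<eta>) (rt j + of_real \<eta> * of_nat j) = 0"
    by (auto simp: shifted_root_poly_def poly_prod intro!: prod_zero bexI[of _ j])
qed

lemma tendsto_coeff_shifted_root_poly:
  "((\<lambda>\<eta>. Polynomial.coeff (shifted_root_poly m rt \<eta>) n) \<longlongrightarrow> Polynomial.coeff (\<Prod>i<m. [:- rt i, 1:]) n) (at_right 0)"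
  unfolding shifted_root_poly_def
proof (rule tendsto_coeff_prod)
  fix i n
  have *: "((\<lambda>\<eta>. - (rt i + of_real \<eta> * of_nat i)) \<longlongrightarrow> - (rt i + of_real 0 * of_nat i)) (at_right 0)"
    by (intro tendsto_intros)
  show "((\<lambda>\<eta>. Polynomial.coeff [:- (rt i + of_real \<eta> * of_nat i), 1:] n) \<longlongrightarrow> Polynomial.coeff [:- rt i, 1:] n) (at_right 0)"
    using * by (cases n) simp_all
qed simp


section \<open>The lens and the strip\<close>

text \<open>The polarised form of the fact that \<open>z \<mapsto> (1 + z) / (1 - z)\<close> takes the disc with centre \<open>\<i>h\<close> whose
  boundary passes through 1 and -1 to a half-plane bounded by a line through 0.\<close>

lemma half_plane_kernel:
  fixes z z' :: complex and h s :: real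
  assumes "z \<noteq> 1" "z' \<noteq> 1"
  defines "A \<equiv> of_real s * (1 - \<i> * of_real h)" and "c \<equiv> \<i> * of_real h"
  shows "A * ((1 + z) / (1 - z)) + cnj (A * ((1 + z') / (1 - z')))
    = of_real (2 * s) * ((of_real (1 + h\<^sup>2) - (z - c) * cnj (z' - c)) * (1 / (1 - z) * cnj (1 / (1 - z'))))"
proof -
  define w where "w = cnj z'"
  have ne: "1 - z \<noteq> 0" "1 - w \<noteq> 0"
    using assms(1,2) by (auto simp: w_def complex_eq_iff)
  define a b where "a = 1 / (1 - z)" and "b = 1 / (1 - w)"
  have ab: "(1 - z) * a = 1" "(1 - w) * b = 1" using ne by (simp_all add: a_def b_def)
  have "A * ((1 + z) / (1 - z)) + cnj A * ((1 + w) / (1 - w)) = A * (1 + z) * a + cnj A * (1 + w) * b"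
    by (simp add: a_def b_def)
  also have "\<dots> = A * (1 + z) * a * ((1 - w) * b) + cnj A * (1 + w) * b * ((1 - z) * a)"
    by (simp only: ab mult_1_right)
  also have "\<dots> = (A * (1 + z) * (1 - w) + cnj A * (1 + w) * (1 - z)) * (a * b)"
    by (simp add: algebra_simps)
  also have "A * (1 + z) * (1 - w) + cnj A * (1 + w) * (1 - z)
      = of_real (2 * s) * (of_real (1 + h\<^sup>2) - (z - c) * (w - cnj c))"
    by (simp add: A_def c_def algebra_simps power2_eq_square)
  finally show ?thesis by (simp add: w_def a_def b_def mult.assoc)
qed

lemma Re_half_plane_disc:
  fixes z :: complex and h s r :: real
  assumes "z \<noteq> 1" and r: "1 + h\<^sup>2 = r\<^sup>2"
  shows "Re (of_real s * (1 - \<i> * of_real h) * ((1 + z) / (1 - z)))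
    = s * (r\<^sup>2 - (cmod (z - \<i> * of_real h))\<^sup>2) * (cmod (1 / (1 - z)))\<^sup>2"
proof -
  define A where "A = of_real s * (1 - \<i> * of_real h)"
  define n where "n = cmod (1 / (1 - z))"
  have "A * ((1 + z) / (1 - z)) + cnj (A * ((1 + z) / (1 - z))) = of_real (2 * s) *
      ((of_real (1 + h\<^sup>2) - (z - \<i> * of_real h) * cnj (z - \<i> * of_real h)) * (1 / (1 - z) * cnj (1 / (1 - z))))"
    unfolding A_def by (rule half_plane_kernel[OF assms(1) assms(1)])
  also have "\<dots> = of_real (2 * s * ((1 + h\<^sup>2 - (cmod (z - \<i> * of_real h))\<^sup>2) * n\<^sup>2))"
    unfolding complex_norm_square[symmetric] n_def by simp
  finally have "2 * Re (A * ((1 + z) / (1 - z))) = 2 * s * ((1 + h\<^sup>2 - (cmod (z - \<i> * of_real h))\<^sup>2) * n\<^sup>2)"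
    unfolding complex_add_cnj of_real_eq_iff .
  then show ?thesis unfolding r A_def n_def by simp
qed

text \<open>The centres \<open>\<plusminus>\<i> cot \<alpha>\<close> belong to the half-planes whose boundaries contain the two edges of the sector
  \<open>\<bar>arg w\<bar> < \<alpha>\<close>.\<close>

lemma sin_cot:
  assumes "0 < \<alpha>" "\<alpha> \<le> pi / 2"
  shows "sin \<alpha> > 0" "cot \<alpha> \<ge> 0" "1 + (cot \<alpha>)\<^sup>2 = (1 / sin \<alpha>)\<^sup>2" "cot \<alpha> < 1 / sin \<alpha>"
    "of_real (sin \<alpha>) * (1 - \<i> * of_real (cot \<alpha>)) = - \<i> * exp (\<i> * of_real \<alpha>)"
    "of_real (sin \<alpha>) * (1 - \<i> * of_real (- cot \<alpha>)) = \<i> * exp (- \<i> * of_real \<alpha>)"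
proof -
  show s: "sin \<alpha> > 0" using assms by (intro sin_gt_zero) auto
  show "cot \<alpha> \<ge> 0" using s assms by (auto simp: cot_def intro!: divide_nonneg_pos cos_ge_zero)
  show "1 + (cot \<alpha>)\<^sup>2 = (1 / sin \<alpha>)\<^sup>2"
    using s by (simp add: cot_def power_divide divide_simps)
  have "cos \<alpha> < 1" using cos_monotone_0_pi[of 0 \<alpha>] assms by simp
  then show "cot \<alpha> < 1 / sin \<alpha>" using s by (simp add: cot_def divide_strict_right_mono)
  show "of_real (sin \<alpha>) * (1 - \<i> * of_real (cot \<alpha>)) = - \<i> * exp (\<i> * of_real \<alpha>)"
    "of_real (sin \<alpha>) * (1 - \<i> * of_real (- cot \<alpha>)) = \<i> * exp (- \<i> * of_real \<alpha>)"
    using s by (auto simp: cot_def complex_eq_iff Re_exp Im_exp)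
qed

lemma Re_half_plane_exp:
  "Re (- \<i> * exp (\<i> * of_real \<alpha>) * exp \<zeta>) = exp (Re \<zeta>) * sin (\<alpha> + Im \<zeta>)"
  "Re (\<i> * exp (- \<i> * of_real \<alpha>) * exp \<zeta>) = exp (Re \<zeta>) * sin (\<alpha> - Im \<zeta>)"
proof -
  have "Re (- \<i> * exp (\<i> * of_real \<alpha> + \<zeta>)) = exp (Re \<zeta>) * sin (\<alpha> + Im \<zeta>)"
    by (simp add: Im_exp)
  then show "Re (- \<i> * exp (\<i> * of_real \<alpha>) * exp \<zeta>) = exp (Re \<zeta>) * sin (\<alpha> + Im \<zeta>)"
    by (simp only: exp_add mult.assoc)
  have "Re (\<i> * exp (- \<i> * of_real \<alpha> + \<zeta>)) = exp (Re \<zeta>) * - sin (Im \<zeta> - \<alpha>)"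
    by (simp add: Im_exp)
  also have "- sin (Im \<zeta> - \<alpha>) = sin (\<alpha> - Im \<zeta>)" using sin_minus[of "Im \<zeta> - \<alpha>"] by simp
  finally show "Re (\<i> * exp (- \<i> * of_real \<alpha>) * exp \<zeta>) = exp (Re \<zeta>) * sin (\<alpha> - Im \<zeta>)"
    by (simp only: exp_add mult.assoc)
qed

lemma exp_strip_half_planes:
  assumes "\<zeta> \<in> strip \<alpha>" "0 < \<alpha>" "\<alpha> \<le> pi / 2"
  shows "0 \<le> Re (- \<i> * exp (\<i> * of_real \<alpha>) * exp \<zeta>)" "0 \<le> Re (\<i> * exp (- \<i> * of_real \<alpha>) * exp \<zeta>)" "exp \<zeta> \<noteq> -1"
proof -
  have "0 \<le> sin (\<alpha> + Im \<zeta>)" "0 \<le> sin (\<alpha> - Im \<zeta>)"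
    using assms by (auto simp: strip_def intro!: sin_ge_zero)
  then show "0 \<le> Re (- \<i> * exp (\<i> * of_real \<alpha>) * exp \<zeta>)" "0 \<le> Re (\<i> * exp (- \<i> * of_real \<alpha>) * exp \<zeta>)"
    unfolding Re_half_plane_exp by simp_all
  have "cos (Im \<zeta>) > 0" using assms by (intro cos_gt_zero_pi) (auto simp: strip_def)
  then have "Re (exp \<zeta>) > 0" by (simp add: Re_exp)
  then show "exp \<zeta> \<noteq> -1" by auto
qed

lemma compact_lens: "compact (lens \<alpha>)"
proof -
  have "z \<in> lens \<alpha> \<longleftrightarrow> z \<in> cball (\<i> * of_real (cot \<alpha>)) (1 / sin \<alpha>) \<inter> cball (- (\<i> * of_real (cot \<alpha>))) (1 / sin \<alpha>)" for z
    unfolding lens_def Int_iff mem_Collect_eq mem_cball dist_norm norm_minus_commute[of _ z]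
    by (simp only: diff_minus_eq_add)
  then have "lens \<alpha> = cball (\<i> * of_real (cot \<alpha>)) (1 / sin \<alpha>) \<inter> cball (- (\<i> * of_real (cot \<alpha>))) (1 / sin \<alpha>)"
    by blast
  then show ?thesis by (simp add: compact_Int)
qed

lemma bdd_above_poly_lens: "bdd_above ((\<lambda>z. cmod (poly p z)) ` lens \<alpha>)"
  by (intro bounded_imp_bdd_above compact_imp_bounded compact_continuous_image continuous_intros compact_lens)

definition strip_to_lens :: "complex \<Rightarrow> complex" where
  "strip_to_lens \<zeta> = (exp \<zeta> - 1) / (exp \<zeta> + 1)"

lemma strip_to_lens_in_lens:
  assumes "\<zeta> \<in> strip \<alpha>" and \<alpha>: "0 < \<alpha>" "\<alpha> \<le> pi / 2"
  shows "strip_to_lens \<zeta> \<in> lens \<alpha>"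
proof -
  define z where "z = strip_to_lens \<zeta>"
  have ne: "exp \<zeta> + 1 \<noteq> 0" using exp_strip_half_planes(3)[OF assms] by (metis add_eq_0_iff2)
  then have z: "z \<noteq> 1" "(1 + z) / (1 - z) = exp \<zeta>"
    by (auto simp: z_def strip_to_lens_def divide_simps)
  have *: "cmod (z - \<i> * of_real h) \<le> 1 / sin \<alpha>"
    if h: "0 \<le> Re (of_real (sin \<alpha>) * (1 - \<i> * of_real h) * exp \<zeta>)" "1 + h\<^sup>2 = (1 / sin \<alpha>)\<^sup>2" for h
  proof -
    have "0 \<le> sin \<alpha> * ((1 / sin \<alpha>)\<^sup>2 - (cmod (z - \<i> * of_real h))\<^sup>2) * (cmod (1 / (1 - z)))\<^sup>2"
      using h(1) unfolding z(2)[symmetric] Re_half_plane_disc[OF z(1) h(2)] .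
    moreover have "(cmod (1 / (1 - z)))\<^sup>2 > 0" using z(1) by simp
    ultimately have "(cmod (z - \<i> * of_real h))\<^sup>2 \<le> (1 / sin \<alpha>)\<^sup>2"
      using sin_cot(1)[OF \<alpha>] by (simp add: zero_le_mult_iff)
    then show ?thesis by (rule power2_le_imp_le) (use sin_cot(1)[OF \<alpha>] in simp)
  qed
  have "cmod (z - \<i> * of_real (cot \<alpha>)) \<le> 1 / sin \<alpha>"
    by (rule *) (use sin_cot(3,5)[OF \<alpha>] exp_strip_half_planes(1)[OF assms] in simp_all)
  moreover have "cmod (z - \<i> * of_real (- cot \<alpha>)) \<le> 1 / sin \<alpha>"
    by (rule *) (use sin_cot(3,6)[OF \<alpha>] exp_strip_half_planes(2)[OF assms] in simp_all)
  ultimately show ?thesis by (simp add: lens_def z_def)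
qed

lemma open_lens_to_strip:
  assumes \<alpha>: "0 < \<alpha>" "\<alpha> \<le> pi / 2"
    and z: "cmod (z - \<i> * of_real (cot \<alpha>)) < 1 / sin \<alpha>" "cmod (z + \<i> * of_real (cot \<alpha>)) < 1 / sin \<alpha>"
  obtains \<zeta> where "\<zeta> \<in> strip \<alpha>" "exp \<zeta> = (1 + z) / (1 - z)" "strip_to_lens \<zeta> = z" "z \<noteq> 1"
proof -
  have "cmod (1 - \<i> * of_real (cot \<alpha>)) = 1 / sin \<alpha>" "cmod (- 1 - \<i> * of_real (cot \<alpha>)) = 1 / sin \<alpha>"
    using sin_cot(1,3)[OF \<alpha>] by (simp_all add: cmod_def real_sqrt_divide)
  with z(1) have ne: "z \<noteq> 1" "z \<noteq> - 1" by auto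
  define w where "w = (1 + z) / (1 - z)"
  have "1 + z \<noteq> 0" using ne(2) by (metis add.commute add_eq_0_iff)
  then have w0: "w \<noteq> 0" using ne by (simp add: w_def)
  define \<zeta> where "\<zeta> = Ln w"
  have e: "exp \<zeta> = w" by (simp add: \<zeta>_def w0)
  have *: "0 < Re (of_real (sin \<alpha>) * (1 - \<i> * of_real h) * exp \<zeta>)"
    if h: "cmod (z - \<i> * of_real h) < 1 / sin \<alpha>" "1 + h\<^sup>2 = (1 / sin \<alpha>)\<^sup>2" for h
  proof -
    have "(cmod (z - \<i> * of_real h))\<^sup>2 < (1 / sin \<alpha>)\<^sup>2"
      using h(1) by (intro power_strict_mono) auto
    then have "0 < sin \<alpha> * ((1 / sin \<alpha>)\<^sup>2 - (cmod (z - \<i> * of_real h))\<^sup>2) * (cmod (1 / (1 - z)))\<^sup>2"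
      using ne(1) sin_cot(1)[OF \<alpha>] by (intro mult_pos_pos) auto
    then show ?thesis unfolding e w_def Re_half_plane_disc[OF ne(1) h(2)] .
  qed
  have "0 < Re (- \<i> * exp (\<i> * of_real \<alpha>) * exp \<zeta>)"
    using *[of "cot \<alpha>"] z(1) sin_cot(3)[OF \<alpha>] unfolding sin_cot(5)[OF \<alpha>] by simp
  moreover have "0 < Re (\<i> * exp (- \<i> * of_real \<alpha>) * exp \<zeta>)"
    using *[of "- cot \<alpha>"] z(2) sin_cot(3)[OF \<alpha>] unfolding sin_cot(6)[OF \<alpha>] by simp
  ultimately have s: "0 < sin (\<alpha> + Im \<zeta>)" "0 < sin (\<alpha> - Im \<zeta>)"
    unfolding Re_half_plane_exp by (simp_all add: zero_less_mult_iff)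
  have im: "- pi < Im \<zeta>" "Im \<zeta> \<le> pi" using w0 by (simp_all add: \<zeta>_def mpi_less_Im_Ln Im_Ln_le_pi)
  have "- \<alpha> < Im \<zeta>"
  proof (rule ccontr)
    assume "\<not> - \<alpha> < Im \<zeta>"
    then have "0 \<le> sin (- (\<alpha> + Im \<zeta>))" using im \<alpha> by (intro sin_ge_zero) auto
    with s(1) show False unfolding sin_minus by linarith
  qed
  moreover have "Im \<zeta> < \<alpha>"
  proof (rule ccontr)
    assume "\<not> Im \<zeta> < \<alpha>"
    then have "0 \<le> sin (- (\<alpha> - Im \<zeta>))" using im \<alpha> by (intro sin_ge_zero) auto
    with s(2) show False unfolding sin_minus by linarith
  qed
  ultimately have "\<zeta> \<in> strip \<alpha>" by (auto simp: strip_def)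
  moreover have "strip_to_lens \<zeta> = z"
  proof -
    have "w - 1 = 2 * z / (1 - z)" "w + 1 = 2 / (1 - z)"
      using ne(1) by (auto simp: w_def divide_simps)
    then show ?thesis unfolding strip_to_lens_def e using ne(1) by simp
  qed
  ultimately show thesis using that e w_def ne(1) by blast
qed


section \<open>Forms on polynomials\<close>

text \<open>The model is \<open>\<Phi> p q = \<langle>p(A) x, q(A) x\<rangle>\<close>, for which multiplication by \<open>z - c\<close> is the operator
  \<open>A - c\<close>.\<close>

locale lens_form = poly_form \<Phi> for \<Phi> :: "complex poly \<Rightarrow> complex poly \<Rightarrow> complex" +
  fixes \<alpha> :: real
  assumes \<alpha>: "0 < \<alpha>" "\<alpha> \<le> pi / 2"
    and disc_bound: "\<And>c q. c = \<i> * of_real (cot \<alpha>) \<or> c = - (\<i> * of_real (cot \<alpha>)) \<Longrightarrow>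
      nm ([:- c, 1:] * q) \<le> 1 / sin \<alpha> * nm q"
begin

lemma B_interp: "\<Phi> (interp m \<mu> u) (interp m \<mu> v) = gram {..<m} (\<lambda>j k. \<Phi> (lagrange m \<mu> j) (lagrange m \<mu> k)) u v"
proof -
  have "\<Phi> (interp m \<mu> u) (interp m \<mu> v) = (\<Sum>j<m. \<Phi> (Polynomial.smult (u j) (lagrange m \<mu> j)) (interp m \<mu> v))"
    unfolding interp_def[of m \<mu> u] by (rule B_sum_left)
  also have "\<dots> = (\<Sum>j<m. \<Sum>k<m. \<Phi> (Polynomial.smult (u j) (lagrange m \<mu> j)) (Polynomial.smult (v k) (lagrange m \<mu> k)))"
    unfolding interp_def by (intro sum.cong refl B_sum_right)
  finally show ?thesis by (simp add: gram_def B_sc_left B_sc_right mult_ac)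
qed

text \<open>Multiplication by \<open>z - c\<close> followed by reduction modulo the orthogonal polynomial \<open>\<omega>\<close> is an orthogonal
  projection of a product, so the disc condition survives.  Passing to the perturbed polynomial \<open>\<omega>'\<close> changes
  the result by the leading coefficient times \<open>\<omega>' - \<omega>\<close>, which costs \<open>\<epsilon>\<close>.  Modulo \<open>\<omega>'\<close>, multiplication is diagonal in
  the Lagrange basis at the roots \<open>\<mu>\<close>.  The contraction by \<open>\<rho>\<close> about 0 brings in the distance \<open>cot \<alpha>\<close>
  from 0 to \<open>c\<close>, which is smaller than the radius.\<close>

lemma shifted_multiplication_bound:
  assumes m: "0 < m" and \<mu>: "inj_on \<mu> {..<m}"
    and \<omega>: "Polynomial.degree \<omega> = m" "Polynomial.lead_coeff \<omega> = 1"
      "\<And>q. Polynomial.degree q < m \<Longrightarrow> \<Phi> \<omega> q = 0"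
    and \<omega>': "Polynomial.degree \<omega>' = m" "Polynomial.lead_coeff \<omega>' = 1"
      "\<And>j. j < m \<Longrightarrow> poly \<omega>' (\<mu> j) = 0"
    and C: "\<And>q. Polynomial.degree q < m \<Longrightarrow> cmod (Polynomial.coeff q (m - 1)) \<le> C * nm q"
    and \<epsilon>: "C * nm (\<omega>' - \<omega>) \<le> \<epsilon>" and \<rho>: "0 < \<rho>" "\<rho> < 1"
    and c: "c = \<i> * of_real (cot \<alpha>) \<or> c = - (\<i> * of_real (cot \<alpha>))"
  shows "nm (interp m \<mu> (\<lambda>j. (of_real \<rho> * \<mu> j - c) * u j))
    \<le> (\<rho> * (1 / sin \<alpha> + \<epsilon>) + (1 - \<rho>) * cot \<alpha>) * nm (interp m \<mu> u)"
proof -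
  define q where "q = interp m \<mu> u"
  define l where "l = Polynomial.coeff q (m - 1)"
  have q: "Polynomial.degree q < m" "\<And>j. j < m \<Longrightarrow> poly q (\<mu> j) = u j"
    using degree_interp[OF m] poly_interp[OF \<mu>] by (simp_all add: q_def)
  have low: "Polynomial.degree ([:- b, 1:] * q - Polynomial.smult l w) < m"
    if "Polynomial.degree w = m" "Polynomial.lead_coeff w = 1" for b w
    unfolding degree_less_iff_low[OF m] low_def
  proof (intro CollectI allI impI)
    fix i assume i: "m \<le> i"
    have q0: "Polynomial.coeff q i = 0" using q(1) i by (intro coeff_eq_0) auto
    have q1: "Polynomial.coeff q (i - 1) = (if i = m then l else 0)"
      using q(1) i by (auto simp: l_def intro!: coeff_eq_0)
    have w: "Polynomial.coeff w i = (if i = m then 1 else 0)"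
      using that i by (auto intro!: coeff_eq_0)
    have "Polynomial.coeff ([:- b, 1:] * q) i = - b * Polynomial.coeff q i + Polynomial.coeff q (i - 1)"
      using i m by (cases i) (auto simp: mult_pCons_left)
    then show "Polynomial.coeff ([:- b, 1:] * q - Polynomial.smult l w) i = 0"
      using q0 q1 w by simp
  qed
  define y where "y = [:- c, 1:] * q - Polynomial.smult l \<omega>"
  have y: "nm y \<le> 1 / sin \<alpha> * nm q"
  proof -
    have "\<Phi> \<omega> y = 0" by (rule \<omega>(3)) (simp only: y_def low[OF \<omega>(1,2)])
    moreover from this have "\<Phi> y \<omega> = 0" using B_herm[of y \<omega>] by simp
    moreover have "[:- c, 1:] * q = y + Polynomial.smult l \<omega>" by (simp add: y_def)
    ultimately have "(nm ([:- c, 1:] * q))\<^sup>2 = (nm y)\<^sup>2 + (nm (Polynomial.smult l \<omega>))\<^sup>2"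
      by (simp add: nm_square B_add_left B_add_right B_sc_left B_sc_right)
    then have "(nm y)\<^sup>2 \<le> (nm ([:- c, 1:] * q))\<^sup>2" by simp
    then have "nm y \<le> nm ([:- c, 1:] * q)" by (rule power2_le_imp_le) simp
    also have "\<dots> \<le> 1 / sin \<alpha> * nm q" by (rule disc_bound[OF c])
    finally show ?thesis .
  qed
  define x where "x = [:- c, 1:] * q - Polynomial.smult l \<omega>'"
  have x: "nm x \<le> (1 / sin \<alpha> + \<epsilon>) * nm q"
  proof -
    have "x = y - Polynomial.smult l (\<omega>' - \<omega>)" by (simp add: x_def y_def smult_diff_right)
    then have "nm x \<le> nm y + cmod l * nm (\<omega>' - \<omega>)"
      using nm_triangle_diff[of y "Polynomial.smult l (\<omega>' - \<omega>)"] by (simp add: nm_sc)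
    also have "cmod l * nm (\<omega>' - \<omega>) \<le> C * nm q * nm (\<omega>' - \<omega>)"
      unfolding l_def by (rule mult_right_mono[OF C[OF q(1)]]) simp
    also have "C * nm q * nm (\<omega>' - \<omega>) \<le> \<epsilon> * nm q"
      using mult_right_mono[OF \<epsilon> nm_nonneg[of q]] by (simp add: mult_ac)
    finally show ?thesis using y by (simp add: algebra_simps)
  qed
  have "interp m \<mu> (\<lambda>j. (of_real \<rho> * \<mu> j - c) * u j)
      = interp m \<mu> (\<lambda>j. poly (Polynomial.smult (of_real \<rho>) x - Polynomial.smult (of_real (1 - \<rho>) * c) q) (\<mu> j))"
    unfolding interp_def
    by (intro sum.cong refl) (simp add: x_def q(2) \<omega>'(3) algebra_simps)
  also have "\<dots> = Polynomial.smult (of_real \<rho>) x - Polynomial.smult (of_real (1 - \<rho>) * c) q"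
  proof (rule interp_poly[OF \<mu>])
    have "Polynomial.degree x < m" unfolding x_def by (rule low[OF \<omega>'(1,2)])
    then show "Polynomial.degree (Polynomial.smult (of_real \<rho>) x - Polynomial.smult (of_real (1 - \<rho>) * c) q) < m"
      using q(1) by (intro degree_diff_less le_less_trans[OF degree_smult_le]) auto
  qed
  finally have "nm (interp m \<mu> (\<lambda>j. (of_real \<rho> * \<mu> j - c) * u j))
      \<le> cmod (of_real \<rho>) * nm x + cmod (of_real (1 - \<rho>) * c) * nm q"
    using nm_triangle_diff[of "Polynomial.smult (of_real \<rho>) x" "Polynomial.smult (of_real (1 - \<rho>) * c) q"]
    by (simp only: nm_sc)
  also have "cmod (of_real \<rho>) = \<rho>" using \<rho> by simp
  also have "cmod (of_real (1 - \<rho>) * c) = (1 - \<rho>) * cot \<alpha>"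
    using \<rho> c sin_cot(2)[OF \<alpha>] by (auto simp: norm_mult simp del: of_real_diff)
  also have "\<rho> * nm x \<le> \<rho> * ((1 / sin \<alpha> + \<epsilon>) * nm q)"
    using x \<rho> by (intro mult_left_mono) auto
  finally show ?thesis by (simp add: q_def algebra_simps)
qed

lemma coeff_bounded:
  assumes m: "0 < m" and ev: "\<And>z. \<exists>C. \<forall>q. Polynomial.degree q < m \<longrightarrow> cmod (poly q z) \<le> C * nm q"
  obtains C where "C > 0" "\<And>q. Polynomial.degree q < m \<Longrightarrow> cmod (Polynomial.coeff q (m - 1)) \<le> C * nm q"
proof -
  define \<mu> :: "nat \<Rightarrow> complex" where "\<mu> = of_nat"
  have inj: "inj_on \<mu> {..<m}" by (auto simp: \<mu>_def inj_on_def)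
  obtain C where C: "\<And>z q. Polynomial.degree q < m \<Longrightarrow> cmod (poly q z) \<le> C z * nm q"
    using ev by metis
  define D where "D = (\<Sum>j<m. \<bar>C (\<mu> j)\<bar> * cmod (Polynomial.coeff (lagrange m \<mu> j) (m - 1)))"
  have D: "D \<ge> 0" unfolding D_def by (intro sum_nonneg) auto
  show thesis
  proof (rule that[of "D + 1"])
    fix q :: "complex poly" assume q: "Polynomial.degree q < m"
    have "Polynomial.coeff q (m - 1) = (\<Sum>j<m. poly q (\<mu> j) * Polynomial.coeff (lagrange m \<mu> j) (m - 1))"
      by (subst interp_poly[OF inj q, symmetric]) (simp add: interp_def coeff_sum)
    also have "cmod \<dots> \<le> (\<Sum>j<m. (\<bar>C (\<mu> j)\<bar> * nm q) * cmod (Polynomial.coeff (lagrange m \<mu> j) (m - 1)))"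
    proof (rule order_trans[OF norm_sum sum_mono])
      fix j
      have "cmod (poly q (\<mu> j)) \<le> \<bar>C (\<mu> j)\<bar> * nm q"
        using C[OF q, of "\<mu> j"] mult_right_mono[OF abs_ge_self[of "C (\<mu> j)"] nm_nonneg[of q]] by linarith
      then show "cmod (poly q (\<mu> j) * Polynomial.coeff (lagrange m \<mu> j) (m - 1))
          \<le> (\<bar>C (\<mu> j)\<bar> * nm q) * cmod (Polynomial.coeff (lagrange m \<mu> j) (m - 1))"
        unfolding norm_mult by (rule mult_right_mono) simp
    qed
    also have "\<dots> = D * nm q" by (simp add: D_def sum_distrib_right sum_distrib_left mult_ac)
    finally show "cmod (Polynomial.coeff q (m - 1)) \<le> (D + 1) * nm q"
      by (simp add: distrib_right add_increasing2)
  qed (use D in simp)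
qed

text \<open>For a small perturbation of the roots, the contracted diagonal operator satisfies both disc conditions
  with a radius \<open>r < 1 / sin \<alpha>\<close>.  Testing them on the Lagrange basis puts the nodes into the open lens, so that
  they come from points of the strip, and the multiplier bound applies to \<open>p\<close> composed with the map
  from the strip to the lens.\<close>

theorem dilated_polynomial_bound:
  assumes m: "0 < m" and ev: "\<And>z. \<exists>C. \<forall>q. Polynomial.degree q < m \<longrightarrow> cmod (poly q z) \<le> C * nm q"
    and p: "Polynomial.degree p < m" "\<And>z. z \<in> lens \<alpha> \<Longrightarrow> cmod (poly p z) \<le> M" and M: "M > 0"
    and \<rho>: "0 < \<rho>" "\<rho> < 1"
  shows "nm (pcompose p [:0, of_real \<rho>:]) \<le> K25 \<alpha> * M * nm 1"
proof -
  note sc = sin_cot[OF \<alpha>]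
  obtain C where C: "C > 0" "\<And>q. Polynomial.degree q < m \<Longrightarrow> cmod (Polynomial.coeff q (m - 1)) \<le> C * nm q"
    using coeff_bounded[OF m ev] by blast
  obtain \<omega> where \<omega>: "Polynomial.degree \<omega> = m" "Polynomial.lead_coeff \<omega> = 1"
    "\<And>q. Polynomial.degree q < m \<Longrightarrow> \<Phi> \<omega> q = 0" using monic_orthogonal_polynomial[OF m] by blast
  obtain rt where "Polynomial.smult (Polynomial.lead_coeff \<omega>) (\<Prod>i<Polynomial.degree \<omega>. [:- rt i, 1:]) = \<omega>"
    using complex_poly_decompose' by blast
  then have rt: "(\<Prod>i<m. [:- rt i, 1:]) = \<omega>" using \<omega>(2) unfolding \<omega>(1) by simp
  \<comment> \<open>Half of what the contraction gains, so that a perturbation of this size keeps the radius below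
    \<open>1 / sin \<alpha>\<close>.\<close>
  define \<epsilon> where "\<epsilon> = (1 - \<rho>) * (1 / sin \<alpha> - cot \<alpha>) / 2"
  have \<epsilon>: "\<epsilon> > 0" using sc(4) \<rho> by (simp add: \<epsilon>_def)
  have "((\<lambda>\<eta>. nm (shifted_root_poly m rt \<eta> - \<omega>)) \<longlongrightarrow> 0) (at_right 0)"
  proof (rule tendsto_nm_zero)
    show "Polynomial.degree (shifted_root_poly m rt \<eta> - \<omega>) \<le> m" for \<eta>
      by (rule degree_diff_le) (simp_all add: shifted_root_poly_props \<omega>(1))
    have "((\<lambda>\<eta>. Polynomial.coeff (shifted_root_poly m rt \<eta>) i - Polynomial.coeff \<omega> i)
        \<longlongrightarrow> Polynomial.coeff \<omega> i - Polynomial.coeff \<omega> i) (at_right 0)" for i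
      using tendsto_coeff_shifted_root_poly[of m rt i] unfolding rt by (intro tendsto_intros)
    then show "((\<lambda>\<eta>. Polynomial.coeff (shifted_root_poly m rt \<eta> - \<omega>) i) \<longlongrightarrow> 0) (at_right 0)" for i by simp
  qed
  then have "\<forall>\<^sub>F \<eta> in at_right 0. nm (shifted_root_poly m rt \<eta> - \<omega>) < \<epsilon> / C"
    by (rule order_tendstoD(2)) (use \<epsilon> C(1) in simp)
  from eventually_happens'[OF trivial_limit_at_right_real eventually_conj[OF this eventually_distinct_roots[of rt m]]]
  obtain \<eta> where \<eta>: "nm (shifted_root_poly m rt \<eta> - \<omega>) < \<epsilon> / C"
    "inj_on (\<lambda>i. rt i + of_real \<eta> * of_nat i) {..<m}" by blast
  define \<mu> where "\<mu> = (\<lambda>i. rt i + of_real \<eta> * of_nat i)"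
  define \<omega>' where "\<omega>' = shifted_root_poly m rt \<eta>"
  have inj: "inj_on \<mu> {..<m}" using \<eta>(2) by (simp add: \<mu>_def)
  have \<omega>': "Polynomial.degree \<omega>' = m" "Polynomial.lead_coeff \<omega>' = 1" "\<And>j. j < m \<Longrightarrow> poly \<omega>' (\<mu> j) = 0"
    unfolding \<omega>'_def \<mu>_def by (rule shifted_root_poly_props)+
  have C\<epsilon>: "C * nm (\<omega>' - \<omega>) \<le> \<epsilon>" using \<eta>(1) C(1) by (simp add: \<omega>'_def field_simps)
  define r where "r = \<rho> * (1 / sin \<alpha> + \<epsilon>) + (1 - \<rho>) * cot \<alpha>"
  have r: "r < 1 / sin \<alpha>"
  proof -
    have "2 * \<epsilon> = (1 - \<rho>) * (1 / sin \<alpha> - cot \<alpha>)" by (simp add: \<epsilon>_def)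
    moreover have "r = 1 / sin \<alpha> - (1 - \<rho>) * (1 / sin \<alpha> - cot \<alpha>) + \<rho> * \<epsilon>"
      unfolding r_def by (simp only: ring_distribs mult_1_left)
    ultimately have "r = 1 / sin \<alpha> - 2 * \<epsilon> + \<rho> * \<epsilon>" by simp
    moreover have "\<rho> * \<epsilon> < 1 * \<epsilon>" using \<rho> \<epsilon> by (intro mult_strict_right_mono) auto
    ultimately show ?thesis using \<epsilon> by linarith
  qed
  define z where "z = (\<lambda>j. of_real \<rho> * \<mu> j)"
  have bound: "nm (interp m \<mu> (\<lambda>j. (z j - c) * u j)) \<le> r * nm (interp m \<mu> u)"
    if "c = \<i> * of_real (cot \<alpha>) \<or> c = - (\<i> * of_real (cot \<alpha>))" for c u
    unfolding z_def r_def
    by (rule shifted_multiplication_bound[OF m inj \<omega> \<omega>' C(2) C\<epsilon> \<rho> that])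
  have node: "cmod (z j - c) < 1 / sin \<alpha>"
    if j: "j < m" and c: "c = \<i> * of_real (cot \<alpha>) \<or> c = - (\<i> * of_real (cot \<alpha>))" for j c
  proof -
    define \<delta> where "\<delta> = (\<lambda>i. if i = j then 1 else 0 :: complex)"
    define l where "l = interp m \<mu> \<delta>"
    have "interp m \<mu> (\<lambda>i. (z i - c) * \<delta> i) = Polynomial.smult (z j - c) l"
    proof -
      have "interp m \<mu> (\<lambda>i. (z i - c) * \<delta> i) = interp m \<mu> (\<lambda>i. poly (Polynomial.smult (z j - c) l) (\<mu> i))"
        unfolding interp_def by (intro sum.cong refl) (auto simp: l_def poly_interp[OF inj] \<delta>_def)
      also have "\<dots> = Polynomial.smult (z j - c) l"
        by (intro interp_poly[OF inj] le_less_trans[OF degree_smult_le]) (simp add: l_def degree_interp[OF m])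
      finally show ?thesis .
    qed
    then have le: "cmod (z j - c) * nm l \<le> r * nm l"
      using bound[OF c, of \<delta>] by (simp add: nm_sc l_def)
    obtain C' where "\<forall>q. Polynomial.degree q < m \<longrightarrow> cmod (poly q (\<mu> j)) \<le> C' * nm q" using ev by blast
    then have "1 \<le> C' * nm l"
      using degree_interp[OF m, of \<mu> \<delta>] poly_interp[OF inj j, of \<delta>] by (fastforce simp: l_def \<delta>_def)
    then have "nm l \<noteq> 0" by auto
    then have "nm l > 0" using nm_nonneg[of l] by linarith
    then have "cmod (z j - c) \<le> r" using le by simp
    then show ?thesis using r by linarith
  qed
  have "\<exists>\<zeta>. \<zeta> \<in> strip \<alpha> \<and> exp \<zeta> = (1 + z j) / (1 - z j) \<and> strip_to_lens \<zeta> = z j \<and> z j \<noteq> 1" if "j < m" for j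
    using open_lens_to_strip[OF \<alpha>, of "z j"] node[OF that, of "\<i> * of_real (cot \<alpha>)"]
      node[OF that, of "- (\<i> * of_real (cot \<alpha>))"] by fastforce
  then obtain \<zeta> where \<zeta>: "\<And>j. j < m \<Longrightarrow> \<zeta> j \<in> strip \<alpha>" "\<And>j. j < m \<Longrightarrow> exp (\<zeta> j) = (1 + z j) / (1 - z j)"
    "\<And>j. j < m \<Longrightarrow> strip_to_lens (\<zeta> j) = z j" "\<And>j. j < m \<Longrightarrow> z j \<noteq> 1" by metis
  define G where "G = (\<lambda>j k. \<Phi> (lagrange m \<mu> j) (lagrange m \<mu> k))"
  have gram: "gram {..<m} G u v = \<Phi> (interp m \<mu> u) (interp m \<mu> v)" for u v
    by (simp add: B_interp G_def)
  have half_plane: "0 \<le> Re (gram {..<m} (\<lambda>j k. G j k * (A * exp (\<zeta> j) + cnj (A * exp (\<zeta> k)))) u u)"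
    if A: "A = of_real (sin \<alpha>) * (1 - \<i> * of_real h)" and h: "h = cot \<alpha> \<or> h = - cot \<alpha>" for A h u
  proof -
    define c where "c = \<i> * of_real h"
    have c: "c = \<i> * of_real (cot \<alpha>) \<or> c = - (\<i> * of_real (cot \<alpha>))" using h by (auto simp: c_def)
    have h2: "1 + h\<^sup>2 = (1 / sin \<alpha>)\<^sup>2" using h sc(3) by auto
    define y where "y = (\<lambda>j. 1 / (1 - z j))"
    define v where "v = (\<lambda>j. u j * y j)"
    have "gram {..<m} (\<lambda>j k. G j k * (A * exp (\<zeta> j) + cnj (A * exp (\<zeta> k)))) u u
      = (\<Sum>j<m. \<Sum>k<m. of_real (2 * sin \<alpha>) * (of_real ((1 / sin \<alpha>)\<^sup>2) * (v j * cnj (v k) * G j k)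
          - ((z j - c) * v j) * cnj ((z k - c) * v k) * G j k))"
      unfolding gram_def
    proof (intro sum.cong refl)
      have alg: "a * b * (g * (s * ((x - w * w') * (p * p')))) = s * (x * ((a * p) * (b * p') * g) - (w * (a * p)) * (w' * (b * p')) * g)"
        for a b g s x w w' p p' :: complex by (simp add: algebra_simps)
      fix j k assume "j \<in> {..<m}" "k \<in> {..<m}"
      then have jk: "j < m" "k < m" by auto
      have "A * exp (\<zeta> j) + cnj (A * exp (\<zeta> k)) = of_real (2 * sin \<alpha>) *
          ((of_real ((1 / sin \<alpha>)\<^sup>2) - (z j - c) * cnj (z k - c)) * (y j * cnj (y k)))"
        unfolding \<zeta>(2)[OF jk(1)] \<zeta>(2)[OF jk(2)] A c_def y_def h2[symmetric]
        by (rule half_plane_kernel[OF \<zeta>(4)[OF jk(1)] \<zeta>(4)[OF jk(2)]])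
      then show "u j * cnj (u k) * (G j k * (A * exp (\<zeta> j) + cnj (A * exp (\<zeta> k))))
        = of_real (2 * sin \<alpha>) * (of_real ((1 / sin \<alpha>)\<^sup>2) * (v j * cnj (v k) * G j k)
          - ((z j - c) * v j) * cnj ((z k - c) * v k) * G j k)"
        by (simp only: v_def complex_cnj_mult alg)
    qed
    also have "\<dots> = of_real (2 * sin \<alpha>) * (of_real ((1 / sin \<alpha>)\<^sup>2) * gram {..<m} G v v
        - gram {..<m} G (\<lambda>j. (z j - c) * v j) (\<lambda>j. (z j - c) * v j))"
      by (simp only: gram_def sum_distrib_left[symmetric] sum_subtractf)
    finally have eq: "Re (gram {..<m} (\<lambda>j k. G j k * (A * exp (\<zeta> j) + cnj (A * exp (\<zeta> k)))) u u)
      = 2 * sin \<alpha> * ((1 / sin \<alpha>)\<^sup>2 * (nm (interp m \<mu> v))\<^sup>2 - (nm (interp m \<mu> (\<lambda>j. (z j - c) * v j)))\<^sup>2)"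
      unfolding gram nm_square by (simp only: Re_complex_of_real times_complex.simps minus_complex.simps Im_complex_of_real) simp
    have "(nm (interp m \<mu> (\<lambda>j. (z j - c) * v j)))\<^sup>2 \<le> (1 / sin \<alpha> * nm (interp m \<mu> v))\<^sup>2"
      using order_trans[OF bound[OF c, of v] mult_right_mono[OF less_imp_le[OF r] nm_nonneg]]
      by (intro power_mono) auto
    then show ?thesis
      unfolding eq power_mult_distrib using sc(1) by (intro mult_nonneg_nonneg) simp_all
  qed
  interpret S: sector_gram "{..<m}" G \<zeta> \<alpha>
  proof
    show "G k j = cnj (G j k)" for j k unfolding G_def by (rule B_herm)
    show "0 \<le> Re (gram {..<m} G u u)" for u unfolding gram by (rule B_nonneg)
    show "0 \<le> Re (gram {..<m} (\<lambda>j k. G j k *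
        (- \<i> * exp (\<i> * \<alpha>) * exp (\<zeta> j) + cnj (- \<i> * exp (\<i> * \<alpha>) * exp (\<zeta> k)))) u u)" for u
      by (rule half_plane[OF sc(5)[symmetric]]) simp
    show "0 \<le> Re (gram {..<m} (\<lambda>j k. G j k *
        (\<i> * exp (- \<i> * \<alpha>) * exp (\<zeta> j) + cnj (\<i> * exp (- \<i> * \<alpha>) * exp (\<zeta> k)))) u u)" for u
      by (rule half_plane[OF sc(6)[symmetric]]) simp
    show "\<exists>C. \<forall>u. (cmod (u j))\<^sup>2 \<le> C * Re (gram {..<m} G u u)" if "j \<in> {..<m}" for j
    proof -
      obtain C' where C': "\<And>q. Polynomial.degree q < m \<Longrightarrow> cmod (poly q (\<mu> j)) \<le> C' * nm q" using ev by blast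
      have "(cmod (u j))\<^sup>2 \<le> C'\<^sup>2 * Re (gram {..<m} G u u)" for u
      proof -
        have "cmod (u j) \<le> C' * nm (interp m \<mu> u)"
          using C'[OF degree_interp[OF m, of \<mu> u]] poly_interp[OF inj, of j u] that by simp
        then have "(cmod (u j))\<^sup>2 \<le> (C' * nm (interp m \<mu> u))\<^sup>2" by (rule power_mono) simp
        then show ?thesis by (simp add: power_mult_distrib nm_square gram)
      qed
      then show ?thesis by blast
    qed
  qed (use \<alpha> \<zeta>(1) in auto)
  define \<phi> where "\<phi> = (\<lambda>\<zeta>. poly p (strip_to_lens \<zeta>) / of_real M)"
  have "\<phi> \<in> admissible \<alpha>"
    unfolding admissible_def
  proof (intro CollectI conjI ballI)
    have "strip_to_lens holomorphic_on strip \<alpha>"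
      unfolding strip_to_lens_def[abs_def]
      by (intro holomorphic_intros) (use exp_strip_half_planes(3)[OF _ \<alpha>] in \<open>metis add_eq_0_iff2\<close>)
    then have "(poly p \<circ> strip_to_lens) holomorphic_on strip \<alpha>"
      by (rule holomorphic_on_compose) (intro holomorphic_intros)
    then show "\<phi> holomorphic_on strip \<alpha>"
      unfolding \<phi>_def o_def using M by (intro holomorphic_on_divide[OF _ holomorphic_on_const]) auto
    show "cmod (\<phi> x) \<le> 1" if "x \<in> strip \<alpha>" for x
      using p(2)[OF strip_to_lens_in_lens[OF that \<alpha>]] M by (simp add: \<phi>_def norm_divide)
  qed
  from S.admissible_multiplication_bound[OF this, of "\<lambda>_. 1"]
  have le: "S.nm (\<lambda>j. \<phi> (\<zeta> j)) \<le> K25 \<alpha> * S.nm (\<lambda>_. 1)" by simp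
  have Snm: "S.nm u = nm (interp m \<mu> u)" for u by (simp add: S.nm_def nm_def gram)
  have one: "interp m \<mu> (\<lambda>_. 1) = 1" using interp_poly[OF inj, of 1] m by simp
  have "interp m \<mu> (\<lambda>j. \<phi> (\<zeta> j)) = Polynomial.smult (1 / of_real M) (pcompose p [:0, of_real \<rho>:])"
  proof -
    have "interp m \<mu> (\<lambda>j. \<phi> (\<zeta> j)) = interp m \<mu> (\<lambda>j. poly (Polynomial.smult (1 / of_real M) (pcompose p [:0, of_real \<rho>:])) (\<mu> j))"
      unfolding interp_def by (intro sum.cong refl) (simp add: \<phi>_def \<zeta>(3) z_def poly_pcompose mult.commute)
    also have "\<dots> = Polynomial.smult (1 / of_real M) (pcompose p [:0, of_real \<rho>:])"
    proof (rule interp_poly[OF inj], rule le_less_trans[OF degree_smult_le])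
      show "Polynomial.degree (pcompose p [:0, of_real \<rho>:]) < m" using p(1) by (simp add: degree_pcompose)
    qed
    finally show ?thesis .
  qed
  then have "1 / M * nm (pcompose p [:0, of_real \<rho>:]) \<le> K25 \<alpha> * nm 1"
    using le M by (simp add: Snm one nm_sc norm_divide)
  then show ?thesis using M by (simp add: pos_divide_le_eq mult_ac)
qed

end


section \<open>Operators on a Hilbert space\<close>

context complex_hilbert_space
begin

lemma scalar_closed [simp]: "x \<in> carrier H \<Longrightarrow> c \<odot> x \<in> carrier H"
  using smult_closed[of c x] by (simp add: ring_of_type_algebra_def)

lemma scalar_add: "x \<in> carrier H \<Longrightarrow> (a + b) \<odot> x = a \<odot> x \<oplus> b \<odot> x"
  using smult_l_distr[of a b x] by (simp add: ring_of_type_algebra_def)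

lemma scalar_add_right: "x \<in> carrier H \<Longrightarrow> y \<in> carrier H \<Longrightarrow> a \<odot> (x \<oplus> y) = a \<odot> x \<oplus> a \<odot> y"
  using smult_r_distr[of a x y] by (simp add: ring_of_type_algebra_def)

lemma scalar_scalar: "x \<in> carrier H \<Longrightarrow> a \<odot> (b \<odot> x) = (a * b) \<odot> x"
  using smult_assoc1[of a b x] by (simp add: ring_of_type_algebra_def)

lemma scalar_one: "x \<in> carrier H \<Longrightarrow> 1 \<odot> x = x"
  using smult_one[of x] by (simp add: ring_of_type_algebra_def)

lemma scalar_zero: "x \<in> carrier H \<Longrightarrow> 0 \<odot> x = \<zero>"
  using smult_l_null[of x] by (simp add: ring_of_type_algebra_def)

lemma scalar_uminus: "x \<in> carrier H \<Longrightarrow> (- c) \<odot> x = \<ominus> (c \<odot> x)"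
proof -
  assume x: "x \<in> carrier H"
  have "(- c) \<odot> x \<oplus> c \<odot> x = \<zero>" using scalar_add[OF x, of "- c" c] scalar_zero[OF x] by simp
  then show ?thesis using x by (intro M.minus_equality[symmetric]) auto
qed

lemma minus_as_scalar: "x \<in> carrier H \<Longrightarrow> y \<in> carrier H \<Longrightarrow> x \<ominus> y = x \<oplus> (- 1) \<odot> y"
  by (simp add: a_minus_def scalar_uminus scalar_one)

lemma ip_add_right: "\<lbrakk>x \<in> carrier H; y \<in> carrier H; z \<in> carrier H\<rbrakk> \<Longrightarrow> ip H z (x \<oplus> y) = ip H z x + ip H z y"
  using ip_add[of x y z] ip_cnj[of z "x \<oplus> y"] ip_cnj[of z x] ip_cnj[of z y]
  by (metis M.add.m_closed complex_cnj_add complex_cnj_cnj)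

lemma ip_smult_right: "\<lbrakk>x \<in> carrier H; y \<in> carrier H\<rbrakk> \<Longrightarrow> ip H x (c \<odot> y) = cnj c * ip H x y"
  using ip_smult[of y x c] ip_cnj[of x "c \<odot> y"] ip_cnj[of x y]
  by (metis scalar_closed complex_cnj_mult complex_cnj_cnj)

lemma hnorm_nonneg: "x \<in> carrier H \<Longrightarrow> 0 \<le> hnorm H x"
  by (simp add: hnorm_def ip_nonneg)

lemma hnorm_square: "x \<in> carrier H \<Longrightarrow> (hnorm H x)\<^sup>2 = Re (ip H x x)"
  by (simp add: hnorm_def ip_nonneg)

lemma hnorm_scalar: "x \<in> carrier H \<Longrightarrow> hnorm H (c \<odot> x) = cmod c * hnorm H x"
proof -
  assume x: "x \<in> carrier H"
  have "ip H (c \<odot> x) (c \<odot> x) = of_real ((cmod c)\<^sup>2) * ip H x x"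
    unfolding complex_norm_square using x by (simp add: ip_smult ip_smult_right mult_ac)
  then show ?thesis by (simp add: hnorm_def real_sqrt_mult)
qed

lemma hnorm_zero: "hnorm H \<zero> = 0"
  using hnorm_scalar[of \<zero> 0] scalar_zero[of \<zero>] by simp

lemma hnorm_minus_le:
  assumes "x \<in> carrier H" "y \<in> carrier H"
  shows "(hnorm H (x \<ominus> y))\<^sup>2 \<le> 2 * (hnorm H x)\<^sup>2 + 2 * (hnorm H y)\<^sup>2"
proof -
  have "(hnorm H (x \<ominus> y))\<^sup>2 + (hnorm H (x \<oplus> y))\<^sup>2 = 2 * (hnorm H x)\<^sup>2 + 2 * (hnorm H y)\<^sup>2"
    using assms
    by (simp add: hnorm_square minus_as_scalar ip_add ip_add_right ip_smult ip_smult_right)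
  then show ?thesis using zero_le_power2[of "hnorm H (x \<oplus> y)"] by linarith
qed

text \<open>The constant \<open>K\<close> guarantees that the supremum defining the operator norm is taken over a bounded set.\<close>

lemma hnorm_le_op_norm:
  assumes T: "\<And>x. x \<in> carrier H \<Longrightarrow> T x \<in> carrier H" "\<And>c x. x \<in> carrier H \<Longrightarrow> T (c \<odot> x) = c \<odot> T x"
    and K: "\<And>x. x \<in> carrier H \<Longrightarrow> hnorm H (T x) \<le> K * hnorm H x"
    and x: "x \<in> carrier H"
  shows "hnorm H (T x) \<le> op_norm H T * hnorm H x"
proof (cases "hnorm H x = 0")
  case True
  then show ?thesis using K[OF x] hnorm_nonneg[OF T(1)[OF x]] by simp
next
  case False
  then have pos: "hnorm H x > 0" using hnorm_nonneg[OF x] by linarith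
  define y where "y = of_real (1 / hnorm H x) \<odot> x"
  have y: "y \<in> carrier H" "hnorm H y \<le> 1"
    using x pos by (auto simp: y_def hnorm_scalar norm_divide)
  have bdd: "bdd_above {hnorm H (T x) | x. x \<in> carrier H \<and> hnorm H x \<le> 1}"
  proof (rule bdd_aboveI[of _ "\<bar>K\<bar>"], clarify)
    fix x assume x: "x \<in> carrier H" "hnorm H x \<le> 1"
    have "hnorm H (T x) \<le> K * hnorm H x" by (rule K[OF x(1)])
    also have "\<dots> \<le> \<bar>K\<bar> * hnorm H x" by (rule mult_right_mono) (auto simp: hnorm_nonneg[OF x(1)])
    also have "\<dots> \<le> \<bar>K\<bar>" using x(2) by (simp add: mult_left_le)
    finally show "hnorm H (T x) \<le> \<bar>K\<bar>" .
  qed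
  have "hnorm H (T y) \<le> op_norm H T"
    unfolding op_norm_def by (rule cSup_upper[OF _ bdd]) (use y in blast)
  moreover have "hnorm H (T y) = 1 / hnorm H x * hnorm H (T x)"
    unfolding y_def T(2)[OF x] using hnorm_scalar[OF T(1)[OF x]] pos by (simp add: norm_divide)
  ultimately show ?thesis using pos by (simp add: pos_divide_le_eq)
qed

lemma op_norm_le:
  assumes "\<And>x. x \<in> carrier H \<Longrightarrow> hnorm H (T x) \<le> r * hnorm H x" "r \<ge> 0"
  shows "op_norm H T \<le> r"
  unfolding op_norm_def
proof (rule cSup_least)
  have "hnorm H (T \<zero>) \<in> {hnorm H (T x) |x. x \<in> carrier H \<and> hnorm H x \<le> 1}"
    using hnorm_zero by force
  then show "{hnorm H (T x) |x. x \<in> carrier H \<and> hnorm H x \<le> 1} \<noteq> {}" by blast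
  fix a assume "a \<in> {hnorm H (T x) |x. x \<in> carrier H \<and> hnorm H x \<le> 1}"
  then obtain x where x: "a = hnorm H (T x)" "x \<in> carrier H" "hnorm H x \<le> 1" by blast
  have "r * hnorm H x \<le> r" using x(3) assms(2) by (simp add: mult_left_le)
  then show "a \<le> r" using assms(1)[OF x(2)] x(1) by linarith
qed

end

locale hilbert_operator = complex_hilbert_space +
  fixes A :: "'a \<Rightarrow> 'a"
  assumes bounded: "bounded_operator H A"
begin

lemma A_closed [simp]: "x \<in> carrier H \<Longrightarrow> A x \<in> carrier H"
  and A_add: "x \<in> carrier H \<Longrightarrow> y \<in> carrier H \<Longrightarrow> A (x \<oplus> y) = A x \<oplus> A y"
  and A_scalar: "x \<in> carrier H \<Longrightarrow> A (c \<odot> x) = c \<odot> A x"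
  using bounded by (auto simp: bounded_operator_def)

lemma A_power_closed [simp]: "x \<in> carrier H \<Longrightarrow> (A ^^ n) x \<in> carrier H"
  by (induction n) auto

text \<open>Taking the number of summands independent of the degree makes the sum additive in the polynomial term
  by term.\<close>

definition op_poly_upto :: "nat \<Rightarrow> complex poly \<Rightarrow> 'a \<Rightarrow> 'a" where
  "op_poly_upto n p x = (\<Oplus>i\<in>{..n}. Polynomial.coeff p i \<odot> (A ^^ i) x)"

lemma op_poly_upto_closed [simp]: "x \<in> carrier H \<Longrightarrow> op_poly_upto n p x \<in> carrier H"
  unfolding op_poly_upto_def by (rule M.finsum_closed) auto

lemma op_poly_upto_0: "x \<in> carrier H \<Longrightarrow> op_poly_upto 0 p x = Polynomial.coeff p 0 \<odot> x"
  unfolding op_poly_upto_def using M.finsum_0[of "\<lambda>i. Polynomial.coeff p i \<odot> (A ^^ i) x"] by auto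

lemma op_poly_upto_Suc:
  "x \<in> carrier H \<Longrightarrow> op_poly_upto (Suc n) p x = Polynomial.coeff p (Suc n) \<odot> (A ^^ Suc n) x \<oplus> op_poly_upto n p x"
  unfolding op_poly_upto_def using M.finsum_Suc[of "\<lambda>i. Polynomial.coeff p i \<odot> (A ^^ i) x" n] by auto

lemma op_poly_eq_upto:
  assumes x: "x \<in> carrier H" and n: "Polynomial.degree p \<le> n"
  shows "op_poly H p A x = op_poly_upto n p x"
  using n
proof (induction n rule: dec_induct)
  case base
  then show ?case by (simp add: op_poly_def op_poly_upto_def)
next
  case (step n)
  then show ?case using x by (simp add: op_poly_upto_Suc coeff_eq_0 scalar_zero)
qed

lemma op_poly_closed [simp]: "x \<in> carrier H \<Longrightarrow> op_poly H p A x \<in> carrier H"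
  using op_poly_eq_upto[of x p "Polynomial.degree p"] by simp

lemma op_poly_upto_add:
  assumes x: "x \<in> carrier H"
  shows "op_poly_upto n (p + q) x = op_poly_upto n p x \<oplus> op_poly_upto n q x"
proof (induction n)
  case 0
  then show ?case using x by (simp add: op_poly_upto_0 scalar_add)
next
  case (Suc n)
  then show ?case using x by (simp add: op_poly_upto_Suc scalar_add M.add.m_ac)
qed

lemma op_poly_upto_smult:
  assumes x: "x \<in> carrier H"
  shows "op_poly_upto n (Polynomial.smult c p) x = c \<odot> op_poly_upto n p x"
  using x by (induction n) (simp_all add: op_poly_upto_0 op_poly_upto_Suc scalar_scalar scalar_add_right)

lemma op_poly_upto_pCons:
  assumes x: "x \<in> carrier H"
  shows "op_poly_upto (Suc n) (pCons 0 p) x = A (op_poly_upto n p x)"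
  using x by (induction n) (simp_all add: op_poly_upto_0 op_poly_upto_Suc scalar_zero A_scalar A_add)

lemma op_poly_add:
  assumes x: "x \<in> carrier H"
  shows "op_poly H (p + q) A x = op_poly H p A x \<oplus> op_poly H q A x"
proof -
  define n where "n = max (Polynomial.degree p) (Polynomial.degree q)"
  have "Polynomial.degree (p + q) \<le> n" unfolding n_def by (rule degree_add_le_max)
  then show ?thesis using op_poly_eq_upto[OF x, of p n] op_poly_eq_upto[OF x, of q n]
      op_poly_eq_upto[OF x, of "p + q" n] op_poly_upto_add[OF x] by (simp add: n_def)
qed

lemma op_poly_smult:
  assumes x: "x \<in> carrier H"
  shows "op_poly H (Polynomial.smult c p) A x = c \<odot> op_poly H p A x"
  using op_poly_eq_upto[OF x, of p "Polynomial.degree p"] op_poly_upto_smult[OF x]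
    op_poly_eq_upto[OF x, of "Polynomial.smult c p" "Polynomial.degree p"] degree_smult_le by simp

lemma op_poly_pCons:
  assumes x: "x \<in> carrier H"
  shows "op_poly H (pCons 0 p) A x = A (op_poly H p A x)"
  using op_poly_eq_upto[OF x, of p "Polynomial.degree p"] op_poly_upto_pCons[OF x]
    op_poly_eq_upto[OF x, of "pCons 0 p" "Suc (Polynomial.degree p)"] degree_pCons_le[of 0 p] by simp

lemma op_poly_one: "x \<in> carrier H \<Longrightarrow> op_poly H 1 A x = x"
  using op_poly_eq_upto[of x 1 0] by (simp add: op_poly_upto_0 scalar_one)

lemma op_poly_linear_factor:
  assumes x: "x \<in> carrier H"
  shows "op_poly H ([:- c, 1:] * q) A x = op_shift H A c (op_poly H q A x)"
proof -
  have "[:- c, 1:] * q = pCons 0 q + Polynomial.smult (- c) q" by (simp add: mult_pCons_left)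
  then show ?thesis
    using x by (simp only: op_poly_add op_poly_pCons op_poly_smult)
      (simp add: op_shift_def a_minus_def scalar_uminus)
qed

lemma op_shift_le:
  assumes x: "x \<in> carrier H"
  shows "hnorm H (op_shift H A c x) \<le> op_norm H (op_shift H A c) * hnorm H x"
proof -
  obtain K where "\<forall>x\<in>carrier H. hnorm H (A x) \<le> K * hnorm H x"
    using bounded unfolding bounded_operator_def by blast
  then have K: "\<And>x. x \<in> carrier H \<Longrightarrow> hnorm H (A x) \<le> K * hnorm H x" by blast
  have closed: "op_shift H A c x \<in> carrier H" if "x \<in> carrier H" for x
    using that by (simp add: op_shift_def)
  show ?thesis
  proof (rule hnorm_le_op_norm[OF closed _ _ x])
    show "op_shift H A c (a \<odot> x) = a \<odot> op_shift H A c x" if "x \<in> carrier H" for a x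
      using that by (simp add: op_shift_def minus_as_scalar A_scalar scalar_add_right scalar_scalar mult_ac)
    show "hnorm H (op_shift H A c x) \<le> sqrt (2 * K\<^sup>2 + 2 * (cmod c)\<^sup>2) * hnorm H x" if x: "x \<in> carrier H" for x
    proof (rule power2_le_imp_le)
      have "(hnorm H (op_shift H A c x))\<^sup>2 \<le> 2 * (hnorm H (A x))\<^sup>2 + 2 * (hnorm H (c \<odot> x))\<^sup>2"
        unfolding op_shift_def by (rule hnorm_minus_le) (use x in auto)
      also have "(hnorm H (A x))\<^sup>2 \<le> (K * hnorm H x)\<^sup>2"
        by (rule power_mono[OF K[OF x]]) (simp add: hnorm_nonneg x)
      finally show "(hnorm H (op_shift H A c x))\<^sup>2 \<le> (sqrt (2 * K\<^sup>2 + 2 * (cmod c)\<^sup>2) * hnorm H x)\<^sup>2"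
        using x by (simp add: power_mult_distrib hnorm_scalar algebra_simps)
    qed (simp add: hnorm_nonneg x)
  qed
qed

lemma poly_form_operator:
  assumes x: "x \<in> carrier H"
  shows "poly_form (\<lambda>p q. ip H (op_poly H p A x) (op_poly H q A x))"
  unfolding poly_form_def
proof
  show "ip H (op_poly H q A x) (op_poly H p A x) = cnj (ip H (op_poly H p A x) (op_poly H q A x))" for p q
    using x by (intro ip_cnj) auto
qed (use x in \<open>simp_all add: op_poly_add op_poly_smult ip_add ip_smult ip_nonneg\<close>)

definition sample :: "nat \<Rightarrow> complex" where "sample i = of_real (1 / (of_nat i + 1))"

text \<open>The added form makes evaluations of polynomials of degree less than \<open>m\<close> bounded, and as the sample points
  lie in the lens, it satisfies the disc conditions as well.\<close>

definition reg_form :: "'a \<Rightarrow> nat \<Rightarrow> real \<Rightarrow> complex poly \<Rightarrow> complex poly \<Rightarrow> complex" where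
  "reg_form x m \<epsilon> p q = ip H (op_poly H p A x) (op_poly H q A x)
     + of_real \<epsilon> * (\<Sum>i<m. poly p (sample i) * cnj (poly q (sample i)))"

lemma reg_form_self:
  "x \<in> carrier H \<Longrightarrow> Re (reg_form x m \<epsilon> p p) = (hnorm H (op_poly H p A x))\<^sup>2 + \<epsilon> * (\<Sum>i<m. (cmod (poly p (sample i)))\<^sup>2)"
  by (simp add: reg_form_def hnorm_square complex_norm_square[symmetric] del: of_real_power flip: of_real_power)

lemma lens_form_operator:
  assumes x: "x \<in> carrier H" and \<alpha>: "0 < \<alpha>" "\<alpha> \<le> pi / 2" and \<epsilon>: "\<epsilon> > 0"
    and disc: "op_norm H (op_shift H A (\<i> * of_real (cot \<alpha>))) \<le> 1 / sin \<alpha>"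
      "op_norm H (op_shift H A (- (\<i> * of_real (cot \<alpha>)))) \<le> 1 / sin \<alpha>"
  shows "lens_form (reg_form x m \<epsilon>) \<alpha>"
proof -
  note sc = sin_cot[OF \<alpha>]
  interpret poly_form "reg_form x m \<epsilon>"
    unfolding poly_form_def
  proof
    show "reg_form x m \<epsilon> q p = cnj (reg_form x m \<epsilon> p q)" for p q
      using x ip_cnj[of "op_poly H p A x" "op_poly H q A x"] by (simp add: reg_form_def mult.commute)
    show "0 \<le> Re (reg_form x m \<epsilon> p p)" for p
      using x \<epsilon> by (simp add: reg_form_self sum_nonneg)
    show "reg_form x m \<epsilon> (p + p') q = reg_form x m \<epsilon> p q + reg_form x m \<epsilon> p' q" for p p' q
      using x by (simp add: reg_form_def op_poly_add ip_add distrib_right sum.distrib distrib_left)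
    show "reg_form x m \<epsilon> (Polynomial.smult c p) q = c * reg_form x m \<epsilon> p q" for c p q
      using x by (simp add: reg_form_def op_poly_smult ip_smult distrib_left sum_distrib_left mult_ac)
  qed
  show ?thesis
  proof unfold_locales
    fix c q assume c: "c = \<i> * of_real (cot \<alpha>) \<or> c = - (\<i> * of_real (cot \<alpha>))"
    define r where "r = 1 / sin \<alpha>"
    have r: "r > 0" "1 + (cot \<alpha>)\<^sup>2 = r\<^sup>2" using sc(1,3) by (auto simp: r_def)
    have c2: "(cmod (sample i - c))\<^sup>2 \<le> r\<^sup>2" for i
    proof -
      have "(cmod (sample i - c))\<^sup>2 = (1 / (of_nat i + 1))\<^sup>2 + (cot \<alpha>)\<^sup>2"
        using c by (auto simp: cmod_power2 sample_def)
      moreover have "(1 / (of_nat i + 1) :: real)\<^sup>2 \<le> 1"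
        by (intro power_le_one) auto
      ultimately show ?thesis using r(2) by linarith
    qed
    define y where "y = op_poly H q A x"
    have y: "y \<in> carrier H" using x by (simp add: y_def)
    have "op_norm H (op_shift H A c) \<le> r" using c disc by (auto simp: r_def)
    then have "hnorm H (op_shift H A c y) \<le> r * hnorm H y"
      using op_shift_le[OF y, of c] mult_right_mono[of "op_norm H (op_shift H A c)" r "hnorm H y"] hnorm_nonneg[OF y] by linarith
    moreover have "0 \<le> hnorm H (op_shift H A c y)" using y by (intro hnorm_nonneg) (simp add: op_shift_def)
    ultimately have 1: "(hnorm H (op_shift H A c y))\<^sup>2 \<le> (r * hnorm H y)\<^sup>2" by (rule power_mono)
    have 2: "(\<Sum>i<m. (cmod (poly ([:- c, 1:] * q) (sample i)))\<^sup>2) \<le> (\<Sum>i<m. r\<^sup>2 * (cmod (poly q (sample i)))\<^sup>2)"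
    proof (rule sum_mono)
      fix i
      have "poly ([:- c, 1:] * q) (sample i) = (sample i - c) * poly q (sample i)" by (simp add: algebra_simps)
      then show "(cmod (poly ([:- c, 1:] * q) (sample i)))\<^sup>2 \<le> r\<^sup>2 * (cmod (poly q (sample i)))\<^sup>2"
        using mult_right_mono[OF c2[of i]] by (simp only: norm_mult power_mult_distrib) simp
    qed
    have "(nm ([:- c, 1:] * q))\<^sup>2 = (hnorm H (op_shift H A c y))\<^sup>2 + \<epsilon> * (\<Sum>i<m. (cmod (poly ([:- c, 1:] * q) (sample i)))\<^sup>2)"
      unfolding nm_square reg_form_self[OF x] op_poly_linear_factor[OF x] y_def ..
    also have "\<dots> \<le> (r * hnorm H y)\<^sup>2 + \<epsilon> * (\<Sum>i<m. r\<^sup>2 * (cmod (poly q (sample i)))\<^sup>2)"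
      using 1 2 \<epsilon> by (intro add_mono mult_left_mono) auto
    also have "\<dots> = r\<^sup>2 * ((hnorm H y)\<^sup>2 + \<epsilon> * (\<Sum>i<m. (cmod (poly q (sample i)))\<^sup>2))"
      by (simp only: power_mult_distrib sum_distrib_left[symmetric] distrib_left mult.left_commute)
    also have "\<dots> = (r * nm q)\<^sup>2"
      unfolding power_mult_distrib nm_square reg_form_self[OF x] y_def ..
    finally show "nm ([:- c, 1:] * q) \<le> 1 / sin \<alpha> * nm q"
      unfolding r_def[symmetric] by (rule power2_le_imp_le) (use r in simp)
  qed (use \<alpha> in auto)
qed

lemma reg_form_evaluation:
  assumes x: "x \<in> carrier H" and \<epsilon>: "\<epsilon> > 0"
  shows "\<exists>C. \<forall>q. Polynomial.degree q < m \<longrightarrow> cmod (poly q z) \<le> C * sqrt (Re (reg_form x m \<epsilon> q q))"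
proof -
  have inj: "inj_on sample {..<m}" by (auto simp: inj_on_def sample_def)
  define C where "C = (\<Sum>j<m. sqrt (1 / \<epsilon>) * cmod (poly (lagrange m sample j) z))"
  have "cmod (poly q z) \<le> C * sqrt (Re (reg_form x m \<epsilon> q q))" if q: "Polynomial.degree q < m" for q
  proof -
    have at: "cmod (poly q (sample j)) \<le> sqrt (1 / \<epsilon>) * sqrt (Re (reg_form x m \<epsilon> q q))" if "j < m" for j
    proof -
      have "(cmod (poly q (sample j)))\<^sup>2 \<le> (\<Sum>i<m. (cmod (poly q (sample i)))\<^sup>2)"
        using that by (intro member_le_sum) auto
      also have "\<dots> \<le> 1 / \<epsilon> * Re (reg_form x m \<epsilon> q q)"
      proof -
        define S where "S = (\<Sum>i<m. (cmod (poly q (sample i)))\<^sup>2)"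
        have "1 / \<epsilon> * (\<epsilon> * S) \<le> 1 / \<epsilon> * ((hnorm H (op_poly H q A x))\<^sup>2 + \<epsilon> * S)"
          using \<epsilon> by (intro mult_left_mono) auto
        then show ?thesis using \<epsilon> unfolding reg_form_self[OF x] S_def by simp
      qed
      finally have "sqrt ((cmod (poly q (sample j)))\<^sup>2) \<le> sqrt (1 / \<epsilon> * Re (reg_form x m \<epsilon> q q))"
        by (rule real_sqrt_le_mono)
      then show ?thesis unfolding real_sqrt_mult by simp
    qed
    have "poly q z = (\<Sum>j<m. poly q (sample j) * poly (lagrange m sample j) z)"
      by (subst interp_poly[OF inj q, symmetric]) (simp add: interp_def poly_sum)
    also have "cmod \<dots> \<le> (\<Sum>j<m. (sqrt (1 / \<epsilon>) * sqrt (Re (reg_form x m \<epsilon> q q))) * cmod (poly (lagrange m sample j) z))"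
      by (rule order_trans[OF norm_sum sum_mono]) (use at in \<open>auto simp: norm_mult intro!: mult_right_mono\<close>)
    also have "\<dots> = C * sqrt (Re (reg_form x m \<epsilon> q q))"
      unfolding C_def sum_distrib_right by (intro sum.cong refl) (simp only: mult_ac)
    finally show ?thesis .
  qed
  then show ?thesis by blast
qed

text \<open>First the regularization \<open>\<epsilon>\<close> tends to 0 for a fixed contraction \<open>\<rho>\<close>, then \<open>\<rho>\<close> tends to 1.\<close>

theorem polynomial_operator_bound:
  assumes x: "x \<in> carrier H" and \<alpha>: "0 < \<alpha>" "\<alpha> \<le> pi / 2"
    and disc: "op_norm H (op_shift H A (\<i> * of_real (cot \<alpha>))) \<le> 1 / sin \<alpha>"
      "op_norm H (op_shift H A (- (\<i> * of_real (cot \<alpha>)))) \<le> 1 / sin \<alpha>"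
    and p: "\<And>z. z \<in> lens \<alpha> \<Longrightarrow> cmod (poly p z) \<le> M" and M: "M > 0"
  shows "hnorm H (op_poly H p A x) \<le> K25 \<alpha> * M * hnorm H x"
proof -
  define m where "m = Suc (Polynomial.degree p)"
  have K: "K25 \<alpha> \<ge> 0" by (rule K25_nonneg[OF \<alpha>])
  define dil where "dil = (\<lambda>\<rho>. pcompose p [:0, complex_of_real \<rho>:])"
  have reg: "(hnorm H (op_poly H (dil \<rho>) A x))\<^sup>2 \<le> (K25 \<alpha> * M)\<^sup>2 * ((hnorm H x)\<^sup>2 + \<epsilon> * real m)"
    if \<rho>: "0 < \<rho>" "\<rho> < 1" and \<epsilon>: "\<epsilon> > 0" for \<rho> \<epsilon>
  proof -
    interpret F: lens_form "reg_form x m \<epsilon>" \<alpha> by (rule lens_form_operator[OF x \<alpha> \<epsilon> disc])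
    have "F.nm (dil \<rho>) \<le> K25 \<alpha> * M * F.nm 1"
      unfolding dil_def
    proof (rule F.dilated_polynomial_bound[where m = m])
      show "\<exists>C. \<forall>q. Polynomial.degree q < m \<longrightarrow> cmod (poly q z) \<le> C * F.nm q" for z
        unfolding F.nm_def by (rule reg_form_evaluation[OF x \<epsilon>])
    qed (use p M \<rho> in \<open>auto simp: m_def\<close>)
    then have "(F.nm (dil \<rho>))\<^sup>2 \<le> (K25 \<alpha> * M * F.nm 1)\<^sup>2" by (rule power_mono) simp
    then have "Re (reg_form x m \<epsilon> (dil \<rho>) (dil \<rho>)) \<le> (K25 \<alpha> * M)\<^sup>2 * Re (reg_form x m \<epsilon> 1 1)"
      unfolding power_mult_distrib[of _ "F.nm 1"] F.nm_square .
    moreover have "(hnorm H (op_poly H (dil \<rho>) A x))\<^sup>2 \<le> Re (reg_form x m \<epsilon> (dil \<rho>) (dil \<rho>))"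
      unfolding reg_form_self[OF x] using \<epsilon> by (simp add: sum_nonneg)
    moreover have "Re (reg_form x m \<epsilon> 1 1) = (hnorm H x)\<^sup>2 + \<epsilon> * real m"
      unfolding reg_form_self[OF x] by (simp add: op_poly_one[OF x])
    ultimately show ?thesis by simp
  qed
  have dilated: "hnorm H (op_poly H (dil \<rho>) A x) \<le> K25 \<alpha> * M * hnorm H x" if \<rho>: "0 < \<rho>" "\<rho> < 1" for \<rho>
  proof (rule power2_le_imp_le)
    have "(hnorm H (op_poly H (dil \<rho>) A x))\<^sup>2 \<le> (K25 \<alpha> * M)\<^sup>2 * ((hnorm H x)\<^sup>2 + 0 * real m)"
    proof (rule tendsto_lowerbound)
      show "((\<lambda>\<epsilon>. (K25 \<alpha> * M)\<^sup>2 * ((hnorm H x)\<^sup>2 + \<epsilon> * real m)) \<longlongrightarrow> (K25 \<alpha> * M)\<^sup>2 * ((hnorm H x)\<^sup>2 + 0 * real m)) (at_right 0)"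
        by (intro tendsto_intros)
      show "\<forall>\<^sub>F \<epsilon> in at_right 0. (hnorm H (op_poly H (dil \<rho>) A x))\<^sup>2 \<le> (K25 \<alpha> * M)\<^sup>2 * ((hnorm H x)\<^sup>2 + \<epsilon> * real m)"
        using eventually_at_right_less[of "0::real"] by eventually_elim (rule reg[OF \<rho>])
    qed simp
    then show "(hnorm H (op_poly H (dil \<rho>) A x))\<^sup>2 \<le> (K25 \<alpha> * M * hnorm H x)\<^sup>2"
      by (simp add: power_mult_distrib)
  qed (use K M hnorm_nonneg[OF x] in simp)
  interpret P: poly_form "\<lambda>p q. ip H (op_poly H p A x) (op_poly H q A x)" by (rule poly_form_operator[OF x])
  have Pnm: "P.nm q = hnorm H (op_poly H q A x)" for q by (simp add: P.nm_def hnorm_def)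
  have "((\<lambda>\<rho>. P.nm (p - dil \<rho>)) \<longlongrightarrow> 0) (at_left 1)"
  proof (rule P.tendsto_nm_zero)
    show "Polynomial.degree (p - dil \<rho>) \<le> Polynomial.degree p" for \<rho>
      by (intro degree_diff_le) (auto simp: dil_def degree_pcompose)
    have "((\<lambda>\<rho>. Polynomial.coeff p i - of_real \<rho> ^ i * Polynomial.coeff p i) \<longlongrightarrow>
        Polynomial.coeff p i - of_real 1 ^ i * Polynomial.coeff p i) (at_left 1)" for i
      by (intro tendsto_intros)
    then show "((\<lambda>\<rho>. Polynomial.coeff (p - dil \<rho>) i) \<longlongrightarrow> 0) (at_left 1)" for i
      by (simp add: dil_def coeff_pcompose_linear)
  qed
  then have lim: "((\<lambda>\<rho>. P.nm (p - dil \<rho>) + K25 \<alpha> * M * hnorm H x) \<longlongrightarrow> 0 + K25 \<alpha> * M * hnorm H x) (at_left 1)"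
    by (intro tendsto_intros)
  have "P.nm p \<le> 0 + K25 \<alpha> * M * hnorm H x"
  proof (rule tendsto_lowerbound[OF lim])
    have "\<forall>\<^sub>F \<rho> in at_left (1::real). \<rho> \<in> {0<..<1}" by (rule eventually_at_left_real) simp
    then show "\<forall>\<^sub>F \<rho> in at_left 1. P.nm p \<le> P.nm (p - dil \<rho>) + K25 \<alpha> * M * hnorm H x"
    proof eventually_elim
      case (elim \<rho>)
      then have "P.nm (dil \<rho>) \<le> K25 \<alpha> * M * hnorm H x" using dilated[of \<rho>] by (simp add: Pnm)
      then show ?case using P.nm_triangle[of "p - dil \<rho>" "dil \<rho>"] by simp
    qed
  qed simp
  then show ?thesis by (simp add: Pnm)
qed

end

theorem lens_const_le_K25:
  fixes \<alpha> :: real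
  assumes \<alpha>: "0 < \<alpha>" "\<alpha> \<le> pi / 2"
  shows "lens_const TYPE('u) \<alpha> \<le> ereal (K25 \<alpha>)"
proof -
  have K: "K25 \<alpha> \<ge> 0" by (rule K25_nonneg[OF \<alpha>])
  have "ereal (op_norm H (op_poly H p A) / (SUP z\<in>lens \<alpha>. cmod (poly p z))) \<le> ereal (K25 \<alpha>)"
    if "(H, A) \<in> lens_operators \<alpha>" for H :: "'u complex_inner_space" and A p
  proof -
    have HA: "complex_hilbert_space H" "bounded_operator H A"
      "op_norm H (op_shift H A (\<i> * complex_of_real (cot \<alpha>))) \<le> 1 / sin \<alpha>"
      "op_norm H (op_shift H A (- (\<i> * complex_of_real (cot \<alpha>)))) \<le> 1 / sin \<alpha>"
      using that by (auto simp: lens_operators_def)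
    interpret hilbert_operator H A
      using HA(1,2) by (simp add: hilbert_operator_def hilbert_operator_axioms_def)
    define M where "M = (SUP z\<in>lens \<alpha>. cmod (poly p z))"
    have M: "cmod (poly p z) \<le> M" if "z \<in> lens \<alpha>" for z
      unfolding M_def by (rule cSUP_upper[OF that bdd_above_poly_lens])
    have "0 \<in> lens \<alpha>" using sin_cot(2,4)[OF \<alpha>] by (simp add: lens_def norm_mult)
    then have M0: "M \<ge> 0" using M[of 0] norm_ge_zero[of "poly p 0"] by linarith
    have "op_norm H (op_poly H p A) / M \<le> K25 \<alpha>"
    proof (cases "M = 0")
      case False
      then have pos: "M > 0" using M0 by simp
      have "op_norm H (op_poly H p A) \<le> K25 \<alpha> * M"
        by (rule op_norm_le[OF polynomial_operator_bound[OF _ \<alpha> HA(3,4) M pos]]) (use K pos in auto)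
      then show ?thesis using pos by (simp add: pos_divide_le_eq)
    qed (use K in simp)
    then show ?thesis by (simp add: M_def)
  qed
  then show ?thesis
    unfolding lens_const_def by (intro SUP_least) (auto intro!: SUP_least)
qed


section \<open>Extremal polynomials on the lens\<close>

lemma holomorphic_polynomial_approx:
  assumes hol: "f holomorphic_on ball 0 R" and "r < R" "0 < r" "e > 0"
  obtains q :: "complex poly" where "\<And>z. z \<in> cball 0 r \<Longrightarrow> cmod (f z - poly q z) \<le> e"
proof -
  define a where "a = (\<lambda>n. (deriv ^^ n) f 0 / fact n)"
  have sums: "(\<lambda>n. a n * z ^ n) sums f z" if "z \<in> ball 0 R" for z
    using holomorphic_power_series[OF hol that] by (simp add: a_def)
  define \<rho> where "\<rho> = (r + R) / 2"
  have \<rho>: "r < \<rho>" "\<rho> < R" using assms by (auto simp: \<rho>_def field_simps)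
  have "summable (\<lambda>n. a n * of_real \<rho> ^ n)"
    using sums[of "of_real \<rho>"] \<rho> assms(3) by (auto simp: sums_iff)
  then have "ereal \<rho> \<le> conv_radius a"
    using conv_radius_geI[of a "of_real \<rho>"] \<rho> assms(3) by simp
  moreover have "ereal r < ereal \<rho>" using \<rho>(1) by simp
  ultimately have "ereal r < conv_radius a" by (rule less_le_trans[rotated])
  then have "uniform_limit (cball 0 r) (\<lambda>n x. \<Sum>i<n. a i * (x - 0) ^ i) (\<lambda>x. suminf (\<lambda>i. a i * (x - 0) ^ i)) sequentially"
    by (rule powser_uniform_limit)
  then have "\<forall>\<^sub>F n in sequentially. \<forall>x\<in>cball 0 r. dist (\<Sum>i<n. a i * (x - 0) ^ i) (suminf (\<lambda>i. a i * (x - 0) ^ i)) < e"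
    using \<open>e > 0\<close> by (rule uniform_limitD)
  from eventually_happens'[OF sequentially_bot this]
  obtain n where n: "\<forall>x\<in>cball 0 r. dist (\<Sum>i<n. a i * (x - 0) ^ i) (suminf (\<lambda>i. a i * (x - 0) ^ i)) < e" ..
  define q where "q = (\<Sum>i<n. Polynomial.monom (a i) i)"
  show thesis
  proof (rule that[of q])
    fix z :: complex assume z: "z \<in> cball 0 r"
    have "suminf (\<lambda>i. a i * z ^ i) = f z" using sums[of z] z assms(2) by (auto simp: sums_iff)
    moreover have "poly q z = (\<Sum>i<n. a i * z ^ i)" by (simp add: q_def poly_sum poly_monom)
    ultimately have "dist (poly q z) (f z) < e" using bspec[OF n z] by simp
    then show "cmod (f z - poly q z) \<le> e" by (simp add: dist_norm norm_minus_commute)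
  qed
qed

text \<open>A geometric series: \<open>1 / (w + 1) = (1 / (M + 1)) / (1 - x)\<close> with \<open>x = (M - w) / (M + 1)\<close>.  On the
  part of the right half-plane in question, \<open>\<bar>M - w\<bar>\<^sup>2 \<le> M\<^sup>2 + R\<^sup>2\<close>, so the choice \<open>M = R\<^sup>2\<close> bounds \<open>\<bar>x\<bar>\<close> by a
  constant below 1.\<close>

lemma half_plane_inverse_approx:
  assumes "R > 0" "e > 0"
  obtains g :: "complex poly" where
    "\<And>w. 0 \<le> Re w \<Longrightarrow> cmod w \<le> R \<Longrightarrow> cmod (1 / (w + 1) - poly g w) \<le> e"
proof -
  define M where "M = R\<^sup>2"
  have M: "M > 0" using assms by (simp add: M_def)
  define \<theta> where "\<theta> = sqrt (M\<^sup>2 + M) / (M + 1)"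
  have \<theta>: "0 \<le> \<theta>" "\<theta> < 1"
  proof -
    show "0 \<le> \<theta>" using M by (simp add: \<theta>_def)
    have "sqrt (M\<^sup>2 + M) < sqrt ((M + 1)\<^sup>2)"
      using M by (intro real_sqrt_less_mono) (simp add: power2_eq_square algebra_simps)
    then show "\<theta> < 1" using M by (simp add: \<theta>_def)
  qed
  have "(\<lambda>n. \<theta> ^ n) \<longlonglongrightarrow> 0" using \<theta> by (intro LIMSEQ_power_zero) auto
  then have "\<forall>\<^sub>F n in sequentially. \<theta> ^ n < e" using assms(2) by (rule order_tendstoD(2))
  from eventually_happens'[OF sequentially_bot this] obtain n where n: "\<theta> ^ n < e" ..
  define b where "b = complex_of_real (M + 1)"
  have b: "b \<noteq> 0" "cmod b = M + 1" using M by (auto simp: b_def simp del: of_real_add)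
  define g where "g = (\<Sum>i<n. Polynomial.smult (1 / b) ([: of_real M / b, - 1 / b :] ^ i))"
  show thesis
  proof (rule that[of g])
    fix w :: complex assume w: "0 \<le> Re w" "cmod w \<le> R"
    define x where "x = (of_real M - w) / b"
    have x: "cmod x \<le> \<theta>"
    proof -
      have "(cmod (of_real M - w))\<^sup>2 = M\<^sup>2 - 2 * M * Re w + (cmod w)\<^sup>2"
        by (simp add: cmod_power2 power2_diff algebra_simps)
      also have "\<dots> \<le> M\<^sup>2 + M"
      proof -
        have "(cmod w)\<^sup>2 \<le> M" unfolding M_def by (rule power_mono[OF w(2)]) simp
        moreover have "0 \<le> 2 * M * Re w" using w(1) M by (intro mult_nonneg_nonneg) auto
        ultimately show ?thesis by linarith
      qed
      finally have "cmod (of_real M - w) \<le> sqrt (M\<^sup>2 + M)" by (rule real_le_rsqrt)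
      then show ?thesis using M by (simp add: x_def \<theta>_def norm_divide b(2) divide_right_mono)
    qed
    then have x1: "x \<noteq> 1" using \<theta>(2) by auto
    have w1: "cmod (w + 1) \<ge> 1" using w(1) abs_Re_le_cmod[of "w + 1"] by simp
    then have wne: "w + 1 \<noteq> 0" by auto
    have bx: "b * (1 - x) = w + 1" using b(1) by (simp add: x_def b_def right_diff_distrib)
    have "poly g w = 1 / b * (\<Sum>i<n. x ^ i)"
      by (simp add: g_def poly_sum poly_power x_def sum_distrib_left diff_divide_distrib mult.commute)
    also have "(\<Sum>i<n. x ^ i) = (1 - x ^ n) / (1 - x)"
      using x1 by (simp add: sum_gp_strict)
    also have "1 / b * ((1 - x ^ n) / (1 - x)) = (1 - x ^ n) / (w + 1)" by (simp add: bx[symmetric])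
    finally have "1 / (w + 1) - poly g w = x ^ n / (w + 1)" by (simp add: diff_divide_distrib)
    then have "cmod (1 / (w + 1) - poly g w) = cmod x ^ n / cmod (w + 1)" by (simp add: norm_divide norm_power)
    also have "\<dots> \<le> cmod x ^ n / 1" using w1 by (intro divide_left_mono) auto
    also have "\<dots> \<le> \<theta> ^ n" using x by (simp add: power_mono)
    also have "\<dots> \<le> e" using n by simp
    finally show "cmod (1 / (w + 1) - poly g w) \<le> e" .
  qed
qed

lemma lens_subset_unit_disc:
  assumes \<alpha>: "0 < \<alpha>" "\<alpha> \<le> pi / 2" and z: "z \<in> lens \<alpha>"
  shows "cmod z \<le> 1"
proof -
  define h where "h = cot \<alpha>"
  have "(cmod (z - \<i> * of_real h))\<^sup>2 \<le> (1 / sin \<alpha>)\<^sup>2" "(cmod (z + \<i> * of_real h))\<^sup>2 \<le> (1 / sin \<alpha>)\<^sup>2"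
    using z by (auto simp: lens_def h_def intro!: power_mono)
  moreover have "(cmod (z - \<i> * of_real h))\<^sup>2 + (cmod (z + \<i> * of_real h))\<^sup>2 = 2 * (cmod z)\<^sup>2 + 2 * h\<^sup>2"
    unfolding cmod_power2 by (simp add: power2_eq_square algebra_simps)
  ultimately have "(cmod z)\<^sup>2 \<le> 1" using sin_cot(3)[OF \<alpha>] by (simp add: h_def)
  then show ?thesis by (simp add: power2_le_imp_le[of "cmod z" 1])
qed

lemma ball_subset_lens:
  assumes \<alpha>: "0 < \<alpha>" "\<alpha> \<le> pi / 2" and z: "cmod z \<le> 1 / sin \<alpha> - cot \<alpha>"
  shows "z \<in> lens \<alpha>"
proof -
  have "cmod (\<i> * complex_of_real (cot \<alpha>)) = cot \<alpha>" using sin_cot(2)[OF \<alpha>] by (simp add: norm_mult)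
  then show ?thesis
    using z norm_triangle_ineq4[of z "\<i> * of_real (cot \<alpha>)"] norm_triangle_ineq[of z "\<i> * of_real (cot \<alpha>)"]
    by (auto simp: lens_def)
qed

text \<open>The power \<open>((1 + s z) / (1 - s z))\<^sup>\<beta>\<close> with \<open>s = 1 / (1 + \<delta>)\<close>.  Writing the logarithm of the quotient as a
  difference of logarithms makes it visibly holomorphic on the disc of radius \<open>1 + \<delta>\<close>, which contains the lens.\<close>

definition lens_power :: "real \<Rightarrow> real \<Rightarrow> complex \<Rightarrow> complex" where
  "lens_power \<beta> \<delta> z = exp (of_real \<beta> * (Ln (1 + of_real \<delta> + z) - Ln (1 + of_real \<delta> - z)))"

lemma Re_pos_of_ball:
  fixes z :: complex
  shows "cmod z < 1 + \<delta> \<Longrightarrow> 0 < Re (1 + of_real \<delta> + z) \<and> 0 < Re (1 + of_real \<delta> - z)"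
  using abs_Re_le_cmod[of z] by (auto simp: abs_le_iff)

lemma holomorphic_lens_power:
  assumes "\<delta> > 0"
  shows "lens_power \<beta> \<delta> holomorphic_on ball 0 (1 + \<delta>)"
proof -
  have "1 + of_real \<delta> + z \<notin> \<real>\<^sub>\<le>\<^sub>0" "1 + of_real \<delta> - z \<notin> \<real>\<^sub>\<le>\<^sub>0" if "z \<in> ball 0 (1 + \<delta>)" for z :: complex
    using Re_pos_of_ball[of z \<delta>] that by (auto simp: complex_nonpos_Reals_iff)
  then show ?thesis unfolding lens_power_def by (intro holomorphic_intros) auto
qed

lemma lens_power_0: "lens_power \<beta> \<delta> 0 = 1"
  by (simp add: lens_power_def)

lemma deriv_lens_power_0:
  assumes "\<delta> > 0"
  shows "(lens_power \<beta> \<delta> has_field_derivative of_real (2 * \<beta> / (1 + \<delta>))) (at 0)"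
proof -
  have np: "1 + complex_of_real \<delta> \<notin> \<real>\<^sub>\<le>\<^sub>0" using assms by (auto simp: complex_nonpos_Reals_iff)
  have ne: "1 + complex_of_real \<delta> \<noteq> 0" using np by auto
  show ?thesis
    unfolding lens_power_def
    by (rule derivative_eq_intros refl | use np ne in \<open>simp add: field_simps\<close>)+
qed

text \<open>The point \<open>z / (1 + \<delta>)\<close> lies in the open lens, so the logarithm has imaginary part in
  \<open>(-\<alpha>, \<alpha>)\<close>, and multiplying it by \<open>\<pi> / (2\<alpha>)\<close> leaves it in \<open>(-\<pi>/2, \<pi>/2)\<close>.\<close>

lemma Re_lens_power_pos:
  assumes \<alpha>: "0 < \<alpha>" "\<alpha> \<le> pi / 2" and \<delta>: "\<delta> > 0" and z: "z \<in> lens \<alpha>"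
  shows "0 < Re (lens_power (pi / (2 * \<alpha>)) \<delta> z)"
proof -
  note sc = sin_cot[OF \<alpha>]
  define s where "s = 1 / (1 + \<delta>)"
  have s: "0 < s" "s < 1" using \<delta> by (auto simp: s_def)
  have z1: "cmod z < 1 + \<delta>" using lens_subset_unit_disc[OF \<alpha> z] \<delta> by linarith
  have shrink: "cmod (of_real s * z - c) < 1 / sin \<alpha>" if c: "cmod c = cot \<alpha>" "cmod (z - c) \<le> 1 / sin \<alpha>" for c
  proof -
    have "of_real s * z - c = of_real s * (z - c) - of_real (1 - s) * c" by (simp add: algebra_simps)
    then have "cmod (of_real s * z - c) \<le> s * cmod (z - c) + (1 - s) * cot \<alpha>"
      using norm_triangle_ineq4[of "of_real s * (z - c)" "of_real (1 - s) * c"] s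
      by (simp add: norm_mult c(1) del: of_real_diff)
    also have "\<dots> \<le> s * (1 / sin \<alpha>) + (1 - s) * cot \<alpha>" using s c(2) by (intro add_right_mono mult_left_mono) auto
    also have "\<dots> < s * (1 / sin \<alpha>) + (1 - s) * (1 / sin \<alpha>)" using s sc(4) by (intro add_strict_left_mono mult_strict_left_mono) auto
    also have "\<dots> = 1 / sin \<alpha>" unfolding distrib_right[symmetric] by simp
    finally show ?thesis .
  qed
  have "cmod (of_real s * z - \<i> * of_real (cot \<alpha>)) < 1 / sin \<alpha>"
    using z sc(2) by (intro shrink) (auto simp: lens_def norm_mult)
  moreover have "cmod (of_real s * z - (- (\<i> * of_real (cot \<alpha>)))) < 1 / sin \<alpha>"
    using z sc(2) by (intro shrink) (auto simp: lens_def norm_mult)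
  ultimately obtain \<zeta> where \<zeta>: "\<zeta> \<in> strip \<alpha>" "exp \<zeta> = (1 + of_real s * z) / (1 - of_real s * z)"
    using open_lens_to_strip[OF \<alpha>, of "of_real s * z"] by auto
  define d where "d = 1 + complex_of_real \<delta>"
  have d: "d \<noteq> 0" "of_real s = 1 / d" using \<delta> by (auto simp: d_def s_def complex_eq_iff)
  have pos: "0 < Re (d + z)" "0 < Re (d - z)" using Re_pos_of_ball[OF z1] by (auto simp: d_def)
  have ne: "d + z \<noteq> 0" "d - z \<noteq> 0" using pos by (metis less_irrefl zero_complex.sel(1))+
  define u where "u = Ln (d + z) - Ln (d - z)"
  have "exp u = (d + z) / (d - z)" using ne by (simp add: u_def exp_diff)
  also have "\<dots> = exp \<zeta>"
  proof -
    have "1 + of_real s * z = (d + z) / d" "1 - of_real s * z = (d - z) / d" using d by (auto simp: field_simps)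
    then show ?thesis using d(1) by (simp add: \<zeta>(2))
  qed
  finally have "exp u = exp \<zeta>" .
  then obtain n :: int where n: "u = \<zeta> + of_int (2 * n) * pi * \<i>" using exp_eq by blast
  have "\<bar>Im (Ln (d + z))\<bar> < pi / 2" "\<bar>Im (Ln (d - z))\<bar> < pi / 2"
    using Re_Ln_pos_lt[OF ne(1)] Re_Ln_pos_lt[OF ne(2)] pos by blast+
  then have "\<bar>Im u\<bar> < pi" by (simp add: u_def)
  moreover have "\<bar>Im \<zeta>\<bar> < pi / 2" using \<zeta>(1) \<alpha> by (simp add: strip_def)
  moreover have "Im u = Im \<zeta> + of_int (2 * n) * pi" by (simp add: n)
  ultimately have "\<bar>of_int (2 * n) * pi\<bar> < 2 * pi" by linarith
  then have "\<bar>real_of_int n\<bar> * (2 * pi) < 1 * (2 * pi)" by (simp add: abs_mult)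
  then have "\<bar>real_of_int n\<bar> < 1" by (rule mult_right_less_imp_less) auto
  then have "n = 0" by linarith
  then have u: "u = \<zeta>" using n by simp
  have "\<bar>pi / (2 * \<alpha>) * Im \<zeta>\<bar> < pi / 2"
  proof -
    have "pi / (2 * \<alpha>) * \<bar>Im \<zeta>\<bar> < pi / (2 * \<alpha>) * \<alpha>" using \<zeta>(1) \<alpha> by (intro mult_strict_left_mono) (auto simp: strip_def)
    then show ?thesis using \<alpha>(1) by (simp add: abs_mult)
  qed
  then have "0 < cos (pi / (2 * \<alpha>) * Im \<zeta>)"
    unfolding abs_less_iff by (intro cos_gt_zero_pi) (simp_all only: minus_less_iff)
  then show ?thesis
    unfolding lens_power_def d_def[symmetric] u_def[symmetric] u by (simp add: Re_exp)
qed

text \<open>The target is \<open>f = (W - 1) / (W + 1) = 1 - 2 / (W + 1)\<close> for \<open>W = lens_power \<beta> \<delta>\<close>, which maps the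
  lens into the unit disc and has derivative \<open>\<beta> / (1 + \<delta>)\<close> at 0.  Composing a polynomial approximation of
  \<open>1 / (w + 1)\<close> with one of \<open>W\<close> gives \<open>p\<close>, and Cauchy's inequality on a disc inside the lens compares
  the derivatives at 0.\<close>

lemma lens_extremal_polynomial:
  assumes \<alpha>: "0 < \<alpha>" "\<alpha> \<le> pi / 2" and \<delta>: "\<delta> > 0" and e: "e > 0"
  obtains p :: "complex poly" where "\<And>z. z \<in> lens \<alpha> \<Longrightarrow> cmod (poly p z) \<le> 1 + e"
    "cmod (Polynomial.coeff p 1 - of_real (pi / (2 * \<alpha>) / (1 + \<delta>))) \<le> e"
proof -
  note sc = sin_cot[OF \<alpha>]
  define \<beta> where "\<beta> = pi / (2 * \<alpha>)"
  define W where "W = lens_power \<beta> \<delta>"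
  define \<rho> where "\<rho> = 1 / sin \<alpha> - cot \<alpha>"
  have \<rho>: "\<rho> > 0" using sc(4) by (simp add: \<rho>_def)
  have sub: "cball 0 \<rho> \<subseteq> lens \<alpha>" using ball_subset_lens[OF \<alpha>] by (auto simp: \<rho>_def)
  have sub2: "lens \<alpha> \<subseteq> cball 0 1" using lens_subset_unit_disc[OF \<alpha>] by auto
  have holW: "W holomorphic_on ball 0 (1 + \<delta>)" unfolding W_def by (rule holomorphic_lens_power[OF \<delta>])
  have contW: "continuous_on (lens \<alpha>) W"
    by (rule continuous_on_subset[OF holomorphic_on_imp_continuous_on[OF holW]]) (use sub2 \<delta> in force)
  have posW: "0 < Re (W z)" if "z \<in> lens \<alpha>" for z
    unfolding W_def \<beta>_def by (rule Re_lens_power_pos[OF \<alpha> \<delta> that])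
  have "0 \<in> lens \<alpha>" using sub \<rho> by auto
  then obtain z0 where z0: "z0 \<in> lens \<alpha>" "\<And>z. z \<in> lens \<alpha> \<Longrightarrow> Re (W z0) \<le> Re (W z)"
    using continuous_attains_inf[OF compact_lens, of \<alpha> "\<lambda>z. Re (W z)"] contW by (auto intro: continuous_intros)
  \<comment> \<open>The first bound keeps the polynomial close to \<open>W\<close> in the right half-plane; the second gives
    \<open>2\<eta> \<le> e\<close> for the values and \<open>4\<eta>/\<rho> \<le> e\<close> for the derivatives.\<close>
  define \<eta> where "\<eta> = min (Re (W z0)) (min 1 e * min 1 \<rho> / 4)"
  have \<eta>: "0 < \<eta>" "\<eta> \<le> Re (W z0)" "\<eta> \<le> min 1 e * min 1 \<rho> / 4"
    using posW[OF z0(1)] e \<rho> by (auto simp: \<eta>_def)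
  obtain q where "\<And>z. z \<in> cball 0 1 \<Longrightarrow> cmod (W z - poly q z) \<le> \<eta>"
    using holomorphic_polynomial_approx[OF holW, of 1 \<eta>] \<delta> \<eta>(1) by auto
  then have q: "cmod (W z - poly q z) \<le> \<eta>" if "z \<in> lens \<alpha>" for z using sub2 that by blast
  have posq: "0 \<le> Re (poly q z)" if "z \<in> lens \<alpha>" for z
    using q[OF that] abs_Re_le_cmod[of "W z - poly q z"] z0(2)[OF that] \<eta>(2) by (simp add: abs_le_iff)
  have "compact (poly q ` lens \<alpha>)" by (intro compact_continuous_image continuous_intros compact_lens)
  then obtain R0 where "\<forall>w\<in>poly q ` lens \<alpha>. cmod w \<le> R0" using compact_imp_bounded bounded_iff by metis
  then have R: "cmod (poly q z) \<le> max R0 1" if "z \<in> lens \<alpha>" for z using that by fastforce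
  obtain g where "\<forall>w. 0 \<le> Re w \<longrightarrow> cmod w \<le> max R0 1 \<longrightarrow> cmod (1 / (w + 1) - poly g w) \<le> \<eta>"
    by (rule half_plane_inverse_approx[of "max R0 1" \<eta>]) (use \<eta>(1) in auto)
  then have g: "\<And>w. 0 \<le> Re w \<Longrightarrow> cmod w \<le> max R0 1 \<Longrightarrow> cmod (1 / (w + 1) - poly g w) \<le> \<eta>" by blast
  define p where "p = 1 - Polynomial.smult 2 (pcompose g q)"
  have pp: "poly p z = 1 - 2 * poly g (poly q z)" for z by (simp add: p_def poly_pcompose)
  have gq: "cmod (1 / (poly q z + 1) - poly g (poly q z)) \<le> \<eta>" if "z \<in> lens \<alpha>" for z
    by (rule g[OF posq[OF that] R[OF that]])
  define f where "f = (\<lambda>z. 1 - 2 / (W z + 1))"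
  show thesis
  proof (rule that[of p])
    fix z assume z: "z \<in> lens \<alpha>"
    define w where "w = poly q z"
    have w: "0 \<le> Re w" using posq[OF z] by (simp add: w_def)
    have "(cmod (w - 1))\<^sup>2 \<le> (cmod (w + 1))\<^sup>2" 
      unfolding cmod_power2 using w by (simp add: power2_eq_square algebra_simps)
    then have le: "cmod (w - 1) \<le> cmod (w + 1)" by (rule power2_le_imp_le) simp
    have wne: "w + 1 \<noteq> 0" using w by (auto simp: complex_eq_iff)
    have "(w - 1) / (w + 1) = 1 - 2 * (1 / (w + 1))" using wne by (simp add: field_simps)
    then have "poly p z = (w - 1) / (w + 1) + 2 * (1 / (w + 1) - poly g w)"
      by (simp add: pp w_def[symmetric] right_diff_distrib)
    then have "cmod (poly p z) \<le> cmod ((w - 1) / (w + 1)) + cmod (2 * (1 / (w + 1) - poly g w))"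
      by (simp only: norm_triangle_ineq)
    also have "\<dots> \<le> 1 + 2 * \<eta>"
    proof (rule add_mono)
      show "cmod ((w - 1) / (w + 1)) \<le> 1" using le wne by (simp add: norm_divide divide_le_eq_1)
      have "cmod (1 / (w + 1) - poly g w) \<le> \<eta>" using gq[OF z] by (simp only: w_def)
      then show "cmod (2 * (1 / (w + 1) - poly g w)) \<le> 2 * \<eta>" by (simp only: norm_mult norm_numeral)
    qed
    also have "2 * \<eta> \<le> e"
    proof -
      have "min 1 e * min 1 \<rho> \<le> e * 1" using e \<rho> by (intro mult_mono) auto
      then show ?thesis using \<eta>(3) e by linarith
    qed
    finally show "cmod (poly p z) \<le> 1 + e" by simp
  next
    have fp: "cmod (poly p z - f z) \<le> 4 * \<eta>" if z: "z \<in> lens \<alpha>" for z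
    proof -
      define w where "w = poly q z"
      have w: "0 \<le> Re w" using posq[OF z] by (simp add: w_def)
      have n1: "1 \<le> cmod (w + 1)" "1 \<le> cmod (W z + 1)"
        using w posW[OF z] abs_Re_le_cmod[of "w + 1"] abs_Re_le_cmod[of "W z + 1"] by auto
      then have ne: "w + 1 \<noteq> 0" "W z + 1 \<noteq> 0" by auto
      have "poly p z - f z = 2 * (1 / (w + 1) - poly g w) + 2 * (1 / (W z + 1) - 1 / (w + 1))"
        by (simp add: pp f_def w_def)
      also have "1 / (W z + 1) - 1 / (w + 1) = (w - W z) / ((W z + 1) * (w + 1))"
        using ne by (simp add: divide_simps)
      finally have "cmod (poly p z - f z) \<le> cmod (2 * (1 / (w + 1) - poly g w)) + cmod (2 * ((w - W z) / ((W z + 1) * (w + 1))))"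
        by (simp only: norm_triangle_ineq)
      then have "cmod (poly p z - f z) \<le> 2 * cmod (1 / (w + 1) - poly g w) + 2 * cmod ((w - W z) / ((W z + 1) * (w + 1)))"
        by (simp only: norm_mult norm_numeral)
      moreover have "cmod ((w - W z) / ((W z + 1) * (w + 1))) \<le> \<eta>"
      proof -
        have "1 * 1 \<le> cmod (W z + 1) * cmod (w + 1)" using n1 by (intro mult_mono) auto
        then have "cmod (w - W z) / (cmod (W z + 1) * cmod (w + 1)) \<le> cmod (w - W z) / 1"
          by (intro divide_left_mono) auto
        then show ?thesis using q[OF z] by (simp add: norm_divide norm_mult w_def norm_minus_commute)
      qed
      moreover have "cmod (1 / (w + 1) - poly g w) \<le> \<eta>" using gq[OF z] by (simp only: w_def)
      ultimately show ?thesis by linarith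
    qed
    have W0: "W 0 = 1" by (simp add: W_def lens_power_0)
    define D where "D = complex_of_real (2 * \<beta> / (1 + \<delta>))"
    have dW: "(W has_field_derivative D) (at 0)"
      unfolding W_def D_def by (rule deriv_lens_power_0[OF \<delta>])
    have "(f has_field_derivative D / 2) (at 0)"
      unfolding f_def by (rule derivative_eq_intros refl dW | simp add: W0)+
    moreover have "D / 2 = of_real (\<beta> / (1 + \<delta>))"
    proof -
      have "D / 2 = of_real (2 * \<beta> / (1 + \<delta>) / 2)" by (simp only: D_def of_real_divide of_real_numeral)
      also have "2 * \<beta> / (1 + \<delta>) / 2 = \<beta> / (1 + \<delta>)"
      proof -
        have "2 * b / x / 2 = b / x" for b x :: real by simp
        then show ?thesis .
      qed
      finally show ?thesis .
    qed
    ultimately have df: "(f has_field_derivative of_real (\<beta> / (1 + \<delta>))) (at 0)" by simp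
    have dp: "(poly p has_field_derivative Polynomial.coeff p 1) (at 0)"
    proof -
      have "poly (pderiv p) 0 = Polynomial.coeff p 1"
        unfolding poly_0_coeff_0 coeff_pderiv by simp
      then show ?thesis using poly_DERIV[of p 0] by simp
    qed
    have "deriv (\<lambda>z. poly p z - f z) 0 = Polynomial.coeff p 1 - of_real (\<beta> / (1 + \<delta>))"
      by (rule DERIV_imp_deriv) (rule DERIV_diff[OF dp df])
    moreover have "cmod ((deriv ^^ 1) (\<lambda>z. poly p z - f z) 0) \<le> fact 1 * (4 * \<eta>) / \<rho> ^ 1"
    proof (rule Cauchy_inequality[OF _ _ \<rho>])
      have ne: "W z + 1 \<noteq> 0" if "z \<in> lens \<alpha>" for z using posW[OF that] by (auto simp: complex_eq_iff)
      have neb: "\<forall>z\<in>cball 0 \<rho>. W z + 1 \<noteq> 0" using ne sub by blast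
      have "continuous_on (cball 0 \<rho>) W" by (rule continuous_on_subset[OF contW sub])
      then show "continuous_on (cball 0 \<rho>) (\<lambda>z. poly p z - f z)"
        unfolding f_def using neb by (intro continuous_intros)
      have "ball (0 :: complex) \<rho> \<subseteq> ball 0 (1 + \<delta>)"
      proof
        fix z :: complex assume "z \<in> ball 0 \<rho>"
        then have "z \<in> cball 0 1" using sub sub2 ball_subset_cball by blast
        then show "z \<in> ball 0 (1 + \<delta>)" using \<delta> by simp
      qed
      then have "W holomorphic_on ball 0 \<rho>" by (rule holomorphic_on_subset[OF holW])
      moreover have "W z + 1 \<noteq> 0" if "z \<in> ball 0 \<rho>" for z using neb that ball_subset_cball by blast
      ultimately show "(\<lambda>z. poly p z - f z) holomorphic_on ball 0 \<rho>"
        unfolding f_def by (intro holomorphic_intros)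
      show "cmod (poly p x - f x) \<le> 4 * \<eta>" if "cmod (0 - x) = \<rho>" for x
      proof (rule fp)
        have "x \<in> cball 0 \<rho>" using that by simp
        then show "x \<in> lens \<alpha>" using sub by blast
      qed
    qed
    moreover have "4 * \<eta> / \<rho> \<le> e"
    proof -
      have "min 1 e * min 1 \<rho> \<le> e * \<rho>" using e \<rho> by (intro mult_mono) auto
      then have "4 * \<eta> \<le> e * \<rho>" using \<eta>(3) by linarith
      then show ?thesis using \<rho> by (simp add: pos_divide_le_eq)
    qed
    ultimately have "cmod (Polynomial.coeff p 1 - of_real (\<beta> / (1 + \<delta>))) \<le> e"
      by (simp only: funpow.simps One_nat_def o_apply id_apply power_one_right power_Suc0_right fact_Suc_0 mult_1)
    then show "cmod (Polynomial.coeff p 1 - of_real (pi / (2 * \<alpha>) / (1 + \<delta>))) \<le> e"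
      by (simp only: \<beta>_def)
  qed
qed


section \<open>A nilpotent operator on pairs of complex numbers\<close>

text \<open>The sets \<open>\<complex> \<times> \<complex>\<close> and \<open>\<complex>\<close> have the same cardinality.\<close>

lemma embed_complex_pairs:
  fixes \<iota> :: "complex \<Rightarrow> 'u"
  assumes "inj \<iota>"
  obtains e :: "complex \<times> complex \<Rightarrow> 'u" where "inj e"
proof -
  have "infinite (UNIV :: complex set)" by (rule infinite_UNIV_char_0)
  from card_of_ordIso[THEN iffD2, OF card_of_Times_same_infinite[OF this]]
  obtain f :: "complex \<times> complex \<Rightarrow> complex" where "bij_betw f (UNIV \<times> UNIV) UNIV" by blast
  then have "inj f" by (simp add: bij_betw_def)
  then show thesis using that[of "\<iota> \<circ> f"] assms inj_compose by blast
qed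

definition pair_scale :: "complex \<Rightarrow> complex \<times> complex \<Rightarrow> complex \<times> complex" where
  "pair_scale c p = (c * fst p, c * snd p)"

text \<open>The Hilbert space \<open>\<complex>\<^sup>2\<close>, transported along an injection \<open>e\<close>.\<close>

definition pair_space :: "(complex \<times> complex \<Rightarrow> 'u) \<Rightarrow> 'u complex_inner_space" where
  "pair_space e = \<lparr>carrier = range e, monoid.mult = (\<lambda>_ _. e 0), one = e 0, ring.zero = e 0,
     add = (\<lambda>x y. e (inv_into UNIV e x + inv_into UNIV e y)), module.smult = (\<lambda>c x. e (pair_scale c (inv_into UNIV e x))),
     ip = (\<lambda>x y. fst (inv_into UNIV e x) * cnj (fst (inv_into UNIV e y)) + snd (inv_into UNIV e x) * cnj (snd (inv_into UNIV e y)))\<rparr>"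

locale embedded_pairs =
  fixes e :: "complex \<times> complex \<Rightarrow> 'u"
  assumes inj_e: "inj e"
begin

abbreviation P :: "'u complex_inner_space" where "P \<equiv> pair_space e"

lemma inv_e [simp]: "inv_into UNIV e (e p) = p"
  by (rule inv_f_f[OF inj_e])

lemma P_simps:
  "carrier P = range e" "\<zero>\<^bsub>P\<^esub> = e 0" "e p \<oplus>\<^bsub>P\<^esub> e q = e (p + q)" "c \<odot>\<^bsub>P\<^esub> e p = e (pair_scale c p)"
  "ip P (e p) (e q) = fst p * cnj (fst q) + snd p * cnj (snd q)"
  by (simp_all add: pair_space_def)

lemma abelian_group_P: "abelian_group P"
proof (rule abelian_groupI)
  fix x assume "x \<in> carrier P"
  then obtain p where "x = e p" by (auto simp: P_simps)
  then show "\<exists>y\<in>carrier P. y \<oplus>\<^bsub>P\<^esub> x = \<zero>\<^bsub>P\<^esub>"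
    by (intro bexI[of _ "e (- p)"]) (auto simp: P_simps)
qed (auto simp: P_simps algebra_simps)

lemma module_P: "Module.module (ring_of_type_algebra :: complex ring) P"
proof (rule moduleI)
  show "cring (ring_of_type_algebra :: complex ring)" by (rule cring_from_type_algebra)
qed (auto simp: abelian_group_P P_simps ring_of_type_algebra_def pair_scale_def plus_prod_def algebra_simps)

lemma minus_P: "e p \<ominus>\<^bsub>P\<^esub> e q = e (p - q)"
proof -
  interpret abelian_group P by (rule abelian_group_P)
  have "\<ominus>\<^bsub>P\<^esub> e q = e (- q)"
    by (rule minus_equality) (auto simp: P_simps)
  then show ?thesis by (simp add: a_minus_def P_simps)
qed

lemma hnorm_P: "hnorm P (e p) = norm p"
  by (simp add: hnorm_def P_simps norm_prod_def complex_mult_cnj cmod_power2)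

lemma hilbert_P: "complex_hilbert_space P"
proof -
  interpret Module.module "ring_of_type_algebra :: complex ring" P by (rule module_P)
  show ?thesis
  proof
    fix s :: "nat \<Rightarrow> 'u"
    assume s: "range s \<subseteq> carrier P" and cauchy: "\<forall>\<epsilon>>0. \<exists>N. \<forall>m\<ge>N. \<forall>n\<ge>N. hnorm P (s m \<ominus>\<^bsub>P\<^esub> s n) < \<epsilon>"
    define t where "t = (\<lambda>n. inv_into UNIV e (s n))"
    have "s n \<in> range e" for n using s by (auto simp: P_simps)
    then have st: "s n = e (t n)" for n by (simp add: t_def f_inv_into_f)
    have "Cauchy t"
      unfolding Cauchy_def dist_norm using cauchy by (simp only: st minus_P hnorm_P)
    then obtain l where "t \<longlonglongrightarrow> l" using Cauchy_convergent convergent_def by blast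
    then have "(\<lambda>n. norm (t n - l)) \<longlonglongrightarrow> 0" using LIM_zero tendsto_norm_zero by blast
    then show "\<exists>l\<in>carrier P. (\<lambda>n. hnorm P (s n \<ominus>\<^bsub>P\<^esub> l)) \<longlonglongrightarrow> 0"
      by (intro bexI[of _ "e l"]) (simp_all add: st minus_P hnorm_P P_simps)
  next
    fix x assume "x \<in> carrier P" "ip P x x = 0"
    then obtain p where p: "x = e p" by (auto simp: P_simps)
    have "hnorm P x = 0" using \<open>ip P x x = 0\<close> by (simp add: hnorm_def)
    then show "x = \<zero>\<^bsub>P\<^esub>" by (simp add: p hnorm_P P_simps)
  next
    fix x assume "x \<in> carrier P"
    then show "0 \<le> Re (ip P x x)" by (auto simp: P_simps complex_mult_cnj)
  qed (auto simp: P_simps pair_scale_def algebra_simps)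
qed

definition nilpotent :: "real \<Rightarrow> 'u \<Rightarrow> 'u" where
  "nilpotent s x = e (of_real s * snd (inv_into UNIV e x), 0)"

lemma nilpotent_e: "nilpotent s (e (a, b)) = e (of_real s * b, 0)"
  by (simp add: nilpotent_def)

lemma norm_pair_square: "(norm (a, b :: complex))\<^sup>2 = (cmod a)\<^sup>2 + (cmod b)\<^sup>2" for a :: complex
  by (simp add: norm_prod_def)

lemma bounded_nilpotent: "bounded_operator P (nilpotent s)"
  unfolding bounded_operator_def
proof (intro conjI)
  show "\<exists>K. \<forall>x\<in>carrier P. hnorm P (nilpotent s x) \<le> K * hnorm P x"
  proof (intro exI[of _ "\<bar>s\<bar>"] ballI)
    fix x assume "x \<in> carrier P"
    then obtain a b where x: "x = e (a, b)" by (auto simp: P_simps)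
    have "\<bar>s\<bar> * cmod b \<le> \<bar>s\<bar> * norm (a, b)" using norm_snd_le[of b a] by (intro mult_left_mono) auto
    then show "hnorm P (nilpotent s x) \<le> \<bar>s\<bar> * hnorm P x"
      by (simp add: x nilpotent_e hnorm_P norm_prod_def norm_mult)
  qed
qed (auto simp: P_simps nilpotent_def pair_scale_def distrib_left mult_ac)

text \<open>Put \<open>s = sin \<alpha>\<close> and \<open>h = cot \<alpha>\<close>.  Because \<open>(s h)\<^sup>2 = 1 - s\<^sup>2\<close>, the difference of the two sides of the
  squared estimate is at least a square.\<close>

lemma nilpotent_in_lens_operators:
  assumes \<alpha>: "0 < \<alpha>" "\<alpha> \<le> pi / 2"
  shows "(P, nilpotent (sin \<alpha>)) \<in> lens_operators \<alpha>"
proof -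
  note sc = sin_cot[OF \<alpha>]
  define s h where "s = sin \<alpha>" and "h = cot \<alpha>"
  have sh: "s > 0" "h \<ge> 0" "1 + h\<^sup>2 = (1 / s)\<^sup>2" using sc by (auto simp: s_def h_def)
  have sh2: "(s * h)\<^sup>2 = 1 - s\<^sup>2"
  proof -
    have "s\<^sup>2 * (1 + h\<^sup>2) = 1" unfolding sh(3) using sh(1) by (simp add: power_divide)
    then show ?thesis by (simp add: power_mult_distrib algebra_simps)
  qed
  interpret complex_hilbert_space P by (rule hilbert_P)
  have "op_norm P (op_shift P (nilpotent s) c) \<le> 1 / s" if c: "cmod c = h" for c
  proof (rule op_norm_le)
    fix x assume "x \<in> carrier P"
    then obtain a b where x: "x = e (a, b)" by (auto simp: P_simps)
    define u v where "u = cmod a" and "v = cmod b"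
    have eq: "op_shift P (nilpotent s) c x = e (of_real s * b - c * a, - (c * b))"
      by (simp add: op_shift_def x nilpotent_e P_simps pair_scale_def minus_P)
    show "hnorm P (op_shift P (nilpotent s) c x) \<le> 1 / s * hnorm P x"
    proof (rule power2_le_imp_le)
      have "cmod (of_real s * b - c * a) \<le> s * v + h * u"
        using norm_triangle_ineq4[of "of_real s * b" "c * a"] sh(1) by (simp add: norm_mult c u_def v_def)
      then have "(cmod (of_real s * b - c * a))\<^sup>2 \<le> (s * v + h * u)\<^sup>2" by (rule power_mono) simp
      then have "(hnorm P (op_shift P (nilpotent s) c x))\<^sup>2 \<le> (s * v + h * u)\<^sup>2 + (h * v)\<^sup>2"
        by (simp add: eq hnorm_P norm_pair_square norm_mult c v_def)
      also have "\<dots> \<le> (1 + h\<^sup>2) * (u\<^sup>2 + v\<^sup>2)"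
      proof -
        have "(1 + h\<^sup>2) * (u\<^sup>2 + v\<^sup>2) - ((s * v + h * u)\<^sup>2 + (h * v)\<^sup>2)
            = u\<^sup>2 + (1 - s\<^sup>2) * v\<^sup>2 - 2 * (s * h) * (u * v)"
          by (simp add: power2_eq_square algebra_simps)
        also have "\<dots> = (u - (s * h) * v)\<^sup>2"
          unfolding sh2[symmetric] by (simp add: power2_eq_square algebra_simps)
        finally show ?thesis using zero_le_power2[of "u - (s * h) * v"] by linarith
      qed
      also have "\<dots> = (1 / s * hnorm P x)\<^sup>2"
        unfolding sh(3) power_mult_distrib by (simp add: x hnorm_P norm_pair_square u_def v_def)
      finally show "(hnorm P (op_shift P (nilpotent s) c x))\<^sup>2 \<le> (1 / s * hnorm P x)\<^sup>2" .
    qed (use sh(1) in \<open>simp add: x hnorm_P\<close>)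
  qed (use sh(1) in simp)
  moreover have "cmod (\<i> * of_real h) = h" "cmod (- (\<i> * of_real h)) = h" using sh(2) by (simp_all add: norm_mult)
  ultimately show ?thesis
    by (simp add: lens_operators_def hilbert_P bounded_nilpotent s_def[symmetric] h_def[symmetric])
qed

lemma op_poly_nilpotent:
  "op_poly P p (nilpotent s) (e (a, b)) =
    e (Polynomial.coeff p 0 * a + Polynomial.coeff p 1 * (of_real s * b), Polynomial.coeff p 0 * b)"
proof -
  interpret hilbert_operator P "nilpotent s"
    using hilbert_P bounded_nilpotent by (simp add: hilbert_operator_def hilbert_operator_axioms_def)
  have x: "e (a, b) \<in> carrier P" by (simp add: P_simps)
  show ?thesis
  proof (induction p)
    case 0
    have "op_poly P (Polynomial.smult 0 1) (nilpotent s) (e (a, b)) = e (pair_scale 0 (a, b))"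
      by (simp only: op_poly_smult[OF x] op_poly_one[OF x] P_simps)
    then show ?case by (simp add: pair_scale_def)
  next
    case (pCons c p)
    have "pCons c p = Polynomial.smult c 1 + pCons 0 p" by (simp add: one_pCons)
    then have "op_poly P (pCons c p) (nilpotent s) (e (a, b))
        = c \<odot>\<^bsub>P\<^esub> e (a, b) \<oplus>\<^bsub>P\<^esub> nilpotent s (op_poly P p (nilpotent s) (e (a, b)))"
      by (simp only: op_poly_add[OF x] op_poly_smult[OF x] op_poly_one[OF x] op_poly_pCons[OF x])
    also have "\<dots> = e (c * a + of_real s * (Polynomial.coeff p 0 * b), c * b)"
      unfolding pCons.IH by (simp add: nilpotent_e P_simps pair_scale_def)
    finally show ?case by (simp add: mult_ac)
  qed
qed

lemma op_norm_poly_nilpotent: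
  assumes "s \<ge> 0"
  shows "s * cmod (Polynomial.coeff p 1) \<le> op_norm P (op_poly P p (nilpotent s))"
proof -
  interpret hilbert_operator P "nilpotent s"
    using hilbert_P bounded_nilpotent by (simp add: hilbert_operator_def hilbert_operator_axioms_def)
  define T where "T = op_poly P p (nilpotent s)"
  define K where "K = 2 * cmod (Polynomial.coeff p 0) + cmod (Polynomial.coeff p 1) * s"
  have T: "T (e (a, b)) = e (Polynomial.coeff p 0 * a + Polynomial.coeff p 1 * (of_real s * b), Polynomial.coeff p 0 * b)" for a b
    by (simp add: T_def op_poly_nilpotent)
  have "hnorm P (T (e (0, 1))) \<le> op_norm P T * hnorm P (e (0, 1))"
  proof (rule hnorm_le_op_norm[where K = K])
    fix x assume "x \<in> carrier P"
    then obtain a b where x: "x = e (a, b)" by (auto simp: P_simps)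
    show "T x \<in> carrier P" by (simp add: x T P_simps)
    show "T (c \<odot>\<^bsub>P\<^esub> x) = c \<odot>\<^bsub>P\<^esub> T x" for c
      by (simp add: x T P_simps pair_scale_def algebra_simps)
    let ?n = "norm (a, b)"
    have "hnorm P (T x) \<le> cmod (Polynomial.coeff p 0 * a + Polynomial.coeff p 1 * (of_real s * b)) + cmod (Polynomial.coeff p 0 * b)"
      by (simp add: x T hnorm_P norm_Pair_le)
    also have "\<dots> \<le> cmod (Polynomial.coeff p 0) * cmod a + cmod (Polynomial.coeff p 1) * s * cmod b + cmod (Polynomial.coeff p 0) * cmod b"
      using norm_triangle_ineq[of "Polynomial.coeff p 0 * a" "Polynomial.coeff p 1 * (of_real s * b)"] assms
      by (simp add: norm_mult)
    also have "\<dots> \<le> cmod (Polynomial.coeff p 0) * ?n + cmod (Polynomial.coeff p 1) * s * ?n + cmod (Polynomial.coeff p 0) * ?n"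
      using norm_fst_le[of a b] norm_snd_le[of b a] assms by (intro add_mono mult_left_mono) auto
    also have "\<dots> = K * hnorm P x" by (simp add: K_def x hnorm_P algebra_simps)
    finally show "hnorm P (T x) \<le> K * hnorm P x" .
  qed (simp add: P_simps)
  moreover have "hnorm P (e (0, 1)) = 1" by (simp add: hnorm_P norm_prod_def)
  moreover have "s * cmod (Polynomial.coeff p 1) \<le> hnorm P (T (e (0, 1)))"
    using norm_fst_le[of "Polynomial.coeff p 1 * of_real s" "Polynomial.coeff p 0"] assms
    by (simp add: T hnorm_P norm_mult mult.commute)
  ultimately show ?thesis by (simp add: T_def)
qed

end


section \<open>The bounds for the lens constant\<close>

theorem L_bound_le_lens_const:
  fixes \<iota> :: "complex \<Rightarrow> 'u"
  assumes "inj \<iota>" and \<alpha>: "0 < \<alpha>" "\<alpha> \<le> pi / 2"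
  shows "ereal (L_bound \<alpha>) \<le> lens_const TYPE('u) \<alpha>"
proof -
  note sc = sin_cot[OF \<alpha>]
  obtain e :: "complex \<times> complex \<Rightarrow> 'u" where "inj e" using embed_complex_pairs[OF assms(1)] by blast
  then interpret embedded_pairs e by unfold_locales
  define \<beta> where "\<beta> = pi / (2 * \<alpha>)"
  define low where "low = (\<lambda>\<epsilon>. sin \<alpha> * (\<beta> / (1 + \<epsilon>) - \<epsilon>) / (1 + \<epsilon>))"
  have low_le: "ereal (low \<epsilon>) \<le> lens_const TYPE('u) \<alpha>" if \<epsilon>: "\<epsilon> > 0" and pos: "low \<epsilon> > 0" for \<epsilon>
  proof -
    obtain p where p: "\<And>z. z \<in> lens \<alpha> \<Longrightarrow> cmod (poly p z) \<le> 1 + \<epsilon>"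
      "cmod (Polynomial.coeff p 1 - of_real (\<beta> / (1 + \<epsilon>))) \<le> \<epsilon>"
      using lens_extremal_polynomial[OF \<alpha> \<epsilon> \<epsilon>] unfolding \<beta>_def by blast
    define d where "d = \<beta> / (1 + \<epsilon>) - \<epsilon>"
    have d: "d > 0" using pos \<epsilon> sc(1) by (simp add: low_def d_def zero_less_divide_iff zero_less_mult_iff)
    have "\<beta> / (1 + \<epsilon>) \<le> cmod (complex_of_real (\<beta> / (1 + \<epsilon>)))"
      unfolding norm_of_real by (rule abs_ge_self)
    then have dp: "d \<le> cmod (Polynomial.coeff p 1)"
      using p(2) norm_triangle_ineq3[of "Polynomial.coeff p 1" "of_real (\<beta> / (1 + \<epsilon>))"]
      unfolding d_def by linarith
    then have p0: "p \<noteq> 0" using d by auto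
    define M where "M = (SUP z\<in>lens \<alpha>. cmod (poly p z))"
    have ne: "lens \<alpha> \<noteq> {}" using ball_subset_lens[OF \<alpha>, of 0] sc(4) by auto
    have M1: "M \<le> 1 + \<epsilon>" unfolding M_def by (rule cSUP_least[OF ne p(1)])
    have M0: "M > 0"
    proof -
      have "infinite (cball (0 :: complex) (1 / sin \<alpha> - cot \<alpha>))" 
        using uncountable_cball[of "1 / sin \<alpha> - cot \<alpha>" "0 :: complex"] sc(4) countable_finite by auto
      then obtain z where z: "z \<in> cball 0 (1 / sin \<alpha> - cot \<alpha>)" "poly p z \<noteq> 0"
        using poly_roots_finite[OF p0] by (metis (mono_tags, lifting) finite_subset mem_Collect_eq subsetI)
      then have "z \<in> lens \<alpha>" using ball_subset_lens[OF \<alpha>] by simp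
      then have "cmod (poly p z) \<le> M" unfolding M_def by (rule cSUP_upper[OF _ bdd_above_poly_lens])
      then show ?thesis using z(2) by (smt (verit) zero_less_norm_iff)
    qed
    have "low \<epsilon> = sin \<alpha> * d / (1 + \<epsilon>)" by (simp add: low_def d_def)
    also have "\<dots> \<le> sin \<alpha> * cmod (Polynomial.coeff p 1) / M"
      using sc(1) d dp M0 M1 by (intro frac_le mult_left_mono) auto
    also have "\<dots> \<le> op_norm P (op_poly P p (nilpotent (sin \<alpha>))) / M"
      using op_norm_poly_nilpotent[of "sin \<alpha>" p] sc(1) M0 by (intro divide_right_mono) auto
    finally have "ereal (low \<epsilon>) \<le> ereal (op_norm P (op_poly P p (nilpotent (sin \<alpha>))) / M)" by simp
    also have "\<dots> \<le> (SUP p \<in> {p. p \<noteq> 0}. ereal (op_norm P (op_poly P p (nilpotent (sin \<alpha>))) / (SUP z\<in>lens \<alpha>. cmod (poly p z))))"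
      unfolding M_def by (rule SUP_upper) (use p0 in simp)
    also have "\<dots> \<le> lens_const TYPE('u) \<alpha>"
      unfolding lens_const_def
      by (rule SUP_upper2[OF nilpotent_in_lens_operators[OF \<alpha>]]) simp
    finally show ?thesis .
  qed
  have "(low \<longlongrightarrow> sin \<alpha> * (\<beta> / (1 + 0) - 0) / (1 + 0)) (at_right 0)"
    unfolding low_def by (intro tendsto_intros) auto
  then have lim: "(low \<longlongrightarrow> L_bound \<alpha>) (at_right 0)" by (simp add: L_bound_def \<beta>_def mult.commute)
  have L: "L_bound \<alpha> > 0" using \<alpha>(1) sc(1) by (simp add: L_bound_def)
  have "\<forall>\<^sub>F \<epsilon> in at_right 0. ereal (low \<epsilon>) \<le> lens_const TYPE('u) \<alpha>"
    using order_tendstoD(1)[OF lim L] eventually_at_right_less[of "0::real"]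
    by eventually_elim (rule low_le)
  then show ?thesis
    by (intro tendsto_upperbound[OF tendsto_ereal[OF lim]]) auto
qed

theorem proposition10p1:
  fixes \<alpha> :: real and \<iota> :: "complex \<Rightarrow> 'u"
  assumes "inj \<iota>"
    and "0 < \<alpha>" and "\<alpha> \<le> pi / 2"
  shows "(ereal (L_bound \<alpha>) \<le> lens_const TYPE('u) \<alpha> \<and>
          lens_const TYPE('u) \<alpha> \<le> ereal (Min {K25 \<alpha>, K_BC \<alpha>, (pi - \<alpha>) / \<alpha>}))
       \<and> (pi / 6 < \<alpha> \<longrightarrow> lens_const TYPE('u) \<alpha> < 2)"
proof (intro conjI impI)
  have le: "lens_const TYPE('u) \<alpha> \<le> ereal (K25 \<alpha>)"
    by (rule lens_const_le_K25[OF assms(2,3)])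
  show "ereal (L_bound \<alpha>) \<le> lens_const TYPE('u) \<alpha>"
    by (rule L_bound_le_lens_const[OF assms])
  have "K25 \<alpha> \<le> Min {K25 \<alpha>, K_BC \<alpha>, (pi - \<alpha>) / \<alpha>}"
    using K25_le_K_BC[OF assms(2,3)] K25_le_ratio[OF assms(2,3)] by simp
  then show "lens_const TYPE('u) \<alpha> \<le> ereal (Min {K25 \<alpha>, K_BC \<alpha>, (pi - \<alpha>) / \<alpha>})"
    using order_trans[OF le] by simp
  assume "pi / 6 < \<alpha>"
  then have "ereal (K25 \<alpha>) < ereal 2" using K25_less_2 assms(3) by simp
  from le_less_trans[OF le this] show "lens_const TYPE('u) \<alpha> < 2" by simp
qed

end
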